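(* Let $\mathcal{R}=\bigcup_{i=1}^{R}\mathcal{R}_i$ be a finite (piecewise smooth) ribbonization of a surface $S\subset\mathbb{R}^3$ all of whose Cartan surface ribbons $\mathcal{R}_i$ are closed. Let $p_1,\dots,p_P$ be the vertices of $\mathcal{R}$ and let $d_k=d(p_k)$ be the degree of $p_k$. Then the Euler characteristic of the ribbonization $\mathcal{R}$ is $$\chi(\mathcal{R})=\frac12\sum_{k=1}^{P}(2-d_k).$$
   Context: A Cartan surface ribbon along a smooth regular curve $\gamma$ (the center curve) on a surface $S\subset\mathbb{R}^3$ with nowhere vanishing normal curvature is the intrinsically flat (developable) ruled surface $r(t,u)=\gamma(t)+u\,\beta(t)$, $-w_-(t)\le u\le w_+(t)$, where $\beta=(\kappa_n h-\tau_g e)/\sqrt{\kappa_n^2+\tau_g^2}$, with $\{e=\gamma'/\|\gamma'\|,\ h=N\times e,\ N\}$ the Darboux frame of $\gamma$ on $S$ ($N$ a unit normal of $S$ along $\gamma$), $\kappa_n$ the normal curvature and $\tau_g$ the geodesic torsion of $\gamma$, and $w_\pm>0$ width (cut-off) functions. It has the same tangent plane as $S$ along $\gamma$. (Ribbons containing planar patches, obtained by cut and paste along singular rulings where $\kappa_n$ and $\tau_g$ both vanish, are also called Cartan ribbons.) A ribbon is closed if it is based on a closed smooth center curve on $S$; the surface may be orientable or non-orientable, and a closed ribbon may be a cylindrical band or a Möbius strip. A ribbonization $\mathcal{R}=\bigcup_i\mathcal{R}_i$ of $S$ is an approximation of $S$ by Cartan surface ribbons along center curves on $S$, where the ribbons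 are widened along their rulings and cut off where they meet their neighbours (or themselves). The (piecewise smooth) curves along which ribbons meet and are cut off are the wedge curves. The system of wedge curves may have branch points, where three or more ribbons come together, and end points, where one ribbon is locally bent around the wedge and is thus in contact with itself. The branch points and end points are all assumed to be isolated and regular, in the sense that the wedge curves in a neighbourhood of such a point can be mapped diffeomorphically to a star configuration in $\mathbb{R}^3$ with a number of straight line segments issuing from a common vertex. The branch points and end points are called the vertices of $\mathcal{R}$, and the degree $d(p)$ of a vertex $p$ is the number of segments issuing from it. If a ribbon has an isolated cone point (a point fully circumscribed by one ribbon), then this is also a vertex, and its degree is counted as $0$. (Points of degree $2$, where two ribbons meet, contribute zero if counted as vertices.) *)

theory Defs
  imports "HOL-Analysis.Analysis" "HOL-Homology.Homology"
begin

section \<open>Smooth maps, regular surfaces, piecewise smooth curves\<close>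

primrec Ck_on :: "nat \<Rightarrow> 'a::euclidean_space set \<Rightarrow> ('a \<Rightarrow> 'b::euclidean_space) \<Rightarrow> bool" where
  "Ck_on 0 U f \<longleftrightarrow> continuous_on U f"
| "Ck_on (Suc k) U f \<longleftrightarrow>
     f differentiable_on U \<and> (\<forall>v. Ck_on k U (\<lambda>x. frechet_derivative f (at x) v))"

definition smooth_on :: "'a::euclidean_space set \<Rightarrow> ('a \<Rightarrow> 'b::euclidean_space) \<Rightarrow> bool" where
  "smooth_on U f \<longleftrightarrow> open U \<and> (\<forall>k. Ck_on k U f)"

definition regular_surface :: "(real^3) set \<Rightarrow> bool" where
  "regular_surface S \<longleftrightarrow>
     (\<forall>p\<in>S. \<exists>U V (f :: real^2 \<Rightarrow> real^3) g.
        open U \<and> p \<in> U \<and> smooth_on V f \<and> (\<forall>x\<in>V. inj (frechet_derivative f (at x))) \<and>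
        homeomorphism V (S \<inter> U) f g)"

definition tangent_space :: "(real^3) set \<Rightarrow> real^3 \<Rightarrow> (real^3) set" where
  "tangent_space S p =
     {v. \<exists>\<epsilon>>0. \<exists>c. smooth_on {-\<epsilon><..<\<epsilon>} c \<and> c ` {-\<epsilon><..<\<epsilon>} \<subseteq> S \<and> c 0 = p \<and>
           (c has_vector_derivative v) (at 0)}"

definition piecewise_smooth_path :: "(real \<Rightarrow> real^3) \<Rightarrow> bool" where
  "piecewise_smooth_path c \<longleftrightarrow> path c \<and>
     (\<exists>F. finite F \<and>
        (\<forall>a b. 0 \<le> a \<and> a < b \<and> b \<le> 1 \<and> {a<..<b} \<inter> F = {} \<longrightarrow>
           (\<exists>g. smooth_on UNIV g \<and> (\<forall>t\<in>{a..b}. c t = g t))))"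

section \<open>Cartan surface ribbons\<close>

text \<open>A ribbon is recorded on the universal cover: its centre curve is parametrized by the whole
  real line, and \<open>period\<close> is the length of the parameter interval after which a closed ribbon
  closes up. The normal field is a function of the parameter, so it may change sign after one
  period (one-sided surfaces).\<close>

record ribbon =
  center :: "real \<Rightarrow> real^3"
  unormal :: "real \<Rightarrow> real^3"
  ruling :: "real \<Rightarrow> real^3"
  width_neg :: "real \<Rightarrow> real"
  width_pos :: "real \<Rightarrow> real"
  period :: real

definition speed :: "ribbon \<Rightarrow> real \<Rightarrow> real" where
  "speed r t = norm (vector_derivative (center r) (at t))"

definition darboux_e :: "ribbon \<Rightarrow> real \<Rightarrow> real^3" where
  "darboux_e r t = (1 / speed r t) *\<^sub>R vector_derivative (center r) (at t)"

definition darboux_h :: "ribbon \<Rightarrow> real \<Rightarrow> real^3" where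
  "darboux_h r t = cross3 (unormal r t) (darboux_e r t)"

text \<open>Darboux equations with respect to arc length: \<open>e' = \<kappa>\<^sub>g h + \<kappa>\<^sub>n N\<close>,
  \<open>h' = - \<kappa>\<^sub>g e + \<tau>\<^sub>g N\<close>, \<open>N' = - \<kappa>\<^sub>n e - \<tau>\<^sub>g h\<close>. With this sign of the
  geodesic torsion the Cartan direction is orthogonal to \<open>N'\<close>, i.e. the ribbon is developable.\<close>

definition normal_curvature :: "ribbon \<Rightarrow> real \<Rightarrow> real" where
  "normal_curvature r t =
     (vector_derivative (darboux_e r) (at t) \<bullet> unormal r t) / speed r t"

definition geodesic_torsion :: "ribbon \<Rightarrow> real \<Rightarrow> real" where
  "geodesic_torsion r t =
     (vector_derivative (darboux_h r) (at t) \<bullet> unormal r t) / speed r t"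

definition cartan_direction :: "ribbon \<Rightarrow> real \<Rightarrow> real^3" where
  "cartan_direction r t =
     (1 / sqrt ((normal_curvature r t)\<^sup>2 + (geodesic_torsion r t)\<^sup>2)) *\<^sub>R
       (normal_curvature r t *\<^sub>R darboux_h r t - geodesic_torsion r t *\<^sub>R darboux_e r t)"

text \<open>Where the normal curvature does not vanish, the ruling is the line spanned by the Cartan
  direction; the sign is left free because that direction, but not its line, may jump when the
  normal curvature changes sign across a singular ruling (reversing the ruling field just
  exchanges the two width functions). Where the normal curvature vanishes, the geodesic torsion
  must vanish too; these are the singular rulings, resp. the planar patches (on an interval of
  such parameters \<open>N\<close> is constant), and the rulings are then only required to be tangent to the
  surface, transversal to the centre curve and to fit together continuously. Ribbons without
  planar patches are those with nowhere vanishing normal curvature.\<close>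

definition cartan_ribbon :: "(real^3) set \<Rightarrow> ribbon \<Rightarrow> bool" where
  "cartan_ribbon S r \<longleftrightarrow>
     smooth_on UNIV (center r) \<and> range (center r) \<subseteq> S \<and>
     (\<forall>t. vector_derivative (center r) (at t) \<noteq> 0) \<and>
     smooth_on UNIV (unormal r) \<and>
     (\<forall>t. norm (unormal r t) = 1 \<and> (\<forall>v\<in>tangent_space S (center r t). unormal r t \<bullet> v = 0)) \<and>
     continuous_on UNIV (ruling r) \<and> (\<forall>t. norm (ruling r t) = 1) \<and>
     (\<forall>t. normal_curvature r t \<noteq> 0 \<longrightarrow>
        ruling r t = cartan_direction r t \<or> ruling r t = - cartan_direction r t) \<and>
     (\<forall>t. normal_curvature r t = 0 \<longrightarrow>
        geodesic_torsion r t = 0 \<and>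
        ruling r t \<bullet> unormal r t = 0 \<and> ruling r t \<bullet> darboux_h r t \<noteq> 0) \<and>
     continuous_on UNIV (width_neg r) \<and> (\<forall>t. width_neg r t > 0) \<and>
     continuous_on UNIV (width_pos r) \<and> (\<forall>t. width_pos r t > 0)"

text \<open>The two alternatives are the cylindrical band and the Moebius strip.\<close>

definition closed_ribbon :: "ribbon \<Rightarrow> bool" where
  "closed_ribbon r \<longleftrightarrow>
     period r > 0 \<and> (\<forall>t. center r (t + period r) = center r t) \<and>
     ((\<forall>t. ruling r (t + period r) = ruling r t \<and>
           width_neg r (t + period r) = width_neg r t \<and>
           width_pos r (t + period r) = width_pos r t) \<or>
      (\<forall>t. ruling r (t + period r) = - ruling r t \<and>
           width_neg r (t + period r) = width_pos r t \<and>
           width_pos r (t + period r) = width_neg r t))"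

definition ribbon_map :: "ribbon \<Rightarrow> real \<times> real \<Rightarrow> real^3" where
  "ribbon_map r = (\<lambda>(t, u). center r t + u *\<^sub>R ruling r t)"

definition ribbon_dom :: "ribbon \<Rightarrow> (real \<times> real) set" where
  "ribbon_dom r = {(t, u). - width_neg r t \<le> u \<and> u \<le> width_pos r t}"

definition ribbon_inner :: "ribbon \<Rightarrow> (real \<times> real) set" where
  "ribbon_inner r = {(t, u). - width_neg r t < u \<and> u < width_pos r t}"

definition ribbon_edge :: "ribbon \<Rightarrow> (real \<times> real) set" where
  "ribbon_edge r = {(t, u). u = - width_neg r t \<or> u = width_pos r t}"

definition ribbon_set :: "ribbon \<Rightarrow> (real^3) set" where
  "ribbon_set r = ribbon_map r ` ribbon_dom r"

text \<open>Two parameter pairs denote the same point of the (abstract) closed ribbon. The condition on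
  the ruling vectors covers both the band (\<open>u = u'\<close>) and the Moebius strip
  (\<open>u = - u'\<close> after an odd number of periods).\<close>

definition same_param :: "ribbon \<Rightarrow> real \<times> real \<Rightarrow> real \<times> real \<Rightarrow> bool" where
  "same_param r = (\<lambda>(t, u) (t', u').
     (\<exists>n::int. t' = t + of_int n * period r) \<and> u *\<^sub>R ruling r t = u' *\<^sub>R ruling r t')"

section \<open>Closed ribbonizations and their wedge curves\<close>

definition ribbonization_set :: "nat \<Rightarrow> (nat \<Rightarrow> ribbon) \<Rightarrow> (real^3) set" where
  "ribbonization_set R rb = (\<Union>i\<in>{1..R}. ribbon_set (rb i))"

definition edge_set :: "nat \<Rightarrow> (nat \<Rightarrow> ribbon) \<Rightarrow> (real^3) set" where
  "edge_set R rb = (\<Union>i\<in>{1..R}. ribbon_map (rb i) ` ribbon_edge (rb i))"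

definition contact_set :: "nat \<Rightarrow> (nat \<Rightarrow> ribbon) \<Rightarrow> (real^3) set" where
  "contact_set R rb =
     {q. \<exists>i\<in>{1..R}. \<exists>j\<in>{1..R}. \<exists>x\<in>ribbon_edge (rb i). \<exists>y\<in>ribbon_edge (rb j).
           ribbon_map (rb i) x = q \<and> ribbon_map (rb j) y = q \<and>
           \<not> (i = j \<and> same_param (rb i) x y)}"

text \<open>The closure adds the end points: there the edge of a ribbon is folded onto itself, and the
  fold point itself has only one preimage. A cone point is a contact point, since a whole edge
  of the ribbon is collapsed to it.\<close>

definition wedge_set :: "nat \<Rightarrow> (nat \<Rightarrow> ribbon) \<Rightarrow> (real^3) set" where
  "wedge_set R rb = closure (contact_set R rb)"

definition cone_points :: "nat \<Rightarrow> (nat \<Rightarrow> ribbon) \<Rightarrow> (real^3) set" where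
  "cone_points R rb =
     {q. \<exists>i\<in>{1..R}.
           (\<forall>t. ribbon_map (rb i) (t, width_pos (rb i) t) = q) \<or>
           (\<forall>t. ribbon_map (rb i) (t, - width_neg (rb i) t) = q)}"

text \<open>A finite system of piecewise smooth simple arcs and simple closed curves meeting at most in
  their end points.\<close>

definition wedge_curve_system :: "(real \<Rightarrow> real^3) set \<Rightarrow> bool" where
  "wedge_curve_system \<C> \<longleftrightarrow> finite \<C> \<and>
     (\<forall>c\<in>\<C>. piecewise_smooth_path c \<and> simple_path c) \<and>
     (\<forall>c\<in>\<C>. \<forall>c'\<in>\<C>. c \<noteq> c' \<longrightarrow>
        path_image c \<inter> path_image c' \<subseteq>
          {pathstart c, pathfinish c} \<inter> {pathstart c', pathfinish c'})"

definition star_configuration :: "(real^3) set \<Rightarrow> (real^3) set" where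
  "star_configuration D = insert 0 (\<Union>v\<in>D. closed_segment 0 v)"

text \<open>\<open>has_degree W p d\<close>: a diffeomorphism of a neighbourhood of \<open>p\<close> onto a neighbourhood of the
  origin takes \<open>W\<close> to a star of \<open>d\<close> straight segments (\<open>d = 0\<close>: \<open>p\<close> is isolated in \<open>W\<close>).\<close>

definition has_degree :: "(real^3) set \<Rightarrow> real^3 \<Rightarrow> nat \<Rightarrow> bool" where
  "has_degree W p d \<longleftrightarrow>
     (\<exists>D U V \<phi> \<psi>. finite D \<and> card D = d \<and> (\<forall>v\<in>D. norm v = 1) \<and>
        p \<in> U \<and> smooth_on U \<phi> \<and> smooth_on V \<psi> \<and> homeomorphism U V \<phi> \<psi> \<and>
        \<phi> p = 0 \<and> \<phi> ` (W \<inter> U) = star_configuration D \<inter> V)"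

text \<open>The vertices are the branch points, end points and isolated (cone) points of the wedge
  system, i.e. the points near which it is not a single arc passing through the point.\<close>

definition vertices :: "nat \<Rightarrow> (nat \<Rightarrow> ribbon) \<Rightarrow> (real^3) set" where
  "vertices R rb =
     {q \<in> wedge_set R rb.
        \<not> (\<exists>U. open U \<and> q \<in> U \<and> (wedge_set R rb \<inter> U) homeomorphic (UNIV :: real set))}"

text \<open>Ribbons are cut off where they meet, so an interior point of a ribbon lies on no other ribbon
  and is attained once. If \<open>S\<close> has no boundary then normally every edge point lies on a wedge; in
  general (e.g. for a ribbonization of a Moebius band) some edges may be free. The free part of
  the edges being closed means that wedge curves do not run into it, so that a wedge curve can
  terminate only in a branch point or in an end point around which a ribbon is bent.\<close>

definition closed_ribbonization :: "(real^3) set \<Rightarrow> nat \<Rightarrow> (nat \<Rightarrow> ribbon) \<Rightarrow> bool" where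
  "closed_ribbonization S R rb \<longleftrightarrow>
     (\<forall>i\<in>{1..R}. cartan_ribbon S (rb i) \<and> closed_ribbon (rb i)) \<and>
     (\<forall>i\<in>{1..R}. \<forall>j\<in>{1..R}. \<forall>x\<in>ribbon_inner (rb i). \<forall>y\<in>ribbon_dom (rb j).
        ribbon_map (rb i) x = ribbon_map (rb j) y \<longrightarrow> i = j \<and> same_param (rb i) x y) \<and>
     (\<exists>\<C>. wedge_curve_system \<C> \<and>
        wedge_set R rb = (\<Union>c\<in>\<C>. path_image c) \<union> cone_points R rb) \<and>
     closed (edge_set R rb - wedge_set R rb) \<and>
     (\<forall>q\<in>vertices R rb. \<exists>d. has_degree (wedge_set R rb) q d)"

section \<open>Euler characteristic\<close>

definition int_independent :: "('a, 'b) monoid_scheme \<Rightarrow> 'a set \<Rightarrow> bool" where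
  "int_independent G F \<longleftrightarrow>
     (\<forall>c :: 'a \<Rightarrow> int.
        finprod G (\<lambda>x. x [^]\<^bsub>G\<^esub> c x) F = \<one>\<^bsub>G\<^esub> \<longrightarrow> (\<forall>x\<in>F. c x = 0))"

text \<open>Rank of an abelian group.\<close>

definition abelian_rank :: "('a, 'b) monoid_scheme \<Rightarrow> enat" where
  "abelian_rank G =
     (SUP F \<in> {F. finite F \<and> F \<subseteq> carrier G \<and> int_independent G F}. enat (card F))"

definition betti :: "nat \<Rightarrow> 'a topology \<Rightarrow> enat" where
  "betti k X = abelian_rank (homology_group (int k) X)"

definition finite_betti :: "'a topology \<Rightarrow> bool" where
  "finite_betti X \<longleftrightarrow> (\<forall>k. betti k X \<noteq> \<infinity>) \<and> finite {k. betti k X \<noteq> 0}"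

text \<open>Only meaningful under \<open>finite_betti X\<close>.\<close>

definition euler_characteristic :: "'a topology \<Rightarrow> int" where
  "euler_characteristic X = (\<Sum>k | betti k X \<noteq> 0. (-1) ^ k * int (the_enat (betti k X)))"

end

theory Submission
  imports Defs
begin

text \<open>
  Cut every ribbon along the ruling at parameter \<open>0\<close>. The ribbonization then arises from the union
  \<open>E\<close> of all edges by attaching one arc (the cut) and one square (the rest of the ribbon) per ribbon,
  whether the ribbon is a band or a Moebius strip. These contributions cancel, so only the Euler
  characteristic of \<open>E\<close> counts. The free part of the edges consists of disjoint circles and contributes
  \<open>0\<close>, and the wedge system \<open>W\<close> is a graph with \<open>|V| - |C| = 1/2 \<Sum> (2 - deg q)\<close>, the sum running over
  the nodes \<open>q\<close>. The number of edge ends at a node is recovered from the germ of \<open>W\<close> alone, since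
  the Euler characteristic of the pair \<open>(W, W - {q})\<close> is \<open>1 - deg q\<close>; hence it agrees with the
  degree in the sense of diffeomorphic stars, and equals \<open>2\<close> at nodes that are not vertices.

  The ranks of homology groups are additive along the long exact sequence of a pair, and the effect of
  attaching a cell follows by excision.
\<close>

section \<open>Rank of abelian groups\<close>

text \<open>The closed cells are not embedded: an edge may be folded onto itself, shared with
  several ribbons, or collapsed to a cone point. Attaching is therefore formulated for maps that are
  injective on the open cell only and send the boundary anywhere into what is already built. The
  system of wedge curves is not canonical either: a curve may be subdivided, and a closed wedge
  curve carries an arbitrary base point. Hence a node need not be a vertex, and counting edge ends
  must be tied to a local invariant of \<open>W\<close> before degrees can enter. Euler
  characteristics are carried by a relation that states the value together with the finiteness of
  all ranks, because an alternating sum of possibly infinite ranks is meaningless and the conclusion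
  asserts finiteness as well. The free edges are controlled by connectedness: the free part and
  \<open>W\<close> are both closed, so an edge arc traversing one period lies wholly in one of
  them.\<close>

definition rank_of :: "('a, 'b) monoid_scheme \<Rightarrow> 'a set \<Rightarrow> enat" where
  "rank_of G S = (SUP F \<in> {F. finite F \<and> F \<subseteq> S \<and> int_independent G F}. enat (card F))"

text \<open>Indexing by a family allows repeated elements a priori. This suits images under a
  homomorphism and chosen preimages, where distinctness is a consequence of independence.\<close>

definition independent_family :: "('a, 'b) monoid_scheme \<Rightarrow> 'i set \<Rightarrow> ('i \<Rightarrow> 'a) \<Rightarrow> bool" where
  "independent_family G I g \<longleftrightarrow>
     (\<forall>c :: 'i \<Rightarrow> int.
        finprod G (\<lambda>i. g i [^]\<^bsub>G\<^esub> c i) I = \<one>\<^bsub>G\<^esub> \<longrightarrow> (\<forall>i\<in>I. c i = 0))"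

text \<open>\<open>rank_of\<close> takes an arbitrary subset, so kernels and images are measured
  inside the ambient group without turning them into groups of their own.\<close>

lemma abelian_rank_eq_rank_of: "abelian_rank G = rank_of G (carrier G)"
  by (simp add: abelian_rank_def rank_of_def)

lemma rank_of_least:
  assumes "\<And>F. \<lbrakk>finite F; F \<subseteq> S; int_independent G F\<rbrakk> \<Longrightarrow> enat (card F) \<le> r"
  shows "rank_of G S \<le> r"
  unfolding rank_of_def by (rule SUP_least) (use assms in auto)

lemma rank_of_upper:
  "\<lbrakk>finite F; F \<subseteq> S; int_independent G F\<rbrakk> \<Longrightarrow> enat (card F) \<le> rank_of G S"
  unfolding rank_of_def by (rule SUP_upper) auto

lemma int_independent_empty: "int_independent G {}"
  by (simp add: int_independent_def)

text \<open>A supremum in \<open>enat\<close> of an infinite set is infinite, so a finite rank is a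
  maximum over a finite set, nonempty because of the empty family.\<close>

lemma rank_of_attained:
  assumes "rank_of G S \<noteq> \<infinity>"
  obtains F where "finite F" "F \<subseteq> S" "int_independent G F" "enat (card F) = rank_of G S"
proof -
  let ?A = "(\<lambda>F. enat (card F)) ` {F. finite F \<and> F \<subseteq> S \<and> int_independent G F}"
  have ne: "?A \<noteq> {}" using int_independent_empty by blast
  have "finite ?A" using assms ne unfolding rank_of_def Sup_enat_def by (auto split: if_splits)
  then have "rank_of G S \<in> ?A"
    using ne Max_in unfolding rank_of_def Sup_enat_def by (metis (no_types, lifting))
  then show ?thesis using that by auto
qed

section \<open>Integer combinations in a commutative group\<close>

context comm_group
begin

lemma int_pow_finprod:
  assumes "finite A" "f \<in> A \<rightarrow> carrier G"
  shows "(finprod G f A) [^] (k::int) = finprod G (\<lambda>x. f x [^] k) A"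
  using assms
proof (induction A rule: finite_induct)
  case (insert x A)
  then have "f \<in> A \<rightarrow> carrier G" "f x \<in> carrier G" by auto
  moreover have "(\<lambda>x. f x [^] k) \<in> A \<rightarrow> carrier G" using insert by auto
  ultimately show ?case using insert by (simp add: int_pow_distrib)
qed (simp add: int_pow_one)

text \<open>Additively: the combination with coefficients \<open>a x\<close> of the elements
  \<open>\<Sum>y. c x y * g y\<close> is a combination of the \<open>g y\<close>, by exchanging two
  finite sums.\<close>

lemma finprod_int_pow_swap:
  assumes "finite E" "finite F" "g \<in> F \<rightarrow> carrier G"
  shows "finprod G (\<lambda>x. (finprod G (\<lambda>y. g y [^] (c x y :: int)) F) [^] (a x :: int)) E
       = finprod G (\<lambda>y. g y [^] (\<Sum>x\<in>E. c x y * a x)) F"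
  using assms(1)
proof (induction E rule: finite_induct)
  case empty
  have "finprod G (\<lambda>y. g y [^] (0::int)) F = \<one>"
    by (rule finprod_one_eqI) simp
  then show ?case by simp
next
  case (insert x E)
  have cl: "(\<lambda>y. g y [^] (k y :: int)) \<in> F \<rightarrow> carrier G" for k
    using assms(3) by auto
  have gy: "g y \<in> carrier G" if "y \<in> F" for y using assms(3) that by auto
  have "finprod G (\<lambda>x. (finprod G (\<lambda>y. g y [^] c x y) F) [^] a x) (insert x E)
      = (finprod G (\<lambda>y. g y [^] c x y) F) [^] a x \<otimes> finprod G (\<lambda>y. g y [^] (\<Sum>x\<in>E. c x y * a x)) F"
    using insert cl by (subst finprod_insert) auto
  also have "(finprod G (\<lambda>y. g y [^] c x y) F) [^] a x = finprod G (\<lambda>y. (g y [^] c x y) [^] a x) F"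
    by (rule int_pow_finprod) (use assms cl in auto)
  also have "\<dots> = finprod G (\<lambda>y. g y [^] (c x y * a x)) F"
    by (rule finprod_cong') (use assms gy in \<open>auto simp: int_pow_pow\<close>)
  also have "\<dots> \<otimes> finprod G (\<lambda>y. g y [^] (\<Sum>x\<in>E. c x y * a x)) F
      = finprod G (\<lambda>y. g y [^] (c x y * a x) \<otimes> g y [^] (\<Sum>x\<in>E. c x y * a x)) F"
    by (rule finprod_multf[symmetric]) (use cl in auto)
  also have "\<dots> = finprod G (\<lambda>y. g y [^] (\<Sum>x\<in>insert x E. c x y * a x)) F"
    by (rule finprod_cong') (use insert assms gy in \<open>auto simp: int_pow_mult\<close>)
  finally show ?case .
qed

lemma finprod_single_int_pow:
  assumes "finite I" "i \<in> I" "g \<in> I \<rightarrow> carrier G"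
  shows "finprod G (\<lambda>j. g j [^] (if j = i then k else 0 :: int)) I = g i [^] k"
proof -
  have "finprod G (\<lambda>j. g j [^] (if j = i then k else 0 :: int)) I
      = finprod G (\<lambda>j. if i = j then g j [^] k else \<one>) I"
    by (rule finprod_cong') (use assms in \<open>auto simp: Pi_iff\<close>)
  also have "\<dots> = g i [^] k"
    using assms by (intro finprod_singleton) auto
  finally show ?thesis .
qed

lemma independent_family_inj_on:
  assumes "finite I" "g \<in> I \<rightarrow> carrier G" "independent_family G I g"
  shows "inj_on g I"
proof (rule inj_onI, rule ccontr)
  fix i j assume ij: "i \<in> I" "j \<in> I" "g i = g j" "i \<noteq> j"
  \<comment> \<open>The relation \<open>g i - g j = 0\<close>, written as a sum of two unit vectors
    so that the product splits into two single powers.\<close>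
  define c where "c = (\<lambda>k. (if k = i then 1 else 0 :: int) + (if k = j then -1 else 0))"
  have cl: "g k \<in> carrier G" if "k \<in> I" for k using assms that by auto
  have "finprod G (\<lambda>k. g k [^] c k) I
      = finprod G (\<lambda>k. g k [^] (if k = i then 1 else 0 :: int) \<otimes> g k [^] (if k = j then -1 else 0 :: int)) I"
    by (rule finprod_cong') (use cl in \<open>auto simp: c_def int_pow_mult\<close>)
  also have "\<dots> = finprod G (\<lambda>k. g k [^] (if k = i then 1 else 0 :: int)) I
      \<otimes> finprod G (\<lambda>k. g k [^] (if k = j then -1 else 0 :: int)) I"
    by (rule finprod_multf) (use cl in auto)
  also have "\<dots> = g i [^] (1::int) \<otimes> g j [^] (-1::int)"
    using assms ij by (simp add: finprod_single_int_pow)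
  also have "\<dots> = \<one>"
    using ij cl by (simp add: int_pow_neg int_pow_1)
  finally have "c i = 0" using assms(3) ij unfolding independent_family_def by blast
  then show False using ij by (simp add: c_def)
qed

lemma independent_family_card_le_rank_of:
  assumes "finite I" "g \<in> I \<rightarrow> S" "S \<subseteq> carrier G" "independent_family G I g"
  shows "enat (card I) \<le> rank_of G S"
proof -
  have gc: "g \<in> I \<rightarrow> carrier G" using assms by auto
  have inj: "inj_on g I" using independent_family_inj_on assms gc by blast
  have "int_independent G (g ` I)"
    unfolding int_independent_def
  proof (intro allI impI)
    fix c :: "'a \<Rightarrow> int"
    assume "finprod G (\<lambda>x. x [^] c x) (g ` I) = \<one>"
    moreover have "(\<lambda>x. x [^] c x) \<in> g ` I \<rightarrow> carrier G" using gc by auto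
    ultimately have "finprod G (\<lambda>i. g i [^] c (g i)) I = \<one>"
      using finprod_reindex[of "\<lambda>x. x [^] c x" g I] inj by simp
    then show "\<forall>x\<in>g ` I. c x = 0"
      using assms(4)[unfolded independent_family_def, THEN spec, of "\<lambda>i. c (g i)"] by blast
  qed
  then have "enat (card (g ` I)) \<le> rank_of G S"
    using assms by (intro rank_of_upper) auto
  then show ?thesis using inj by (simp add: card_image)
qed

text \<open>Taking all exponents equal to 1 gives a relation, so only the empty set is
  independent.\<close>

lemma rank_of_one: "rank_of G {\<one>} = 0"
proof -
  have "rank_of G {\<one>} \<le> 0"
  proof (rule rank_of_least)
    fix F assume F: "finite F" "F \<subseteq> {\<one>}" "int_independent G F"
    have "finprod G (\<lambda>x. x [^] (1::int)) F = \<one>"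
      by (rule finprod_one_eqI) (use F in \<open>auto simp: int_pow_one\<close>)
    then have "\<forall>x\<in>F. (1::int) = 0"
      using F(3)[unfolded int_independent_def, THEN spec, of "\<lambda>_. 1"] by blast
    then have "F = {}" by auto
    then show "enat (card F) \<le> 0" by (simp add: zero_enat_def)
  qed
  then show ?thesis by simp
qed

end

section \<open>Additivity of the rank along a homomorphism\<close>

lemma hom_finprod_comm_group:
  assumes "comm_group G" "comm_group H" "f \<in> hom G H" "finite A" "g \<in> A \<rightarrow> carrier G"
  shows "f (finprod G g A) = finprod H (\<lambda>x. f (g x)) A"
proof -
  interpret G: comm_group G by fact
  interpret H: comm_group H by fact
  interpret group_hom G H f using assms by unfold_locales
  show ?thesis
    using assms(4,5)
  proof (induction A rule: finite_induct)
    case (insert x A)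
    then have "g y \<in> carrier G" if "y \<in> insert x A" for y using that by blast
    then have "(\<lambda>x. f (g x)) \<in> A \<rightarrow> carrier H" "f (g x) \<in> carrier H" "g \<in> A \<rightarrow> carrier G" "g x \<in> carrier G"
      by auto
    then show ?case using insert by simp
  qed simp
qed

text \<open>For an independent \<open>F\<close> take a maximal \<open>F1 \<subseteq> F\<close> on which \<open>f\<close> is independent; each
  further element of \<open>F\<close> yields a relation modulo \<open>F1\<close>, hence an element of the kernel, and these
  elements are independent. No exchange lemma is needed.\<close>

lemma independent_card_le_kernel_image:
  assumes "comm_group G" "comm_group H" "f \<in> hom G H"
    and F: "finite F" "F \<subseteq> carrier G" "int_independent G F"
  shows "enat (card F) \<le> rank_of G (kernel G H f) + rank_of H (f ` carrier G)"
proof -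
  interpret G: comm_group G by fact
  interpret H: comm_group H by fact
  interpret group_hom G H f using assms by unfold_locales
  define Q where "Q = {F1. F1 \<subseteq> F \<and> independent_family H F1 f}"
  have "finite Q" unfolding Q_def using F by auto
  moreover have "{} \<in> Q" by (simp add: Q_def independent_family_def)
  ultimately obtain F1 where F1: "F1 \<in> Q" and mx: "\<And>F2. F2 \<in> Q \<Longrightarrow> F1 \<subseteq> F2 \<Longrightarrow> F2 = F1"
    using finite_has_maximal[of Q] by (metis empty_iff)
  have F1F: "F1 \<subseteq> F" and F1i: "independent_family H F1 f" using F1 by (auto simp: Q_def)
  have fin1: "finite F1" using F1F F finite_subset by blast
  have Fc: "y \<in> carrier G" if "y \<in> F" for y using F that by auto
  have rel: "\<exists>c. c x \<noteq> (0::int) \<and> (\<forall>y. y \<notin> insert x F1 \<longrightarrow> c y = 0)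
      \<and> finprod G (\<lambda>y. y [^]\<^bsub>G\<^esub> c y) F \<in> kernel G H f" if x: "x \<in> F - F1" for x
  proof -
    have "insert x F1 \<notin> Q" using mx x by blast
    then have "\<not> independent_family H (insert x F1) f" using x F1F by (auto simp: Q_def)
    then obtain c' where c': "finprod H (\<lambda>i. f i [^]\<^bsub>H\<^esub> (c' i :: int)) (insert x F1) = \<one>\<^bsub>H\<^esub>"
      and nz: "\<exists>i\<in>insert x F1. c' i \<noteq> 0" unfolding independent_family_def by blast
    \<comment> \<open>Otherwise the relation would live on \<open>F1\<close> alone, where
      \<open>f\<close> is independent.\<close>
    have cx: "c' x \<noteq> 0"
    proof
      assume "c' x = 0"
      then have "finprod H (\<lambda>i. f i [^]\<^bsub>H\<^esub> (c' i :: int)) F1 = \<one>\<^bsub>H\<^esub>"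
        using c' x fin1 F1F Fc by (subst (asm) H.finprod_insert) (auto simp: subset_iff Pi_iff)
      then have "\<forall>i\<in>F1. c' i = 0" using F1i unfolding independent_family_def by blast
      then show False using nz \<open>c' x = 0\<close> by auto
    qed
    define c where "c = (\<lambda>y. if y \<in> insert x F1 then c' y else 0)"
    have "f (finprod G (\<lambda>y. y [^]\<^bsub>G\<^esub> c y) F) = finprod H (\<lambda>y. f (y [^]\<^bsub>G\<^esub> c y)) F"
      by (rule hom_finprod_comm_group) (use assms Fc in auto)
    also have "\<dots> = finprod H (\<lambda>y. f y [^]\<^bsub>H\<^esub> c' y) (insert x F1)"
      by (rule H.finprod_mono_neutral_cong_right)
         (use F x F1F Fc in \<open>auto simp: c_def hom_int_pow\<close>)
    also have "\<dots> = \<one>\<^bsub>H\<^esub>" by (rule c')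
    finally have "finprod G (\<lambda>y. y [^]\<^bsub>G\<^esub> c y) F \<in> kernel G H f"
      unfolding kernel_def using Fc by (auto intro!: G.finprod_closed)
    then show ?thesis using cx by (intro exI[of _ c]) (auto simp: c_def)
  qed
  then obtain C where C1: "\<And>x. x \<in> F - F1 \<Longrightarrow> C x x \<noteq> (0::int)"
    and C2: "\<And>x y. x \<in> F - F1 \<Longrightarrow> y \<notin> insert x F1 \<Longrightarrow> C x y = 0"
    and C3: "\<And>x. x \<in> F - F1 \<Longrightarrow> finprod G (\<lambda>y. y [^]\<^bsub>G\<^esub> C x y) F \<in> kernel G H f"
    by metis
  have ind: "independent_family G (F - F1) (\<lambda>x. finprod G (\<lambda>y. y [^]\<^bsub>G\<^esub> C x y) F)"
    unfolding independent_family_def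
  proof (intro allI impI ballI)
    fix a :: "_ \<Rightarrow> int" and y
    assume a: "finprod G (\<lambda>x. finprod G (\<lambda>y. y [^]\<^bsub>G\<^esub> C x y) F [^]\<^bsub>G\<^esub> a x) (F - F1) = \<one>\<^bsub>G\<^esub>"
      and y: "y \<in> F - F1"
    have "finprod G (\<lambda>y. y [^]\<^bsub>G\<^esub> (\<Sum>x\<in>F-F1. C x y * a x)) F = \<one>\<^bsub>G\<^esub>"
      using G.finprod_int_pow_swap[of "F - F1" F "\<lambda>y. y" C a] F a by (auto simp: subset_iff Pi_iff)
    then have "(\<Sum>x\<in>F-F1. C x y * a x) = 0"
      using F(3)[unfolded int_independent_def, THEN spec, of "\<lambda>y. \<Sum>x\<in>F-F1. C x y * a x"] y by blast
    \<comment> \<open>Row \<open>x\<close> of \<open>C\<close> is supported on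
      \<open>insert x F1\<close>. Restricted to \<open>F - F1\<close> the matrix is diagonal with
      nonzero diagonal entries, so the relation determines \<open>a y\<close> separately for each
      \<open>y\<close>.\<close>
    moreover have "(\<Sum>x\<in>F-F1. C x y * a x) = (\<Sum>x\<in>F-F1. if x = y then C y y * a y else 0)"
      by (rule sum.cong) (use C2 y in auto)
    ultimately show "a y = 0" using C1[OF y] y F by simp
  qed
  have "enat (card (F - F1)) \<le> rank_of G (kernel G H f)"
    by (rule G.independent_family_card_le_rank_of[OF _ _ _ ind])
       (use F C3 in \<open>auto simp: kernel_def\<close>)
  moreover have "enat (card F1) \<le> rank_of H (f ` carrier G)"
    by (rule H.independent_family_card_le_rank_of[OF _ _ _ F1i])
       (use fin1 F1F F in auto)
  moreover have "card F = card (F - F1) + card F1"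
    using F1F F fin1 by (simp add: card_Diff_subset card_mono)
  ultimately show ?thesis by (metis add_mono plus_enat_simps(1))
qed

text \<open>Preimages of independent elements of the image stay independent next to independent
  kernel elements: applying \<open>f\<close> to a relation removes the kernel part and kills the
  coefficients of the preimages, and what remains is a relation in the kernel.\<close>

lemma kernel_image_card_le_rank:
  assumes "comm_group G" "comm_group H" "f \<in> hom G H"
    and F1: "finite F1" "F1 \<subseteq> kernel G H f" "int_independent G F1"
    and F2: "finite F2" "F2 \<subseteq> f ` carrier G" "int_independent H F2"
  shows "enat (card F1 + card F2) \<le> abelian_rank G"
proof -
  interpret G: comm_group G by fact
  interpret H: comm_group H by fact
  interpret group_hom G H f using assms by unfold_locales
  define s where "s = inv_into (carrier G) f"
  have s: "s y \<in> carrier G" "f (s y) = y" if "y \<in> F2" for y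
    using that F2 unfolding s_def by (auto simp: inv_into_into f_inv_into_f subset_iff)
  have k: "x \<in> carrier G" "f x = \<one>\<^bsub>H\<^esub>" if "x \<in> F1" for x
    using that F1 unfolding kernel_def by auto
  define g where "g = case_sum (\<lambda>x. x) s"
  \<comment> \<open>The disjoint sum keeps the two index sets apart even where a kernel element and
    a chosen preimage could coincide as group elements.\<close>
  define I where "I = Sum_Type.Plus F1 F2"
  have g: "g \<in> I \<rightarrow> carrier G" using s k unfolding g_def I_def by auto
  have "independent_family G I g"
    unfolding independent_family_def
  proof (intro allI impI)
    fix c :: "_ \<Rightarrow> int"
    assume c: "finprod G (\<lambda>i. g i [^]\<^bsub>G\<^esub> c i) I = \<one>\<^bsub>G\<^esub>"
    have "finprod G (\<lambda>i. g i [^]\<^bsub>G\<^esub> c i) I =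
        finprod G (\<lambda>i. g i [^]\<^bsub>G\<^esub> c i) (Inl ` F1) \<otimes>\<^bsub>G\<^esub> finprod G (\<lambda>i. g i [^]\<^bsub>G\<^esub> c i) (Inr ` F2)"
      unfolding I_def Plus_def
      by (rule G.finprod_Un_disjoint) (use F1 F2 g in \<open>auto simp: I_def\<close>)
    also have "finprod G (\<lambda>i. g i [^]\<^bsub>G\<^esub> c i) (Inl ` F1) = finprod G (\<lambda>x. x [^]\<^bsub>G\<^esub> c (Inl x)) F1"
      by (subst G.finprod_reindex) (use k in \<open>auto simp: g_def\<close>)
    also have "finprod G (\<lambda>i. g i [^]\<^bsub>G\<^esub> c i) (Inr ` F2) = finprod G (\<lambda>y. s y [^]\<^bsub>G\<^esub> c (Inr y)) F2"
      by (subst G.finprod_reindex) (use s in \<open>auto simp: g_def\<close>)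
    finally have eq: "finprod G (\<lambda>x. x [^]\<^bsub>G\<^esub> c (Inl x)) F1 \<otimes>\<^bsub>G\<^esub> finprod G (\<lambda>y. s y [^]\<^bsub>G\<^esub> c (Inr y)) F2 = \<one>\<^bsub>G\<^esub>"
      using c by simp
    have c1: "finprod G (\<lambda>x. x [^]\<^bsub>G\<^esub> c (Inl x)) F1 \<in> carrier G"
      using k by (auto intro!: G.finprod_closed)
    have c2: "finprod G (\<lambda>y. s y [^]\<^bsub>G\<^esub> c (Inr y)) F2 \<in> carrier G"
      using s by (auto intro!: G.finprod_closed)
    have f1: "f (finprod G (\<lambda>x. x [^]\<^bsub>G\<^esub> c (Inl x)) F1) = \<one>\<^bsub>H\<^esub>"
    proof -
      have "f (finprod G (\<lambda>x. x [^]\<^bsub>G\<^esub> c (Inl x)) F1) = finprod H (\<lambda>x. f (x [^]\<^bsub>G\<^esub> c (Inl x))) F1"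
        by (rule hom_finprod_comm_group) (use assms k in auto)
      also have "\<dots> = \<one>\<^bsub>H\<^esub>"
        by (rule H.finprod_one_eqI) (use k in \<open>auto simp: hom_int_pow H.int_pow_one\<close>)
      finally show ?thesis .
    qed
    have f2: "f (finprod G (\<lambda>y. s y [^]\<^bsub>G\<^esub> c (Inr y)) F2) = finprod H (\<lambda>y. y [^]\<^bsub>H\<^esub> c (Inr y)) F2"
    proof -
      have "f (finprod G (\<lambda>y. s y [^]\<^bsub>G\<^esub> c (Inr y)) F2) = finprod H (\<lambda>y. f (s y [^]\<^bsub>G\<^esub> c (Inr y))) F2"
        by (rule hom_finprod_comm_group) (use assms s in auto)
      also have "\<dots> = finprod H (\<lambda>y. y [^]\<^bsub>H\<^esub> c (Inr y)) F2"
        by (rule H.finprod_cong') (use s F2 in \<open>auto simp: hom_int_pow subset_iff\<close>)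
      finally show ?thesis .
    qed
    have cH: "finprod H (\<lambda>y. y [^]\<^bsub>H\<^esub> c (Inr y)) F2 \<in> carrier H"
      using f2 c2 hom_closed by metis
    have "f (finprod G (\<lambda>x. x [^]\<^bsub>G\<^esub> c (Inl x)) F1 \<otimes>\<^bsub>G\<^esub> finprod G (\<lambda>y. s y [^]\<^bsub>G\<^esub> c (Inr y)) F2) = \<one>\<^bsub>H\<^esub>"
      using eq by simp
    then have "finprod H (\<lambda>y. y [^]\<^bsub>H\<^esub> c (Inr y)) F2 = \<one>\<^bsub>H\<^esub>"
      using f1 f2 c1 c2 cH by (simp)
    then have z2: "\<forall>y\<in>F2. c (Inr y) = 0"
      using F2(3) int_independent_def[of H F2] by (auto dest: spec[of _ "\<lambda>y. c (Inr y)"])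
    then have "finprod G (\<lambda>y. s y [^]\<^bsub>G\<^esub> c (Inr y)) F2 = \<one>\<^bsub>G\<^esub>"
      by (intro G.finprod_one_eqI) auto
    then have "finprod G (\<lambda>x. x [^]\<^bsub>G\<^esub> c (Inl x)) F1 = \<one>\<^bsub>G\<^esub>"
      using eq c1 by simp
    then have "\<forall>x\<in>F1. c (Inl x) = 0"
      using F1(3) int_independent_def[of G F1] by (auto dest: spec[of _ "\<lambda>y. c (Inl y)"])
    with z2 show "\<forall>i\<in>I. c i = 0" by (auto simp: I_def)
  qed
  then have "enat (card I) \<le> rank_of G (carrier G)"
    using G.independent_family_card_le_rank_of[of I g "carrier G"] g F1 F2
    by (auto simp: I_def)
  then show ?thesis
    using F1 F2 by (simp add: I_def abelian_rank_eq_rank_of card_Plus)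
qed

lemma rank_kernel_plus_image:
  assumes "comm_group G" "comm_group H" "f \<in> hom G H"
  shows "abelian_rank G = rank_of G (kernel G H f) + rank_of H (f ` carrier G)"
proof (rule antisym)
  show "abelian_rank G \<le> rank_of G (kernel G H f) + rank_of H (f ` carrier G)"
    unfolding abelian_rank_eq_rank_of
    by (rule rank_of_least) (rule independent_card_le_kernel_image[OF assms])
  show "rank_of G (kernel G H f) + rank_of H (f ` carrier G) \<le> abelian_rank G"
  \<comment> \<open>An infinite rank makes the bound trivial. For a finite one, taking one of the
    two families empty shows that both summands are finite, hence attained.\<close>
  proof (cases "abelian_rank G")
    case (enat n)
    have "rank_of G (kernel G H f) \<le> enat n"
      using kernel_image_card_le_rank[OF assms _ _ _ finite.emptyI empty_subsetI int_independent_empty] enat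
      by (intro rank_of_least) auto
    moreover have "rank_of H (f ` carrier G) \<le> enat n"
      using kernel_image_card_le_rank[OF assms finite.emptyI empty_subsetI int_independent_empty] enat
      by (intro rank_of_least) auto
    ultimately obtain F1 F2 where
      F1: "finite F1" "F1 \<subseteq> kernel G H f" "int_independent G F1" "enat (card F1) = rank_of G (kernel G H f)"
      and F2: "finite F2" "F2 \<subseteq> f ` carrier G" "int_independent H F2" "enat (card F2) = rank_of H (f ` carrier G)"
      by (metis enat_ord_simps(5) infinity_ileE rank_of_attained)
    show ?thesis
      using kernel_image_card_le_rank[OF assms F1(1-3) F2(1-3)] F1(4) F2(4)
      by (metis plus_enat_simps(1))
  qed simp
qed

lemma abelian_rank_iso:
  assumes "comm_group G" "comm_group H" "G \<cong> H"
  shows "abelian_rank G = abelian_rank H"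
proof -
  interpret G: comm_group G by fact
  interpret H: comm_group H by fact
  obtain f where f: "f \<in> iso G H" using assms(3) by (auto simp: is_iso_def)
  interpret group_hom G H f using f by unfold_locales (auto simp: Group.iso_iff)
  have "kernel G H f = {\<one>\<^bsub>G\<^esub>}"
    using f inj_iff_trivial_ker Group.iso_iff[of f G H] by blast
  moreover have "f ` carrier G = carrier H" using f Group.iso_iff[of f G H] by blast
  ultimately show ?thesis
    using rank_kernel_plus_image[OF assms(1,2), of f] homh G.rank_of_one
    by (simp add: abelian_rank_eq_rank_of)
qed

lemma abelian_rank_trivial:
  assumes "comm_group G" "trivial_group G"
  shows "abelian_rank G = 0"
  using comm_group.rank_of_one[OF assms(1)] assms(2)
  by (simp add: abelian_rank_eq_rank_of trivial_group_def)

lemma abelian_rank_integer_group: "abelian_rank integer_group = 1"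
proof (rule antisym)
  interpret comm_group integer_group by (rule abelian_integer_group)
  show "abelian_rank integer_group \<le> 1"
    unfolding abelian_rank_eq_rank_of
  proof (rule rank_of_least)
    fix F assume F: "finite F" "int_independent integer_group F"
    have "card F \<le> 1"
    proof (rule ccontr)
      assume "\<not> card F \<le> 1"
      then obtain a b where ab: "a \<in> F" "b \<in> F" "a \<noteq> b"
        by (metis One_nat_def card_le_Suc0_iff_eq F(1))
      \<comment> \<open>Two integers always satisfy \<open>b * a - a * b = 0\<close>. Independence
        would force both coefficients, \<open>b\<close> and \<open>- a\<close>, to vanish, against
        \<open>a \<noteq> b\<close>.\<close>
      define c where "c = (\<lambda>k. (if k = a then b else 0 :: int) + (if k = b then - a else 0))"
      have "finprod integer_group (\<lambda>k. k [^]\<^bsub>integer_group\<^esub> c k) F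
        = finprod integer_group (\<lambda>k. k [^]\<^bsub>integer_group\<^esub> (if k = a then b else 0 :: int)
             \<otimes>\<^bsub>integer_group\<^esub> k [^]\<^bsub>integer_group\<^esub> (if k = b then -a else 0 :: int)) F"
        by (rule finprod_cong') (auto simp: c_def algebra_simps)
      also have "\<dots> = finprod integer_group (\<lambda>k. k [^]\<^bsub>integer_group\<^esub> (if k = a then b else 0 :: int)) F
         \<otimes>\<^bsub>integer_group\<^esub> finprod integer_group (\<lambda>k. k [^]\<^bsub>integer_group\<^esub> (if k = b then -a else 0 :: int)) F"
        by (rule finprod_multf) auto
      also have "\<dots> = a [^]\<^bsub>integer_group\<^esub> b \<otimes>\<^bsub>integer_group\<^esub> b [^]\<^bsub>integer_group\<^esub> (-a)"
        using finprod_single_int_pow[of F a "\<lambda>x. x"] finprod_single_int_pow[of F b "\<lambda>x. x"] F ab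
        by auto
      also have "\<dots> = \<one>\<^bsub>integer_group\<^esub>" by simp
      finally have "\<forall>x\<in>F. c x = 0" using F(2) unfolding int_independent_def by blast
      then have "c a = 0" "c b = 0" using ab by auto
      then show False using ab by (auto simp: c_def split: if_splits)
    qed
    then show "enat (card F) \<le> 1" by (simp add: one_enat_def)
  qed
  have "int_independent integer_group {1}"
    by (auto simp: int_independent_def)
  then show "1 \<le> abelian_rank integer_group"
    using rank_of_upper[of "{1::int}" UNIV integer_group]
    by (simp add: abelian_rank_eq_rank_of one_enat_def)
qed

section \<open>Euler characteristic of pairs of spaces\<close>

text \<open>Degrees range over the integers so that the degree shift of the boundary map is a
  bijection on indices; no boundary case at degree 0 arises.\<close>

definition finite_ranks :: "(int \<Rightarrow> enat) \<Rightarrow> bool" where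
  "finite_ranks f \<longleftrightarrow> (\<forall>k. f k \<noteq> \<infinity>) \<and> finite {k. f k \<noteq> 0}"

definition alternating_sum :: "(int \<Rightarrow> enat) \<Rightarrow> int" where
  "alternating_sum f = (\<Sum>k | f k \<noteq> 0. (if even k then 1 else -1) * int (the_enat (f k)))"

text \<open>The implication from the sum to the summands is what yields finiteness of the image
  ranks from finiteness of two terms of the exact sequence.\<close>

lemma finite_ranks_add: "finite_ranks (\<lambda>k. f k + g k) \<longleftrightarrow> finite_ranks f \<and> finite_ranks g"
proof -
  have "{k. f k + g k \<noteq> 0} = {k. f k \<noteq> 0} \<union> {k. g k \<noteq> 0}" by auto
  moreover have "(\<forall>k. f k + g k \<noteq> \<infinity>) \<longleftrightarrow> (\<forall>k. f k \<noteq> \<infinity>) \<and> (\<forall>k. g k \<noteq> \<infinity>)"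
    by (simp only: plus_eq_infty_iff_enat de_Morgan_disj all_conj_distrib)
  ultimately show ?thesis unfolding finite_ranks_def by (simp only: finite_Un) blast
qed

lemma bij_betw_shift_support: "bij_betw (\<lambda>k. k + 1) {k::int. f (k + 1) \<noteq> (0::enat)} {k. f k \<noteq> 0}"
  by (rule bij_betw_byWitness[where f' = "\<lambda>k. k - 1"]) auto

lemma finite_ranks_shift: "finite_ranks (\<lambda>k. f (k + 1)) \<longleftrightarrow> finite_ranks f"
proof -
  have "(\<forall>k. f (k + 1) \<noteq> \<infinity>) \<longleftrightarrow> (\<forall>k. f k \<noteq> \<infinity>)" by (metis diff_add_cancel)
  then show ?thesis
    using bij_betw_finite[OF bij_betw_shift_support[of f]] by (simp add: finite_ranks_def)
qed

lemma alternating_sum_superset: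
  assumes "finite K" "{k. f k \<noteq> 0} \<subseteq> K"
  shows "alternating_sum f = (\<Sum>k\<in>K. (if even k then 1 else -1) * int (the_enat (f k)))"
  unfolding alternating_sum_def
  by (rule sum.mono_neutral_left) (use assms in \<open>auto simp: zero_enat_def\<close>)

lemma alternating_sum_add:
  assumes "finite_ranks f" "finite_ranks g"
  shows "alternating_sum (\<lambda>k. f k + g k) = alternating_sum f + alternating_sum g"
proof -
  define K where "K = {k. f k \<noteq> 0} \<union> {k. g k \<noteq> 0}"
  have K: "finite K" using assms by (simp add: K_def finite_ranks_def)
  have "int (the_enat (f k + g k)) = int (the_enat (f k)) + int (the_enat (g k))" for k
  proof -
    obtain a b where "f k = enat a" "g k = enat b"
      using assms unfolding finite_ranks_def by (metis enat.exhaust)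
    then show ?thesis by simp
  qed
  moreover have "{k. f k + g k \<noteq> 0} \<subseteq> K" "{k. f k \<noteq> 0} \<subseteq> K" "{k. g k \<noteq> 0} \<subseteq> K"
    by (auto simp: K_def)
  ultimately show ?thesis
    by (simp only: alternating_sum_superset[OF K] distrib_left sum.distrib)
qed

lemma alternating_sum_shift: "alternating_sum (\<lambda>k. f (k + 1)) = - alternating_sum f"
proof -
  have "alternating_sum f
      = (\<Sum>k | f (k + 1) \<noteq> 0. (if even (k + 1) then 1 else -1) * int (the_enat (f (k + 1))))"
    unfolding alternating_sum_def
    by (rule sum.reindex_bij_betw[symmetric]) (rule bij_betw_shift_support)
  also have "\<dots> = - alternating_sum (\<lambda>k. f (k + 1))"
    unfolding alternating_sum_def sum_negf[symmetric] by (rule sum.cong) auto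
  finally show ?thesis by simp
qed

section \<open>Euler characteristic along the long exact sequence of a pair\<close>

definition pair_rank :: "'a topology \<Rightarrow> 'a set \<Rightarrow> int \<Rightarrow> enat" where
  "pair_rank X A k = abelian_rank (relative_homology_group k X A)"

definition has_euler :: "'a topology \<Rightarrow> 'a set \<Rightarrow> int \<Rightarrow> bool" where
  "has_euler X A n \<longleftrightarrow> finite_ranks (pair_rank X A) \<and> alternating_sum (pair_rank X A) = n"

lemma has_euler_unique: "has_euler X A m \<Longrightarrow> has_euler X A n \<Longrightarrow> m = n"
  by (simp add: has_euler_def)

lemma has_euler_iso:
  assumes "\<And>k. relative_homology_group k X A \<cong> relative_homology_group k Y B"
  shows "has_euler X A n \<longleftrightarrow> has_euler Y B n"
proof -
  have "pair_rank X A = pair_rank Y B"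
    unfolding pair_rank_def by (rule ext, rule abelian_rank_iso) (use assms in auto)
  then show ?thesis by (simp add: has_euler_def)
qed

text \<open>The three auxiliary sequences are the ranks of the images of the maps in the long exact
  sequence of the pair.\<close>

lemma pair_rank_exact_sequence:
  obtains \<alpha> \<beta> \<delta> where
    "pair_rank (subtopology X A) {} = (\<lambda>k. \<delta> (k + 1) + \<alpha> k)"
    "pair_rank X {} = (\<lambda>k. \<alpha> k + \<beta> k)"
    "pair_rank X A = (\<lambda>k. \<beta> k + \<delta> k)"
proof -
  let ?XA = "\<lambda>k. relative_homology_group k X A" and ?X = "\<lambda>k. homology_group k X"
    and ?A = "\<lambda>k. homology_group k (subtopology X A)"
  let ?i = "\<lambda>k. hom_induced k (subtopology X A) {} X {} id"
    and ?j = "\<lambda>k. hom_induced k X {} X A id" and ?d = "\<lambda>k. hom_boundary k X A"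
  define \<alpha> where "\<alpha> k = rank_of (?X k) (?i k ` carrier (?A k))" for k
  define \<beta> where "\<beta> k = rank_of (?XA k) (?j k ` carrier (?X k))" for k
  define \<delta> where "\<delta> k = rank_of (?A (k - 1)) (?d k ` carrier (?XA k))" for k
  \<comment> \<open>By exactness the kernel in degree \<open>k\<close> is the image of the boundary
    map from degree \<open>k + 1\<close>; this is the origin of the shifted
    \<open>\<delta>\<close>.\<close>
  have "kernel (?A k) (?X k) (?i k) = ?d (k + 1) ` carrier (?XA (k + 1))" for k
    using homology_exactness_axiom_2[of "k + 1" X A] by simp
  moreover have "abelian_rank (?A k) = rank_of (?A k) (kernel (?A k) (?X k) (?i k)) + \<alpha> k" for k
    unfolding \<alpha>_def by (rule rank_kernel_plus_image) (auto intro: hom_induced_hom)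
  ultimately have 1: "pair_rank (subtopology X A) {} = (\<lambda>k. \<delta> (k + 1) + \<alpha> k)"
    by (simp add: fun_eq_iff pair_rank_def \<delta>_def)
  have "kernel (?X k) (?XA k) (?j k) = ?i k ` carrier (?A k)" for k
    using homology_exactness_axiom_3[of k X A] by simp
  moreover have "abelian_rank (?X k) = rank_of (?X k) (kernel (?X k) (?XA k) (?j k)) + \<beta> k" for k
    unfolding \<beta>_def by (rule rank_kernel_plus_image) (auto intro: hom_induced_hom)
  ultimately have 2: "pair_rank X {} = (\<lambda>k. \<alpha> k + \<beta> k)"
    by (simp add: fun_eq_iff pair_rank_def \<alpha>_def)
  have "kernel (?XA k) (?A (k - 1)) (?d k) = ?j k ` carrier (?X k)" for k
    using homology_exactness_axiom_1[of k X A] by simp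
  moreover have "abelian_rank (?XA k) = rank_of (?XA k) (kernel (?XA k) (?A (k - 1)) (?d k)) + \<delta> k" for k
    unfolding \<delta>_def by (rule rank_kernel_plus_image) (auto intro: hom_boundary_hom)
  ultimately have 3: "pair_rank X A = (\<lambda>k. \<beta> k + \<delta> k)"
    by (simp add: fun_eq_iff pair_rank_def \<beta>_def)
  show ?thesis using that 1 2 3 by blast
qed

text \<open>In alternating sums the subspace gives \<alpha> - \<delta>, the pair \<beta> + \<delta>
  and the space \<alpha> + \<beta>. The minus sign comes from the degree shift.\<close>

lemma has_euler_space_from_pair:
  assumes "has_euler (subtopology X A) {} a" "has_euler X A r"
  shows "has_euler X {} (a + r)"
proof -
  obtain \<alpha> \<beta> \<delta> where *:
    "pair_rank (subtopology X A) {} = (\<lambda>k. \<delta> (k + 1) + \<alpha> k)"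
    "pair_rank X {} = (\<lambda>k. \<alpha> k + \<beta> k)"
    "pair_rank X A = (\<lambda>k. \<beta> k + \<delta> k)"
    by (rule pair_rank_exact_sequence)
  have fin: "finite_ranks \<alpha>" "finite_ranks \<beta>" "finite_ranks \<delta>" "finite_ranks (\<lambda>k. \<delta> (k + 1))"
    using assms unfolding has_euler_def * finite_ranks_add finite_ranks_shift[of \<delta>] by blast+
  note sums = alternating_sum_add[OF fin(4,1), unfolded alternating_sum_shift[of \<delta>]]
    alternating_sum_add[OF fin(1,2)] alternating_sum_add[OF fin(2,3)]
  show ?thesis
    using assms fin sums unfolding has_euler_def * finite_ranks_add by linarith
qed

text \<open>The same identity solved for the pair. Finiteness of \<beta> now comes from the space,
  and that of \<delta>, after undoing the shift, from the subspace.\<close>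

lemma has_euler_pair_from_spaces:
  assumes "has_euler (subtopology X A) {} a" "has_euler X {} x"
  shows "has_euler X A (x - a)"
proof -
  obtain \<alpha> \<beta> \<delta> where *:
    "pair_rank (subtopology X A) {} = (\<lambda>k. \<delta> (k + 1) + \<alpha> k)"
    "pair_rank X {} = (\<lambda>k. \<alpha> k + \<beta> k)"
    "pair_rank X A = (\<lambda>k. \<beta> k + \<delta> k)"
    by (rule pair_rank_exact_sequence)
  have fin: "finite_ranks \<alpha>" "finite_ranks \<beta>" "finite_ranks \<delta>" "finite_ranks (\<lambda>k. \<delta> (k + 1))"
    using assms unfolding has_euler_def * finite_ranks_add finite_ranks_shift[of \<delta>] by blast+
  note sums = alternating_sum_add[OF fin(4,1), unfolded alternating_sum_shift[of \<delta>]]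
    alternating_sum_add[OF fin(1,2)] alternating_sum_add[OF fin(2,3)]
  show ?thesis
    using assms fin sums unfolding has_euler_def * finite_ranks_add by linarith
qed

lemma has_euler_point:
  assumes "topspace X = {a}"
  shows "has_euler X {} 1"
proof -
  have "path_connected_space X"
    unfolding path_connected_space_def using assms path_connected_singleton
    by (auto simp: pathin_const intro!: exI[of _ "\<lambda>_. a"])
  then have 0: "pair_rank X {} 0 = 1"
    using isomorphic_integer_zeroth_homology_group[of X] assms abelian_rank_integer_group
      abelian_rank_iso[OF abelian_homology_group abelian_integer_group, of 0 X]
    by (simp add: pair_rank_def)
  have "pair_rank X {} k = 0" if "k \<noteq> 0" for k
    using homology_dimension_axiom[OF assms that] abelian_rank_trivial abelian_homology_group
    unfolding pair_rank_def by blast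
  then have *: "pair_rank X {} = (\<lambda>k. if k = 0 then enat 1 else enat 0)"
    using 0 by (auto simp: one_enat_def zero_enat_def)
  have "{k::int. (if k = 0 then enat 1 else enat 0) \<noteq> 0} = {0}"
    by (auto simp: zero_enat_def)
  then show ?thesis
    unfolding has_euler_def * finite_ranks_def alternating_sum_def by simp
qed

lemma has_euler_empty: "has_euler trivial_topology {} 0"
proof -
  have "trivial_group (homology_group k (trivial_topology :: 'a topology))" for k
    by (rule trivial_homology_group_empty) simp
  then have *: "pair_rank (trivial_topology :: 'a topology) {} = (\<lambda>k. 0)"
    unfolding pair_rank_def using abelian_rank_trivial abelian_homology_group by blast
  show ?thesis unfolding has_euler_def * finite_ranks_def alternating_sum_def by simp
qed

text \<open>Homology vanishes in negative degrees, so the inclusion of the naturals is a bijection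
  between the supports of the two indexings.\<close>

lemma has_euler_imp_betti:
  assumes "has_euler X {} n"
  shows "finite_betti X \<and> euler_characteristic X = n"
proof -
  let ?r = "pair_rank X {}"
  have fr: "finite_ranks ?r" and n: "alternating_sum ?r = n" using assms by (auto simp: has_euler_def)
  have b: "betti k X = ?r (int k)" for k by (simp add: betti_def pair_rank_def)
  have neg: "?r k = 0" if "k < 0" for k
    unfolding pair_rank_def using abelian_rank_trivial abelian_homology_group trivial_homology_group that
    by blast
  have bij: "bij_betw int {k. betti k X \<noteq> 0} {k. ?r k \<noteq> 0}"
    by (rule bij_betw_byWitness[where f' = nat])
       (auto simp: b, (metis neg linorder_not_less int_nat_eq)+)
  have "finite {k. betti k X \<noteq> 0}"
    using bij_betw_finite[OF bij] fr by (simp add: finite_ranks_def)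
  moreover have "\<forall>k. betti k X \<noteq> \<infinity>" using fr by (simp add: b finite_ranks_def)
  moreover have "euler_characteristic X = n"
  proof -
    have "n = (\<Sum>k | ?r k \<noteq> 0. (if even k then 1 else -1) * int (the_enat (?r k)))"
      using n by (simp add: alternating_sum_def)
    also have "\<dots> = (\<Sum>k | betti k X \<noteq> 0. (if even (int k) then 1 else -1) * int (the_enat (?r (int k))))"
      by (rule sum.reindex_bij_betw[symmetric]) (rule bij)
    also have "\<dots> = euler_characteristic X"
      unfolding euler_characteristic_def by (rule sum.cong) (auto simp: b)
    finally show ?thesis by simp
  qed
  ultimately show ?thesis by (simp add: finite_betti_def)
qed

section \<open>Homotopy invariance and excision for subsets\<close>

abbreviation set_euler :: "'a::topological_space set \<Rightarrow> int \<Rightarrow> bool" where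
  "set_euler S \<equiv> has_euler (top_of_set S) {}"

lemma set_euler_homotopy_eqv:
  assumes "S homotopy_eqv T"
  shows "set_euler S n \<longleftrightarrow> set_euler T n"
  by (rule has_euler_iso) (rule homotopy_equivalent_space_imp_isomorphic_homology_groups[OF assms])

lemma set_euler_homeomorphic:
  fixes S :: "'a::real_normed_vector set" and T :: "'b::real_normed_vector set"
  assumes "S homeomorphic T"
  shows "set_euler S n \<longleftrightarrow> set_euler T n"
  using assms homeomorphic_imp_homotopy_eqv set_euler_homotopy_eqv by blast

lemma set_euler_singleton: "set_euler {a} 1"
  by (rule has_euler_point[of _ a]) simp

lemma set_euler_contractible:
  fixes S :: "'a::real_normed_vector set"
  assumes "contractible S" "S \<noteq> {}"
  shows "set_euler S 1"
proof -
  have "S homotopy_eqv {0::real}"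
    using assms by (intro homotopy_eqv_contractible_sets) auto
  then show ?thesis using set_euler_homotopy_eqv set_euler_singleton by blast
qed

text \<open>The closed set \<open>C\<close> and the open set \<open>N\<close>, both relative to
  \<open>X\<close>, squeeze in between \<open>Z\<close> and \<open>T\<close> and so put the closure
  of \<open>Z\<close> into the interior of \<open>T\<close>.\<close>

lemma has_euler_excision:
  assumes "Z \<subseteq> C" "C \<subseteq> N" "N \<subseteq> T" "T \<subseteq> X" "closedin (top_of_set X) C" "openin (top_of_set X) N"
  shows "has_euler (top_of_set (X - Z)) (T - Z) r \<longleftrightarrow> has_euler (top_of_set X) T r"
proof (rule has_euler_iso)
  fix k
  have "(top_of_set X) closure_of Z \<subseteq> C" "N \<subseteq> (top_of_set X) interior_of T"
    using assms by (simp_all add: closure_of_minimal interior_of_maximal)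
  then have cl: "(top_of_set X) closure_of Z \<subseteq> (top_of_set X) interior_of T"
    using assms(2) by blast
  have eq: "subtopology (top_of_set X) (X - Z) = top_of_set (X - Z)" "subtopology (top_of_set X) X = top_of_set X"
    by (simp_all add: subtopology_subtopology Int_Diff[symmetric])
  show "relative_homology_group k (top_of_set (X - Z)) (T - Z) \<cong> relative_homology_group k (top_of_set X) T"
    using homology_excision_axiom[OF cl \<open>T \<subseteq> X\<close>, of k] unfolding is_iso_def eq by blast
qed

lemma set_euler_pair:
  assumes "set_euler T a" "set_euler X x" "T \<subseteq> X"
  shows "has_euler (top_of_set X) T (x - a)"
  using has_euler_pair_from_spaces[of "top_of_set X" T a x] assms
  by (simp add: subtopology_subtopology Int_absorb1)

text \<open>Add the pair \<open>(X, T)\<close> to \<open>T\<close>, after replacing it by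
  \<open>(X - Z, T - Z)\<close>. In use \<open>Z\<close> is the complicated part of the space and
  only a simple local piece is left.\<close>

lemma set_euler_excisive:
  assumes "Z \<subseteq> N" "N \<subseteq> T" "T \<subseteq> X" "closedin (top_of_set X) Z" "openin (top_of_set X) N"
    and "set_euler T a" "set_euler (X - Z) b" "set_euler (T - Z) c"
  shows "set_euler X (a + (b - c))"
proof -
  have "has_euler (top_of_set (X - Z)) (T - Z) (b - c)"
    using assms by (intro set_euler_pair) auto
  then have "has_euler (top_of_set X) T (b - c)"
    using has_euler_excision[OF subset_refl assms(1-5)] by blast
  then show ?thesis
    using has_euler_space_from_pair[of "top_of_set X" T a "b - c"] assms
    by (simp add: subtopology_subtopology Int_absorb1)
qed

lemma set_euler_disjoint_closed:
  assumes "closedin (top_of_set (S \<union> T)) S" "closedin (top_of_set (S \<union> T)) T" "S \<inter> T = {}"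
    and "set_euler S a" "set_euler T b"
  shows "set_euler (S \<union> T) (a + b)"
proof -
  have eq: "S \<union> T - S = T" "S - S = {}" "(S \<union> T) - T = S" using assms(3) by auto
  have "openin (top_of_set (S \<union> T)) S"
    using openin_diff[OF openin_topspace assms(2)] eq(3) by simp
  \<comment> \<open>\<open>S\<close> is also open in the union, so all of it can be excised, leaving
    \<open>T\<close> relative to the empty set.\<close>
  then have "set_euler (S \<union> T) (a + (b - 0))"
    using assms has_euler_empty by (intro set_euler_excisive[of S S S]) (simp_all add: eq)
  then show ?thesis by simp
qed

text \<open>Closedness is relative to the union because the pieces may be half-open arcs, which are
  not closed in the ambient space.\<close>

lemma set_euler_finite_disjoint_union:
  assumes "finite J"
    and "\<And>j. j \<in> J \<Longrightarrow> closedin (top_of_set (\<Union>j\<in>J. A j)) (A j)"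
    and "disjoint_family_on A J"
    and "\<And>j. j \<in> J \<Longrightarrow> set_euler (A j) 1"
  shows "set_euler (\<Union>j\<in>J. A j) (int (card J))"
  using assms
proof (induction J rule: finite_induct)
  case empty
  show ?case using has_euler_empty by simp
next
  case (insert j J)
  have cl: "closedin (top_of_set (\<Union>(A ` insert j J))) (A i)" if "i \<in> insert j J" for i
    using insert.prems(1) that by blast
  have "closedin (top_of_set (\<Union>j\<in>J. A j)) (A i)" if "i \<in> J" for i
    by (rule closedin_subset_trans[OF cl]) (use that in auto)
  then have IH: "set_euler (\<Union>j\<in>J. A j) (int (card J))"
    using insert by (auto simp: disjoint_family_on_def)
  have "closedin (top_of_set (\<Union>(A ` insert j J))) (\<Union>j\<in>J. A j)"
    using cl insert(1) by (intro closedin_Union) auto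
  moreover have "A j \<inter> (\<Union>j\<in>J. A j) = {}"
    using insert by (auto simp: disjoint_family_on_def)
  ultimately have "set_euler (A j \<union> (\<Union>j\<in>J. A j)) (1 + int (card J))"
    using cl[of j] IH insert.prems(3)[of j] by (intro set_euler_disjoint_closed) auto
  then show ?case using insert.hyps by simp
qed

section \<open>Attaching cells\<close>

text \<open>A continuous map from a compact space onto a Hausdorff one is a quotient map. This gives
  continuity of maps on the image of a cell although the cell is not embedded.\<close>

lemma continuous_on_compact_quotient:
  fixes q :: "'a::topological_space \<Rightarrow> 'b::metric_space" and h :: "'b \<Rightarrow> 'c::topological_space"
  assumes "compact K" "continuous_on K q" "continuous_on K (h \<circ> q)"
  shows "continuous_on (q ` K) h"
proof -
  have "quotient_map (top_of_set K) (top_of_set (q ` K)) q"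
    using assms by (intro T1_Spaces.continuous_imp_quotient_map)
      (auto simp: compact_space_subtopology Hausdorff_space_subtopology Hausdorff_space_euclidean continuous_map_in_subtopology)
  then have "continuous_map (top_of_set (q ` K)) euclidean h"
    by (rule continuous_compose_quotient_map) (use assms in simp)
  then show ?thesis by simp
qed

lemma homotopic_with_canonI:
  assumes "continuous_on ({0..1::real} \<times> S) H"
    and "\<And>u z. \<lbrakk>0 \<le> u; u \<le> 1; z \<in> S\<rbrakk> \<Longrightarrow> H (u, z) \<in> T"
    and "\<And>z. z \<in> S \<Longrightarrow> H (0, z) = f z" "\<And>z. z \<in> S \<Longrightarrow> H (1, z) = g z"
  shows "homotopic_with_canon (\<lambda>_. True) S T f g"
proof (subst homotopic_with)
  have "continuous_map (prod_topology (top_of_set {0..1::real}) (top_of_set S)) (top_of_set T) H"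
    using assms(1,2) by (auto simp: continuous_map_in_subtopology prod_topology_subtopology_eu)
  then show "\<exists>h. continuous_map (prod_topology (top_of_set {0..1::real}) (top_of_set S)) (top_of_set T) h \<and>
        (\<forall>x\<in>topspace (top_of_set S). h (0, x) = f x) \<and>
        (\<forall>x\<in>topspace (top_of_set S). h (1, x) = g x) \<and> (\<forall>t\<in>{0..1}. True)"
    by (intro exI[of _ H]) (use assms(3,4) in auto)
qed simp

text \<open>A norm whose unit ball is the model cell; the maximum norm makes squares available as 2-cells.\<close>

locale gauge =
  fixes N :: "'a::euclidean_space \<Rightarrow> real"
  assumes N_continuous: "continuous_on UNIV N"
    and N_scale: "N (c *\<^sub>R x) = \<bar>c\<bar> * N x"
    and N_pos: "x \<noteq> 0 \<Longrightarrow> N x > 0"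
    and N_compact: "compact {x. N x \<le> 1}"
begin

lemma N_zero [simp]: "N 0 = 0"
  using N_scale[of 0 0] by simp

lemma N_nonneg: "N x \<ge> 0"
  using N_pos[of x] by (cases "x = 0") auto

lemma closed_N: "closed {x. N x \<le> a}" "closed {x. a \<le> N x}" "closed {x. N x = a}"
  using N_continuous by (auto intro!: closed_Collect_le closed_Collect_eq continuous_on_const)

lemma compact_shell: "compact {x. a \<le> N x \<and> N x \<le> b}" if "b \<le> 1"
proof -
  have "{x. a \<le> N x \<and> N x \<le> b} = {x. N x \<le> 1} \<inter> ({x. a \<le> N x} \<inter> {x. N x \<le> b})"
    using that by auto
  then show ?thesis using N_compact closed_N by (metis closed_Int compact_Int_closed)
qed

lemma continuous_on_N [continuous_intros]:
  "continuous_on S g \<Longrightarrow> continuous_on S (\<lambda>x. N (g x))"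
  using continuous_on_compose2[OF N_continuous] by blast

lemma set_euler_disc: "set_euler {x. N x < 3/4} 1"
proof (rule set_euler_contractible)
  have "starlike {x. N x < 3/4}"
    unfolding starlike_def
  proof (intro bexI ballI subsetI)
    fix x y assume x: "x \<in> {x. N x < 3/4}" and "y \<in> closed_segment 0 x"
    then obtain u where u: "0 \<le> u" "u \<le> 1" "y = u *\<^sub>R x" by (auto simp: in_segment)
    then have "N y \<le> 1 * N x" unfolding u N_scale
      using u N_nonneg[of x] by (intro mult_right_mono) auto
    then show "y \<in> {x. N x < 3/4}" using x by simp
  qed simp
  then show "contractible {x. N x < 3/4}" by (rule starlike_imp_contractible)
  have "0 \<in> {x. N x < 3/4}" by simp
  then show "{x. N x < 3/4} \<noteq> {}" by blast
qed

text \<open>The linear homotopy to the radial projection onto \<open>N = 1/2\<close> moves points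
  along rays, on which \<open>N\<close> is affine, so it stays in the shell. Doubling then carries
  \<open>N = 1/2\<close> to the unit sphere.\<close>

lemma set_euler_shell:
  assumes "set_euler {x. N x = 1} s"
  shows "set_euler {x. 1/2 \<le> N x \<and> N x < 3/4} s"
proof -
  let ?A = "{x. 1/2 \<le> N x \<and> N x < 3/4}" and ?B = "{x. N x = 1/2}"
  define r where "r = (\<lambda>x. (1 / (2 * N x)) *\<^sub>R x)"
  have cr: "continuous_on ?A r"
    unfolding r_def by (intro continuous_intros) auto
  have "homotopic_with_canon (\<lambda>_. True) ?A ?A id r"
  proof (rule homotopic_with_linear)
    show "continuous_on ?A id" by (simp add: continuous_on_id')
    show "continuous_on ?A r" by (rule cr)
    fix x assume x: "x \<in> ?A"
    show "closed_segment (id x) (r x) \<subseteq> ?A"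
    proof
      fix y assume "y \<in> closed_segment (id x) (r x)"
      then obtain u where u: "0 \<le> u" "u \<le> 1" "y = (1 - u) *\<^sub>R x + u *\<^sub>R r x"
        by (auto simp: in_segment)
      have "y = ((1 - u) + u / (2 * N x)) *\<^sub>R x"
        by (simp add: u r_def algebra_simps)
      moreover have "(1 - u) + u / (2 * N x) \<ge> 0" using u x by simp
      ultimately have "N y = ((1 - u) + u / (2 * N x)) * N x"
        by (simp add: N_scale)
      also have "\<dots> = (1 - u) * N x + u * (1/2)"
        using x by (simp add: field_simps)
      finally have Ny: "N y = (1 - u) * N x + u * (1/2)" .
      have e: "N y - 1/2 = (1 - u) * (N x - 1/2)" "N x - N y = u * (N x - 1/2)"
        unfolding Ny by (simp_all add: algebra_simps add_divide_distrib diff_divide_distrib)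
      have "N y - 1/2 \<ge> 0" "N x - N y \<ge> 0" unfolding e using u x by auto
      then show "y \<in> ?A" using x by auto
    qed
  qed
  moreover have "retraction ?A ?B r"
  proof -
    have "r x = x" if "N x = 1/2" for x
    proof -
      have "2 * N x = 1" using that by simp
      then show ?thesis unfolding r_def by (simp only: div_by_1 scaleR_one)
    qed
    then show ?thesis
      unfolding retraction_def using cr by (auto simp: r_def N_scale)
  qed
  ultimately have "?A homotopy_eqv ?B" by (rule deformation_retract_imp_homotopy_eqv)
  moreover have "?B homeomorphic {x. N x = 1}"
    unfolding homeomorphic_def
  proof (intro exI)
    show "homeomorphism ?B {x. N x = 1} (\<lambda>x. 2 *\<^sub>R x) (\<lambda>x. (1/2) *\<^sub>R x)"
      by (rule homeomorphismI) (auto simp: N_scale intro!: continuous_intros)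
  qed
  ultimately show ?thesis
    using assms set_euler_homotopy_eqv set_euler_homeomorphic by blast
qed

text \<open>The outer half \<open>N \<ge> 1/2\<close> of the cell retracts radially into \<open>Y\<close>; excising \<open>Y\<close> together
  with the part \<open>N \<ge> 3/4\<close> leaves a disc relative to a shell, on which \<open>f\<close> is an embedding.\<close>

lemma set_euler_attach_cell:
  fixes f :: "'a \<Rightarrow> 'b::euclidean_space"
  assumes Y: "compact Y" and cf: "continuous_on {x. N x \<le> 1} f" and inj: "inj_on f {x. N x < 1}"
    and disj: "f ` {x. N x < 1} \<inter> Y = {}" and bd: "f ` {x. N x = 1} \<subseteq> Y"
    and y: "set_euler Y y" and s: "set_euler {x. N x = 1} s"
  shows "set_euler (Y \<union> f ` {x. N x \<le> 1}) (y + (1 - s))"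
proof -
  \<comment> \<open>\<open>f\<close> may identify boundary points with each other, but never an
    inner point with any other point of the closed cell.\<close>
  have K: "x = x'" if "f x = f x'" "N x < 1" "N x' \<le> 1" for x x'
  proof (cases "N x' = 1")
    case True
    then have "f x \<in> Y" using bd that(1) by auto
    then show ?thesis using disj that by auto
  qed (use inj that in \<open>auto simp: inj_on_def\<close>)
  have notY: "f x \<notin> Y" if "N x < 1" for x using disj that by auto
  define A where "A = {x. 1/2 \<le> N x \<and> N x \<le> 1}"
  let ?X = "Y \<union> f ` {x. N x \<le> 1}" and ?T = "Y \<union> f ` A"
    and ?Z = "Y \<union> f ` {x. 3/4 \<le> N x \<and> N x \<le> 1}"
  \<comment> \<open>The complement of a compact half-size cell is relatively open and lies between
    \<open>?Z\<close> and \<open>?T\<close>; the gap between 1/2 and 3/4 is the room that excision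
    requires.\<close>
  let ?O = "?X - f ` {x. N x \<le> 1/2}"
  have A: "compact A" unfolding A_def by (rule compact_shell) simp
  have cfA: "continuous_on A f" by (rule continuous_on_subset[OF cf]) (auto simp: A_def)
  have cimg: "compact (f ` S)" if "compact S" "S \<subseteq> {x. N x \<le> 1}" for S
    using that cf compact_continuous_image continuous_on_subset by blast
  have comp34: "compact {x. 3/4 \<le> N x \<and> N x \<le> 1}" by (rule compact_shell) simp
  have comp12: "compact {x. N x \<le> a}" if "a \<le> 1" for a
    using compact_shell[OF that, of 0] N_nonneg by simp
  have eT: "set_euler ?T y"
  proof -
    define g where "g = (\<lambda>z. SOME x. x \<in> A \<and> f x = z)"
    \<comment> \<open>Points of \<open>Y\<close> stay fixed; any other point is pulled back to the
      shell and pushed outward along its ray, the factor at time 1 being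
      \<open>1 / N x\<close>.\<close>
    define H where "H = (\<lambda>(u, z). if z \<in> Y then z else f ((1 - u + u / N (g z)) *\<^sub>R g z))"
    define \<Phi> where "\<Phi> = (\<lambda>(u, x). f ((1 - u + u / N x) *\<^sub>R x))"
    have Nsc: "N ((1 - u + u / N x) *\<^sub>R x) = (1 - u) * N x + u" if "0 \<le> u" "u \<le> 1" "x \<in> A" for u x
    proof -
      have "1 - u + u / N x \<ge> 0" "N x \<noteq> 0" using that by (auto simp: A_def)
      then have "N ((1 - u + u / N x) *\<^sub>R x) = (1 - u + u / N x) * N x" by (simp add: N_scale)
      also have "\<dots> = (1 - u) * N x + u" using \<open>N x \<noteq> 0\<close> by (simp add: field_simps)
      finally show ?thesis .
    qed
    have NA: "(1 - u + u / N x) *\<^sub>R x \<in> A" if "0 \<le> u" "u \<le> 1" "x \<in> A" for u x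
    proof -
      have "(1 - u) * N x + u - 1/2 = (1 - u) * (N x - 1/2) + u * (1/2)"
        "1 - ((1 - u) * N x + u) = (1 - u) * (1 - N x)" by (simp_all add: field_simps)
      moreover have "(1 - u) * (N x - 1/2) \<ge> 0" "(1 - u) * (1 - N x) \<ge> 0" using that by (auto simp: A_def)
      ultimately have "1/2 \<le> (1 - u) * N x + u" "(1 - u) * N x + u \<le> 1" using that by linarith+
      then show ?thesis using Nsc[OF that] by (simp add: A_def)
    qed
    \<comment> \<open>The chosen preimage \<open>g\<close> does no harm: for \<open>N x = 1\<close>
      the scaling factor is 1 and \<open>f x\<close> lies in \<open>Y\<close>, while for
      \<open>N x < 1\<close> the preimage is unique.\<close>
    have H\<Phi>: "H (u, f x) = \<Phi> (u, x)" if "x \<in> A" "0 \<le> u" "u \<le> 1" for u x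
    proof (cases "N x = 1")
      case True
      then show ?thesis using bd by (auto simp: H_def \<Phi>_def)
    next
      case False
      then have lt: "N x < 1" using that by (simp add: A_def)
      have "g (f x) \<in> A \<and> f (g (f x)) = f x"
        unfolding g_def by (rule someI[of _ x]) (use that in simp)
      then have "g (f x) = x" using K[of x "g (f x)"] lt by (auto simp: A_def)
      then show ?thesis using notY[OF lt] by (simp add: H_def \<Phi>_def)
    qed
    have c\<Phi>: "continuous_on ({0..1} \<times> A) \<Phi>"
      unfolding \<Phi>_def case_prod_unfold
      by (rule continuous_on_compose2[OF cfA])
         (use NA in \<open>auto simp: A_def intro!: continuous_intros\<close>)
    \<comment> \<open>Over the shell, \<open>H\<close> becomes the explicit continuous map
      \<open>\<Phi>\<close>, so it descends along the compact quotient; on \<open>Y\<close> it is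
      the projection, and the two closed pieces glue.\<close>
    have cH2: "continuous_on ((\<lambda>(u, x). (u, f x)) ` ({0..1} \<times> A)) H"
    proof (rule continuous_on_compact_quotient)
      show "compact ({0..1::real} \<times> A)" using A by (intro compact_Times) auto
      show "continuous_on ({0..1::real} \<times> A) (\<lambda>(u, x). (u, f x))"
        unfolding case_prod_unfold
        by (intro continuous_intros continuous_on_compose2[OF cfA]) auto
      show "continuous_on ({0..1} \<times> A) (H \<circ> (\<lambda>(u, x). (u, f x)))"
        by (rule continuous_on_eq[OF c\<Phi>]) (auto simp: H\<Phi>)
    qed
    have "(\<lambda>(u, x). (u, f x)) ` ({0..1} \<times> A) = {0..1::real} \<times> f ` A" by auto
    with cH2 have cH2': "continuous_on ({0..1} \<times> f ` A) H" by simp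
    have cH1: "continuous_on ({0..1} \<times> Y) H"
      by (rule continuous_on_eq[of _ snd]) (auto simp: H_def intro!: continuous_intros)
    have "continuous_on ({0..1} \<times> Y \<union> {0..1} \<times> f ` A) H"
      by (rule continuous_on_closed_Un[OF _ _ cH1 cH2'])
         (use Y cimg[OF A] in \<open>auto intro!: compact_imp_closed compact_Times simp: A_def\<close>)
    then have cH: "continuous_on ({0..1} \<times> ?T) H" by (simp add: Sigma_Un_distrib2)
    have HT: "H (u, z) \<in> ?T" if "0 \<le> u" "u \<le> 1" and zT: "z \<in> ?T" for u z
    proof (cases "z \<in> Y")
      case False
      then obtain x where x: "x \<in> A" "z = f x" using zT by auto
      then show ?thesis using H\<Phi>[of x u] NA[of u x] that by (auto simp: \<Phi>_def)
    qed (simp add: H_def)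
    have H0: "H (0, z) = z" if zT: "z \<in> ?T" for z
    proof (cases "z \<in> Y")
      case False
      then obtain x where x: "x \<in> A" "z = f x" using zT by auto
      then show ?thesis using H\<Phi>[of x 0] by (auto simp: \<Phi>_def)
    qed (simp add: H_def)
    have H1: "H (1, z) \<in> Y" if zT: "z \<in> ?T" for z
    proof (cases "z \<in> Y")
      case False
      then obtain x where x: "x \<in> A" "z = f x" using zT by auto
      then have "N ((1 / N x) *\<^sub>R x) = 1" by (simp add: N_scale A_def)
      then show ?thesis using H\<Phi>[of x 1] x bd by (auto simp: \<Phi>_def)
    qed (simp add: H_def)
    have "homotopic_with_canon (\<lambda>_. True) ?T ?T id (\<lambda>z. H (1, z))"
      by (rule homotopic_with_canonI[OF cH HT]) (use H0 in auto)
    moreover have "retraction ?T Y (\<lambda>z. H (1, z))"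
      unfolding retraction_def
    proof (intro conjI)
      show "continuous_on ?T (\<lambda>z. H (1, z))"
        by (rule continuous_on_compose2[OF cH]) (auto intro!: continuous_intros)
    qed (use H1 in \<open>auto simp: H_def\<close>)
    ultimately have "?T homotopy_eqv Y" by (rule deformation_retract_imp_homotopy_eqv)
    then show ?thesis using y set_euler_homotopy_eqv by blast
  qed
  have XZ: "?X - ?Z = f ` {x. N x < 3/4}"
  proof (intro equalityI subsetI)
    fix z assume "z \<in> ?X - ?Z"
    then show "z \<in> f ` {x. N x < 3/4}" by (auto simp: not_le[symmetric])
  next
    fix z assume "z \<in> f ` {x. N x < 3/4}"
    then obtain x where x: "z = f x" "N x < 3/4" by auto
    have "z \<notin> f ` {x. 3/4 \<le> N x \<and> N x \<le> 1}" using x K[of x] by force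
    then show "z \<in> ?X - ?Z" using x notY[of x] by auto
  qed
  have TZ: "?T - ?Z = f ` {x. 1/2 \<le> N x \<and> N x < 3/4}"
  proof (intro equalityI subsetI)
    fix z assume "z \<in> ?T - ?Z"
    then show "z \<in> f ` {x. 1/2 \<le> N x \<and> N x < 3/4}" by (auto simp: A_def not_le[symmetric])
  next
    fix z assume "z \<in> f ` {x. 1/2 \<le> N x \<and> N x < 3/4}"
    then obtain x where x: "z = f x" "1/2 \<le> N x" "N x < 3/4" by auto
    have "z \<notin> f ` {x. 3/4 \<le> N x \<and> N x \<le> 1}" using x K[of x] by force
    then show "z \<in> ?T - ?Z" using x notY[of x] by (auto simp: A_def)
  qed
  have "\<exists>g. homeomorphism {x. N x \<le> 3/4} (f ` {x. N x \<le> 3/4}) f g"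
  proof (rule homeomorphism_compact)
    show "compact {x. N x \<le> 3/4}" by (rule comp12) simp
    show "continuous_on {x. N x \<le> 3/4} f" by (rule continuous_on_subset[OF cf]) auto
    show "inj_on f {x. N x \<le> 3/4}" by (rule inj_on_subset[OF inj]) auto
  qed simp
  then obtain g where g: "homeomorphism {x. N x \<le> 3/4} (f ` {x. N x \<le> 3/4}) f g" by blast
  have hom: "set_euler (f ` S) n" if "S \<subseteq> {x. N x \<le> 3/4}" "set_euler S n" for S n
  proof -
    have "homeomorphism S (f ` S) f g"
      by (rule homeomorphism_of_subsets[OF g _ subset_refl]) (use that in auto)
    then show ?thesis using that set_euler_homeomorphic homeomorphic_def by blast
  qed
  have c12: "compact (f ` {x. N x \<le> 1/2})" by (rule cimg[OF comp12]) auto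
  show "set_euler ?X (y + (1 - s))"
  proof (rule set_euler_excisive[of ?Z ?O ?T])
    show "?Z \<subseteq> ?O"
    proof
      fix z assume z: "z \<in> ?Z"
      have "z \<notin> f ` {x. N x \<le> 1/2}"
      proof
        assume "z \<in> f ` {x. N x \<le> 1/2}"
        then obtain x where x: "z = f x" "N x \<le> 1/2" by auto
        then have "z \<notin> Y" using notY[of x] by simp
        then obtain x' where "z = f x'" "3/4 \<le> N x'" "N x' \<le> 1" using z by auto
        then show False using K[of x x'] x by auto
      qed
      then show "z \<in> ?O" using z by auto
    qed
    show "?O \<subseteq> ?T" by (auto simp: A_def image_iff not_le) (metis less_imp_le not_le)
    show "?T \<subseteq> ?X" by (auto simp: A_def)
    show "closedin (top_of_set ?X) ?Z"
      by (rule closed_subset) (use Y cimg[OF comp34] in \<open>auto intro!: compact_imp_closed compact_Un\<close>)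
    have "closedin (top_of_set ?X) (f ` {x. N x \<le> 1/2})"
      by (rule closed_subset) (use c12 in \<open>auto intro!: compact_imp_closed\<close>)
    then show "openin (top_of_set ?X) ?O"
      using openin_diff[OF openin_topspace] by fastforce
    show "set_euler ?T y" by (rule eT)
    show "set_euler (?X - ?Z) 1" unfolding XZ by (rule hom[OF _ set_euler_disc]) auto
    show "set_euler (?T - ?Z) s" unfolding TZ by (rule hom[OF _ set_euler_shell[OF s]]) auto
  qed
qed

end


section \<open>Arcs and squares as model cells\<close>

lemma gauge_abs: "gauge (abs :: real \<Rightarrow> real)"
proof
  have "{x::real. \<bar>x\<bar> \<le> 1} = {-1..1}" by auto
  then show "compact {x::real. \<bar>x\<bar> \<le> 1}" by simp
qed (auto intro!: continuous_intros simp: abs_mult)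

text \<open>The model is the interval from -1 to 1, whose boundary consists of two points, hence the
  change by 1 - 2. The two ends may coincide, so loops are included.\<close>

lemma set_euler_attach_arc:
  fixes c :: "real \<Rightarrow> 'b::euclidean_space"
  assumes "compact Y" "continuous_on {0..1} c" "inj_on c {0<..<1}"
    and "c ` {0<..<1} \<inter> Y = {}" "c 0 \<in> Y" "c 1 \<in> Y" "set_euler Y y"
  shows "set_euler (Y \<union> c ` {0..1}) (y - 1)"
proof -
  interpret gauge "abs :: real \<Rightarrow> real" by (rule gauge_abs)
  define f where "f = (\<lambda>x. c ((x + 1) / 2))"
  have "{x::real. \<bar>x\<bar> = 1} = {-1} \<union> {1}" by auto
  moreover have "set_euler ({-1} \<union> {1::real}) (1 + 1)"
    by (intro set_euler_disjoint_closed set_euler_singleton closed_subset) auto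
  ultimately have s: "set_euler {x::real. \<bar>x\<bar> = 1} 2" by simp
  have "set_euler (Y \<union> f ` {x. \<bar>x\<bar> \<le> 1}) (y + (1 - 2))"
  proof (rule set_euler_attach_cell)
    show "continuous_on {x. \<bar>x\<bar> \<le> 1} f" unfolding f_def
      by (rule continuous_on_compose2[OF assms(2)]) (auto intro!: continuous_intros)
    show "inj_on f {x. \<bar>x\<bar> < 1}"
    proof (rule inj_onI)
      fix x x' assume *: "x \<in> {x. \<bar>x\<bar> < 1}" "x' \<in> {x. \<bar>x\<bar> < 1}" "f x = f x'"
      have "(x + 1) / 2 = (x' + 1) / 2"
        by (rule inj_onD[OF assms(3)]) (use * in \<open>auto simp: f_def\<close>)
      then show "x = x'" by simp
    qed
    show "f ` {x. \<bar>x\<bar> < 1} \<inter> Y = {}"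
    proof -
      have "f ` {x. \<bar>x\<bar> < 1} \<subseteq> c ` {0<..<1}"
        unfolding f_def by (auto simp: abs_less_iff intro!: imageI)
      then show ?thesis using assms(4) by blast
    qed
    show "f ` {x. \<bar>x\<bar> = 1} \<subseteq> Y"
      using assms(5,6) by (auto simp: f_def abs_if split: if_splits)
  qed (use assms s in auto)
  moreover have "f ` {x. \<bar>x\<bar> \<le> 1} = c ` {0..1}"
  proof
    show "f ` {x. \<bar>x\<bar> \<le> 1} \<subseteq> c ` {0..1}"
      unfolding f_def by (auto simp: abs_le_iff intro!: imageI)
    show "c ` {0..1} \<subseteq> f ` {x. \<bar>x\<bar> \<le> 1}"
    proof
      fix z assume "z \<in> c ` {0..1}"
      then obtain t where t: "z = c t" "0 \<le> t" "t \<le> 1" by auto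
      then show "z \<in> f ` {x. \<bar>x\<bar> \<le> 1}"
        by (intro image_eqI[of _ _ "2 * t - 1"]) (auto simp: f_def)
    qed
  qed
  ultimately show ?thesis by simp
qed

definition square_norm :: "real \<times> real \<Rightarrow> real" where
  "square_norm = (\<lambda>(x, y). max \<bar>x\<bar> \<bar>y\<bar>)"

lemma gauge_square_norm: "gauge square_norm"
proof
  have eq: "{x. square_norm x \<le> 1} = {-1..1} \<times> {-1..1}" by (auto simp: square_norm_def)
  then show "compact {x. square_norm x \<le> 1}" unfolding eq by (intro compact_Times) auto
  show "continuous_on UNIV square_norm"
    unfolding square_norm_def case_prod_unfold by (intro continuous_intros)
  show "square_norm (c *\<^sub>R x) = \<bar>c\<bar> * square_norm x" for c x
    by (cases x) (simp add: square_norm_def abs_mult max_mult_distrib_left)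
  show "0 < square_norm x" if "x \<noteq> 0" for x
    using that by (cases x) (auto simp: square_norm_def zero_prod_def less_max_iff_disj)
qed

text \<open>The frontier arises from one point by attaching a loop, which gives 1 - 1. The loop is
  the unit circle rescaled radially to \<open>square_norm\<close> equal to 1.\<close>

lemma set_euler_square_frontier: "set_euler {x. square_norm x = 1} 0"
proof -
  interpret gauge square_norm by (rule gauge_square_norm)
  define v where "v = (\<lambda>t. (cos (2 * pi * t), sin (2 * pi * t)))"
  define c where "c = (\<lambda>t. (1 / square_norm (v t)) *\<^sub>R v t)"
  have nv: "norm (v t) = 1" for t by (simp add: v_def norm_Pair)
  have v0: "square_norm (v t) > 0" for t using nv[of t] by (intro N_pos) auto
  have Nc: "square_norm (c t) = 1" for t using v0[of t] by (simp add: c_def N_scale)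
  \<comment> \<open>Since \<open>v t\<close> is a unit vector, the norm of \<open>c t\<close>
    reveals the scaling factor, and with it \<open>v t\<close> itself.\<close>
  have eqv: "v t = v t'" if "c t = c t'" for t t'
  proof -
    have "norm (c t) = 1 / square_norm (v t)" for t
      using v0[of t] nv[of t] by (simp add: c_def)
    then have "square_norm (v t) = square_norm (v t')" using that by (metis divide_divide_eq_right div_by_1 mult_1 nonzero_eq_divide_eq v0 less_irrefl)
    then show ?thesis using that v0[of t] v0[of t'] by (simp add: c_def)
  qed
  have eqt: "t = t'" if ct: "c t = c t'" and "0 \<le> t" "t < 1" "0 \<le> t'" "t' < 1" for t t'
  proof -
    obtain n :: int where "2 * pi * t = 2 * pi * t' + 2 * pi * of_int n"
      using eqv[OF ct] sin_cos_eq_iff[of "2 * pi * t" "2 * pi * t'"] by (auto simp: v_def)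
    then have "2 * pi * t = 2 * pi * (t' + of_int n)" by (simp add: algebra_simps)
    then have "t = t' + of_int n" by simp
    then show ?thesis using that by (cases "n = 0"; cases "n > 0") auto
  qed
  have "continuous_on UNIV v" unfolding v_def by (intro continuous_intros)
  then have cc: "continuous_on UNIV c"
    unfolding c_def using v0 by (intro continuous_intros) (auto simp: less_imp_neq[symmetric])
  have c1: "c 1 = c 0" by (simp add: c_def v_def)
  have "set_euler ({c 0} \<union> c ` {0..1}) (1 - 1)"
  proof (rule set_euler_attach_arc)
    show "inj_on c {0<..<1}" by (rule inj_onI, rule eqt) auto
    show "c ` {0<..<1} \<inter> {c 0} = {}" using eqt[of _ 0] by force
  qed (use c1 set_euler_singleton continuous_on_subset[OF cc] in auto)
  moreover have "{c 0} \<union> c ` {0..1} = {x. square_norm x = 1}"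
  proof
    show "{c 0} \<union> c ` {0..1} \<subseteq> {x. square_norm x = 1}" using Nc by auto
    show "{x. square_norm x = 1} \<subseteq> {c 0} \<union> c ` {0..1}"
    proof
      fix x assume "x \<in> {x. square_norm x = 1}"
      then have x: "square_norm x = 1" "x \<noteq> 0" using N_zero by auto
      obtain a b where ab: "(1 / norm x) *\<^sub>R x = (a, b)" by (cases "(1 / norm x) *\<^sub>R x")
      then have "norm (a, b) = 1" using x(2) by (metis norm_sgn sgn_div_norm inverse_eq_divide)
      then have "a\<^sup>2 + b\<^sup>2 = 1" by (simp add: norm_Pair)
      then obtain s where s: "0 \<le> s" "s < 2 * pi" "a = cos s" "b = sin s"
        using sincos_total_2pi by metis
      define t where "t = s / (2 * pi)"
      have t: "0 \<le> t" "t \<le> 1" "v t = (1 / norm x) *\<^sub>R x" using s ab by (auto simp: t_def v_def)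
      have "c t = x" using x by (simp add: c_def t(3) N_scale)
      then show "x \<in> {c 0} \<union> c ` {0..1}" using t by auto
    qed
  qed
  ultimately show ?thesis by simp
qed

lemma set_euler_attach_square:
  fixes f :: "real \<times> real \<Rightarrow> 'b::euclidean_space"
  assumes "compact Y" "continuous_on ({-1..1} \<times> {-1..1}) f" "inj_on f ({-1<..<1} \<times> {-1<..<1})"
    and "f ` ({-1<..<1} \<times> {-1<..<1}) \<inter> Y = {}"
    and "\<And>u. u \<in> {-1..1} \<Longrightarrow> f (-1, u) \<in> Y \<and> f (1, u) \<in> Y \<and> f (u, -1) \<in> Y \<and> f (u, 1) \<in> Y"
    and "set_euler Y y"
  shows "set_euler (Y \<union> f ` ({-1..1} \<times> {-1..1})) (y + 1)"
proof -
  interpret gauge square_norm by (rule gauge_square_norm)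
  have eq: "{x. square_norm x \<le> 1} = {-1..1} \<times> {-1..1}" "{x. square_norm x < 1} = {-1<..<1} \<times> {-1<..<1}"
    by (auto simp: square_norm_def)
  have "f ` {x. square_norm x = 1} \<subseteq> Y"
  proof
    fix z assume "z \<in> f ` {x. square_norm x = 1}"
    then obtain x y where "z = f (x, y)" "square_norm (x, y) = 1" by auto
    then show "z \<in> Y" using assms(5)[of x] assms(5)[of y]
      by (auto simp: square_norm_def max_def abs_if split: if_splits)
  qed
  from set_euler_attach_cell[OF assms(1) _ _ _ this assms(6) set_euler_square_frontier]
  have "set_euler (Y \<union> f ` {x. square_norm x \<le> 1}) (y + (1 - 0))"
    unfolding eq using assms by blast
  then show ?thesis by (simp add: eq)
qed

lemma set_euler_finite:
  fixes A :: "'a::t1_space set"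
  assumes "finite A"
  shows "set_euler A (int (card A))"
proof -
  have "set_euler (\<Union>q\<in>A. {q}) (int (card A))"
    by (rule set_euler_finite_disjoint_union[OF assms])
       (auto simp: disjoint_family_on_def set_euler_singleton assms finite_imp_closed intro!: closed_subset)
  then show ?thesis by simp
qed

text \<open>An open arc misses the arcs attached before it: their inner points are excluded by joint
  injectivity, and their ends lie in \<open>Y\<close>.\<close>

lemma set_euler_attach_arcs:
  fixes c :: "'i \<Rightarrow> real \<Rightarrow> 'b::euclidean_space"
  assumes "finite J" "compact Y" and y: "set_euler Y y"
    and cont: "\<And>j. j \<in> J \<Longrightarrow> continuous_on {0..1} (c j)"
    and ends: "\<And>j. j \<in> J \<Longrightarrow> c j 0 \<in> Y \<and> c j 1 \<in> Y"
    and inner: "\<And>j s. \<lbrakk>j \<in> J; s \<in> {0<..<1}\<rbrakk> \<Longrightarrow> c j s \<notin> Y"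
    and inj: "\<And>i j s t. \<lbrakk>i \<in> J; j \<in> J; s \<in> {0<..<1}; t \<in> {0<..<1}; c i s = c j t\<rbrakk> \<Longrightarrow> i = j \<and> s = t"
  shows "set_euler (Y \<union> (\<Union>j\<in>J. c j ` {0..1})) (y - int (card J))"
proof -
  have "set_euler (Y \<union> (\<Union>j\<in>J'. c j ` {0..1})) (y - int (card J'))" if "J' \<subseteq> J" for J'
    using finite_subset[OF that \<open>finite J\<close>] that
  proof (induction J' rule: finite_induct)
    case empty
    then show ?case using y by simp
  next
    case (insert j J')
    let ?Y = "Y \<union> (\<Union>j\<in>J'. c j ` {0..1})"
    have j: "j \<in> J" "J' \<subseteq> J" using insert.prems by auto
    have "set_euler (?Y \<union> c j ` {0..1}) (y - int (card J') - 1)"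
    proof (rule set_euler_attach_arc)
      show "compact ?Y"
        using insert.hyps j \<open>compact Y\<close> cont
        by (intro compact_Un compact_UN compact_continuous_image) auto
      show "continuous_on {0..1} (c j)" by (rule cont[OF j(1)])
      show "inj_on (c j) {0<..<1}" using inj[OF j(1) j(1)] by (intro inj_onI) blast
      have "c j s \<notin> c i ` {0..1}" if s: "s \<in> {0<..<1}" and i: "i \<in> J'" for s i
      proof
        assume "c j s \<in> c i ` {0..1}"
        then obtain t where t: "t \<in> {0..1}" "c j s = c i t" by blast
        have iJ: "i \<in> J" "i \<noteq> j" using i j insert.hyps(2) by auto
        have "t \<notin> {0<..<1}" using inj[OF j(1) iJ(1) s _ t(2)] iJ(2) by blast
        then have "t = 0 \<or> t = 1" using t(1) by auto
        then show False using ends[OF iJ(1)] inner[OF j(1) s] t(2) by auto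
      qed
      then show "c j ` {0<..<1} \<inter> ?Y = {}" using inner[OF j(1)] by blast
      show "c j 0 \<in> ?Y" "c j 1 \<in> ?Y" using ends[OF j(1)] by auto
      show "set_euler ?Y (y - int (card J'))" using insert.IH j by blast
    qed
    moreover have "?Y \<union> c j ` {0..1} = Y \<union> (\<Union>j\<in>insert j J'. c j ` {0..1})" by auto
    moreover have "y - int (card J') - 1 = y - int (card (insert j J'))"
      using insert.hyps by simp
    ultimately show ?case by simp
  qed
  then show ?thesis by blast
qed

lemma set_euler_attach_squares:
  fixes f :: "'i \<Rightarrow> real \<times> real \<Rightarrow> 'b::euclidean_space"
  defines "Q \<equiv> {-1..1} \<times> {-1..1}" and "Q' \<equiv> {-1<..<1} \<times> {-1<..<1}"
  assumes "finite J" "compact Y" and y: "set_euler Y y"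
    and cont: "\<And>j. j \<in> J \<Longrightarrow> continuous_on Q (f j)"
    and bdry: "\<And>j u. \<lbrakk>j \<in> J; u \<in> {-1..1}\<rbrakk> \<Longrightarrow>
          f j (-1, u) \<in> Y \<and> f j (1, u) \<in> Y \<and> f j (u, -1) \<in> Y \<and> f j (u, 1) \<in> Y"
    and inner: "\<And>j x. \<lbrakk>j \<in> J; x \<in> Q'\<rbrakk> \<Longrightarrow> f j x \<notin> Y"
    and inj: "\<And>i j x x'. \<lbrakk>i \<in> J; j \<in> J; x \<in> Q'; x' \<in> Q'; f i x = f j x'\<rbrakk> \<Longrightarrow> i = j \<and> x = x'"
  shows "set_euler (Y \<union> (\<Union>j\<in>J. f j ` Q)) (y + int (card J))"
proof -
  have "set_euler (Y \<union> (\<Union>j\<in>J'. f j ` Q)) (y + int (card J'))" if "J' \<subseteq> J" for J'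
    using finite_subset[OF that \<open>finite J\<close>] that
  proof (induction J' rule: finite_induct)
    case empty
    then show ?case using y by simp
  next
    case (insert j J')
    let ?Y = "Y \<union> (\<Union>j\<in>J'. f j ` Q)"
    have j: "j \<in> J" "J' \<subseteq> J" using insert.prems by auto
    have "set_euler (?Y \<union> f j ` ({-1..1} \<times> {-1..1})) (y + int (card J') + 1)"
    proof (rule set_euler_attach_square)
      have "compact Q" by (simp add: Q_def compact_Times)
      then show "compact ?Y"
        using insert.hyps j \<open>compact Y\<close> cont
        by (intro compact_Un compact_UN compact_continuous_image) auto
      show "continuous_on ({-1..1} \<times> {-1..1}) (f j)" using cont[OF j(1)] by (simp add: Q_def)
      show "inj_on (f j) ({-1<..<1} \<times> {-1<..<1})"
        using inj[OF j(1) j(1)] unfolding Q'_def by (intro inj_onI) blast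
      have "f j x \<notin> f i ` Q" if x: "x \<in> Q'" and i: "i \<in> J'" for x i
      proof
        assume "f j x \<in> f i ` Q"
        then obtain x' where x': "x' \<in> Q" "f j x = f i x'" by blast
        have iJ: "i \<in> J" "i \<noteq> j" using i j insert.hyps(2) by auto
        have "x' \<notin> Q'" using inj[OF j(1) iJ(1) x _ x'(2)] iJ(2) by blast
        \<comment> \<open>A point of the closed square outside the open one lies on one of the four
          sides, all of which are mapped into \<open>Y\<close>.\<close>
        then obtain u where "u \<in> {-1..1}" "x' \<in> {(-1, u), (1, u), (u, -1), (u, 1)}"
          using x'(1) by (cases x') (force simp: Q_def Q'_def)
        then show False using bdry[OF iJ(1), of u] inner[OF j(1) x] x'(2) by auto
      qed
      then show "f j ` ({-1<..<1} \<times> {-1<..<1}) \<inter> ?Y = {}"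
        using inner[OF j(1)] unfolding Q'_def by blast
      show "f j (-1, u) \<in> ?Y \<and> f j (1, u) \<in> ?Y \<and> f j (u, -1) \<in> ?Y \<and> f j (u, 1) \<in> ?Y"
        if "u \<in> {-1..1}" for u
        using bdry[OF j(1) that] by blast
      show "set_euler ?Y (y + int (card J'))" using insert.IH j by blast
    qed
    moreover have "?Y \<union> f j ` ({-1..1} \<times> {-1..1}) = Y \<union> (\<Union>j\<in>insert j J'. f j ` Q)"
      by (auto simp: Q_def)
    moreover have "y + int (card J') + 1 = y + int (card (insert j J'))"
      using insert.hyps by simp
    ultimately show ?case by simp
  qed
  then show ?thesis by blast
qed

section \<open>Local degree of a graph at a point\<close>

text \<open>The common topological form of a smooth star and of a graph near a node: finitely many
  arcs from \<open>q\<close>, disjoint otherwise, that cover \<open>W\<close> near \<open>q\<close>.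
  An empty index set means that \<open>q\<close> is isolated in \<open>W\<close>.\<close>

definition star_germ :: "'a::euclidean_space set \<Rightarrow> 'a \<Rightarrow> 'i set \<Rightarrow> ('i \<Rightarrow> real \<Rightarrow> 'a) \<Rightarrow> bool" where
  "star_germ W q J \<alpha> \<longleftrightarrow> finite J \<and> q \<in> W \<and>
     (\<forall>j\<in>J. continuous_on {0..1} (\<alpha> j) \<and> inj_on (\<alpha> j) {0..1} \<and> \<alpha> j 0 = q \<and> \<alpha> j ` {0..1} \<subseteq> W) \<and>
     (\<forall>i\<in>J. \<forall>j\<in>J. i \<noteq> j \<longrightarrow> \<alpha> i ` {0..1} \<inter> \<alpha> j ` {0..1} \<subseteq> {q}) \<and>
     (\<exists>U. open U \<and> q \<in> U \<and> W \<inter> U \<subseteq> insert q (\<Union>j\<in>J. \<alpha> j ` {0..1}))"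

text \<open>Each arm is added in two moves that cancel: its far end as an isolated point, then an
  arc joining that point to the centre.\<close>

lemma set_euler_star:
  fixes \<alpha> :: "'i \<Rightarrow> real \<Rightarrow> 'a::euclidean_space"
  assumes "finite J"
    and arc: "\<And>j. j \<in> J \<Longrightarrow> continuous_on {0..1} (\<alpha> j) \<and> inj_on (\<alpha> j) {0..1} \<and> \<alpha> j 0 = q"
    and meet: "\<And>i j. \<lbrakk>i \<in> J; j \<in> J; i \<noteq> j\<rbrakk> \<Longrightarrow> \<alpha> i ` {0..1} \<inter> \<alpha> j ` {0..1} \<subseteq> {q}"
  shows "set_euler (insert q (\<Union>j\<in>J. \<alpha> j ` {0..1})) 1"
  using assms
proof (induction J rule: finite_induct)
  case empty
  then show ?case using set_euler_singleton by simp
next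
  case (insert j J)
  let ?S = "insert q (\<Union>j\<in>J. \<alpha> j ` {0..1})"
  have j: "continuous_on {0..1} (\<alpha> j)" "inj_on (\<alpha> j) {0..1}" "\<alpha> j 0 = q"
    using insert.prems(1)[of j] by auto
  have IH: "set_euler ?S 1" using insert.IH insert.prems by blast
  have "compact (\<Union>j\<in>J. \<alpha> j ` {0..1})"
    using insert.hyps insert.prems(1) by (intro compact_UN compact_continuous_image) auto
  then have S: "compact ?S" by (rule compact_insert)
  have notS: "\<alpha> j t \<notin> ?S" if "0 < t" "t \<le> 1" for t
  proof
    assume a: "\<alpha> j t \<in> ?S"
    have "\<alpha> j t \<noteq> q" using j that inj_onD[OF j(2), of t 0] by auto
    moreover from this a obtain i where i: "i \<in> J" "\<alpha> j t \<in> \<alpha> i ` {0..1}" by auto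
    moreover have "\<alpha> j t \<in> \<alpha> j ` {0..1}" using that by simp
    moreover have "\<alpha> j ` {0..1} \<inter> \<alpha> i ` {0..1} \<subseteq> {q}"
      using insert.prems(2)[of j i] insert.hyps(2) i(1) by blast
    ultimately show False by blast
  qed
  have "set_euler (?S \<union> {\<alpha> j 1}) (1 + 1)"
    using notS[of 1] S IH by (intro set_euler_disjoint_closed set_euler_singleton closed_subset)
      (auto intro: compact_imp_closed)
  then have "set_euler ((?S \<union> {\<alpha> j 1}) \<union> \<alpha> j ` {0..1}) (1 + 1 - 1)"
  proof (rule set_euler_attach_arc[rotated -1])
    show "\<alpha> j ` {0<..<1} \<inter> (?S \<union> {\<alpha> j 1}) = {}"
    proof -
      have "\<alpha> j t \<noteq> \<alpha> j 1" if "0 < t" "t < 1" for t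
        using inj_onD[OF j(2), of t 1] that by auto
      moreover have "\<alpha> j t \<notin> ?S" if "0 < t" "t < 1" for t using notS[of t] that by simp
      ultimately show ?thesis by fastforce
    qed
    show "compact (?S \<union> {\<alpha> j 1})" using S by (rule compact_Un) simp
    show "inj_on (\<alpha> j) {0<..<1}" by (rule inj_on_subset[OF j(2)]) auto
  qed (use j in auto)
  moreover have "(?S \<union> {\<alpha> j 1}) \<union> \<alpha> j ` {0..1} = insert q (\<Union>j\<in>insert j J. \<alpha> j ` {0..1})"
    by auto
  ultimately show ?case by simp
qed

text \<open>Without the centre the star falls apart into one half-open, hence contractible, arc per
  arm; each is closed in the union as the trace of a compact arm.\<close>

lemma set_euler_punctured_star:
  fixes \<alpha> :: "'i \<Rightarrow> real \<Rightarrow> 'a::euclidean_space"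
  assumes "finite J"
    and arc: "\<And>j. j \<in> J \<Longrightarrow> continuous_on {0..1} (\<alpha> j) \<and> inj_on (\<alpha> j) {0..1} \<and> \<alpha> j 0 = q"
    and meet: "\<And>i j. \<lbrakk>i \<in> J; j \<in> J; i \<noteq> j\<rbrakk> \<Longrightarrow> \<alpha> i ` {0..1} \<inter> \<alpha> j ` {0..1} \<subseteq> {q}"
  shows "set_euler (insert q (\<Union>j\<in>J. \<alpha> j ` {0..1}) - {q}) (int (card J))"
proof -
  have ne: "\<alpha> j t \<noteq> q" if "j \<in> J" "0 < t" "t \<le> 1" for j t
    using arc[OF that(1)] inj_onD[of "\<alpha> j" "{0..1}" t 0] that by auto
  have half: "\<alpha> j ` {0..1} - {q} = \<alpha> j ` {0<..1}" if "j \<in> J" for j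
  proof -
    have "{0..1::real} = insert 0 {0<..1}" by auto
    then have "\<alpha> j ` {0..1} = insert q (\<alpha> j ` {0<..1})" using arc[OF that] by (metis image_insert)
    moreover have "q \<notin> \<alpha> j ` {0<..1}" using ne[OF that] by fastforce
    ultimately show ?thesis by blast
  qed
  have eq: "insert q (\<Union>j\<in>J. \<alpha> j ` {0..1}) - {q} = (\<Union>j\<in>J. \<alpha> j ` {0<..1})"
    using half by auto
  have "set_euler (\<Union>j\<in>J. \<alpha> j ` {0<..1}) (int (card J))"
  proof (rule set_euler_finite_disjoint_union[OF \<open>finite J\<close>])
    fix j assume j: "j \<in> J"
    have "closed (\<alpha> j ` {0..1})"
      using arc[OF j] by (intro compact_imp_closed compact_continuous_image) auto
    moreover have "\<alpha> j ` {0<..1} = (\<Union>j\<in>J. \<alpha> j ` {0<..1}) \<inter> \<alpha> j ` {0..1}"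
      using j half[OF j] eq by blast
    ultimately show "closedin (top_of_set (\<Union>j\<in>J. \<alpha> j ` {0<..1})) (\<alpha> j ` {0<..1})"
      using closedin_closed by blast
    obtain g where "homeomorphism {0..1} (\<alpha> j ` {0..1}) (\<alpha> j) g"
      using arc[OF j] homeomorphism_compact[of "{0..1::real}" "\<alpha> j"] by auto
    then have "homeomorphism {0<..1} (\<alpha> j ` {0<..1}) (\<alpha> j) g"
      by (rule homeomorphism_of_subsets[OF _ _ subset_refl]) auto
    moreover have "set_euler {0<..1::real} 1"
      by (rule set_euler_contractible) (auto intro: convex_imp_contractible)
    ultimately show "set_euler (\<alpha> j ` {0<..1}) 1"
      using set_euler_homeomorphic homeomorphic_def by blast
  next
    show "disjoint_family_on (\<lambda>j. \<alpha> j ` {0<..1}) J"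
      unfolding disjoint_family_on_def
    proof (intro ballI impI)
      fix i j assume "i \<in> J" "j \<in> J" "i \<noteq> j"
      then show "\<alpha> i ` {0<..1} \<inter> \<alpha> j ` {0<..1} = {}"
        using meet[of i j] half[of i] half[of j] by blast
    qed
  qed
  then show ?thesis using eq by simp
qed

text \<open>Everything outside the star is excised. It is contained in \<open>W - U\<close>, which
  is closed in \<open>W\<close> and avoids \<open>q\<close>, so the star relative to the punctured
  star is left.\<close>

lemma star_germ_local_euler:
  assumes "star_germ W q J \<alpha>"
  shows "has_euler (top_of_set W) (W - {q}) (1 - int (card J))"
proof -
  note germ = assms[unfolded star_germ_def]
  have fin: "finite J" and qW: "q \<in> W" using germ by simp_all
  have arc: "continuous_on {0..1} (\<alpha> j) \<and> inj_on (\<alpha> j) {0..1} \<and> \<alpha> j 0 = q"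
    and sub: "\<alpha> j ` {0..1} \<subseteq> W" if "j \<in> J" for j
    using germ that by simp_all
  have meet: "\<alpha> i ` {0..1} \<inter> \<alpha> j ` {0..1} \<subseteq> {q}" if "i \<in> J" "j \<in> J" "i \<noteq> j" for i j
    using germ that by simp
  obtain U where U: "open U" "q \<in> U" "W \<inter> U \<subseteq> insert q (\<Union>j\<in>J. \<alpha> j ` {0..1})"
    using germ by metis
  let ?S = "insert q (\<Union>j\<in>J. \<alpha> j ` {0..1})"
  have SW: "?S \<subseteq> W" using qW sub by auto
  have "has_euler (top_of_set ?S) (?S - {q}) (1 - int (card J))"
    using set_euler_star[OF fin arc meet] set_euler_punctured_star[OF fin arc meet]
    by (intro set_euler_pair) auto
  moreover have "W - (W - ?S) = ?S" "W - {q} - (W - ?S) = ?S - {q}" using SW by auto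
  ultimately have loc: "has_euler (top_of_set (W - (W - ?S))) (W - {q} - (W - ?S)) (1 - int (card J))"
    by simp
  have "has_euler (top_of_set (W - (W - ?S))) (W - {q} - (W - ?S)) (1 - int (card J))
    \<longleftrightarrow> has_euler (top_of_set W) (W - {q}) (1 - int (card J))"
  proof (rule has_euler_excision)
    show "W - ?S \<subseteq> W - U" using U by auto
    show "W - U \<subseteq> W - {q}" using U by auto
    show "closedin (top_of_set W) (W - U)"
      using U(1) by (metis Diff_eq closedin_closed_Int open_closed)
    show "openin (top_of_set W) (W - {q})"
      using open_delete[OF open_UNIV, of q] by (metis Diff_eq openin_open_Int Compl_eq_Diff_UNIV)
  qed auto
  with loc show ?thesis by blast
qed

text \<open>The number of arms is read off from the pair \<open>(W, W - {q})\<close>, which does not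
  mention the arms.\<close>

lemma star_germ_card_unique:
  assumes "star_germ W q I \<alpha>" "star_germ W q J \<beta>"
  shows "card I = card J"
  using has_euler_unique[OF star_germ_local_euler[OF assms(1)] star_germ_local_euler[OF assms(2)]]
  by simp

text \<open>The inverse diffeomorphism carries shortened straight segments back to arcs in
  \<open>W\<close>.\<close>

lemma has_degree_imp_star_germ:
  assumes "has_degree W q d"
  shows "\<exists>(D :: (real^3) set) \<alpha>. star_germ W q D \<alpha> \<and> card D = d"
proof -
  obtain D U V \<phi> \<psi> where deg: "finite D \<and> card D = d \<and> (\<forall>v\<in>D. norm v = 1) \<and>
      q \<in> U \<and> smooth_on U \<phi> \<and> smooth_on V \<psi> \<and> homeomorphism U V \<phi> \<psi> \<and>
      \<phi> q = 0 \<and> \<phi> ` (W \<inter> U) = star_configuration D \<inter> V"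
    using assms[unfolded has_degree_def] by (elim exE) (rule that)
  have D1: "norm v = 1" if "v \<in> D" for v
    using deg that by simp_all
  have D: "finite D" "card D = d" and qU: "q \<in> U" and sm: "smooth_on U \<phi>" "smooth_on V \<psi>"
    and hom: "homeomorphism U V \<phi> \<psi>" and \<phi>q: "\<phi> q = 0"
    and img: "\<phi> ` (W \<inter> U) = star_configuration D \<inter> V"
    using deg by simp_all
  have oU: "open U" and oV: "open V" using sm by (auto simp: smooth_on_def)
  have \<psi>\<phi>: "\<psi> (\<phi> x) = x" "\<phi> x \<in> V" if "x \<in> U" for x using hom that by (auto simp: homeomorphism_def)
  have \<phi>\<psi>: "\<phi> (\<psi> y) = y" "\<psi> y \<in> U" if "y \<in> V" for y using hom that by (auto simp: homeomorphism_def)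
  have c\<psi>: "continuous_on V \<psi>" and c\<phi>: "continuous_on U \<phi>" using hom by (auto simp: homeomorphism_def)
  have "0 \<in> V" using \<psi>\<phi>(2)[OF qU] \<phi>q by simp
  then obtain e where e: "e > 0" "ball 0 e \<subseteq> V" using oV openE by blast
  \<comment> \<open>Length at most 1 keeps the shortened segments inside the star; length below
    \<open>e\<close> keeps them inside \<open>V\<close>.\<close>
  define \<epsilon> where "\<epsilon> = min 1 (e / 2)"
  have \<epsilon>: "0 < \<epsilon>" "\<epsilon> \<le> 1" "\<epsilon> < e" using e by (auto simp: \<epsilon>_def min_def)
  define \<alpha> where "\<alpha> = (\<lambda>(v::real^3) s::real. \<psi> ((\<epsilon> * s) *\<^sub>R v))"
  have inV: "(\<epsilon> * s) *\<^sub>R v \<in> V" if "v \<in> D" "s \<in> {0..1}" for v s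
  proof -
    have "\<epsilon> * s \<le> \<epsilon> * 1" using that \<epsilon> by (intro mult_left_mono) auto
    then have "\<epsilon> * s < e" using \<epsilon> by linarith
    then have "norm ((\<epsilon> * s) *\<^sub>R v) < e" using D1[OF that(1)] that \<epsilon> by simp
    then show ?thesis using e(2) by auto
  qed
  have Wstar: "\<psi> y \<in> W" if "y \<in> star_configuration D" "y \<in> V" for y
  proof -
    have "y \<in> \<phi> ` (W \<inter> U)" using img that by simp
    then obtain x where "x \<in> W" "x \<in> U" "\<phi> x = y" by auto
    then show ?thesis using \<psi>\<phi> by auto
  qed
  have instar: "(\<epsilon> * s) *\<^sub>R v \<in> star_configuration D" if "v \<in> D" "s \<in> {0..1}" for v s
  proof -
    have "\<epsilon> * s \<le> 1 * 1" using that \<epsilon> by (intro mult_mono) auto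
    then have "(\<epsilon> * s) *\<^sub>R v \<in> closed_segment 0 v"
      using that \<epsilon> by (auto simp: in_segment intro!: exI[of _ "\<epsilon> * s"])
    then show ?thesis using that by (auto simp: star_configuration_def)
  qed
  \<comment> \<open>The directions are unit vectors, so the norm of the model point is
    \<open>\<epsilon> * s\<close> and recovers the parameter; away from the origin the direction
    follows.\<close>
  have eqs: "s = t \<and> (s = 0 \<or> v = w)" if "v \<in> D" "w \<in> D" "s \<in> {0..1}" "t \<in> {0..1}" "\<alpha> v s = \<alpha> w t" for v w s t
  proof -
    have eq: "(\<epsilon> * s) *\<^sub>R v = (\<epsilon> * t) *\<^sub>R w"
      using that(5) \<phi>\<psi>(1)[OF inV] that(1-4) unfolding \<alpha>_def by metis
    then have "norm ((\<epsilon> * s) *\<^sub>R v) = norm ((\<epsilon> * t) *\<^sub>R w)" by simp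
    then have "s = t" using D1 that \<epsilon> by simp
    then show ?thesis using eq \<epsilon> by auto
  qed
  have qW: "q \<in> W" using Wstar[of 0] \<open>0 \<in> V\<close> \<psi>\<phi>(1)[OF qU] \<phi>q by (simp add: star_configuration_def)
  have "star_germ W q D \<alpha>"
    unfolding star_germ_def
  proof (intro conjI ballI impI)
    fix v assume v: "v \<in> D"
    show "continuous_on {0..1} (\<alpha> v)"
      unfolding \<alpha>_def by (rule continuous_on_compose2[OF c\<psi>]) (use inV v in \<open>auto intro!: continuous_intros\<close>)
    show "inj_on (\<alpha> v) {0..1}" using eqs v by (auto intro!: inj_onI)
    show "\<alpha> v 0 = q" using \<psi>\<phi>(1)[OF qU] \<phi>q by (simp add: \<alpha>_def)
    show "\<alpha> v ` {0..1} \<subseteq> W" using Wstar inV instar v by (auto simp: \<alpha>_def)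
  next
    fix v w assume vw: "v \<in> D" "w \<in> D" "v \<noteq> w"
    show "\<alpha> v ` {0..1} \<inter> \<alpha> w ` {0..1} \<subseteq> {q}"
    proof
      fix z assume "z \<in> \<alpha> v ` {0..1} \<inter> \<alpha> w ` {0..1}"
      then obtain s t where st: "s \<in> {0..1}" "t \<in> {0..1}" "z = \<alpha> v s" "\<alpha> v s = \<alpha> w t" by auto
      then have "s = 0" using eqs[OF vw(1,2) st(1,2,4)] vw by auto
      then show "z \<in> {q}" using st \<psi>\<phi>(1)[OF qU] \<phi>q by (simp add: \<alpha>_def)
    qed
  next
    have "open (U \<inter> \<phi> -` ball 0 \<epsilon>)"
      using continuous_open_preimage[OF c\<phi> oU] by simp
    moreover have "q \<in> U \<inter> \<phi> -` ball 0 \<epsilon>" using qU \<phi>q \<epsilon> by simp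
    moreover have "W \<inter> (U \<inter> \<phi> -` ball 0 \<epsilon>) \<subseteq> insert q (\<Union>v\<in>D. \<alpha> v ` {0..1})"
    proof
      fix z assume z: "z \<in> W \<inter> (U \<inter> \<phi> -` ball 0 \<epsilon>)"
      then have zs: "\<phi> z \<in> star_configuration D" "norm (\<phi> z) < \<epsilon>" "z = \<psi> (\<phi> z)" using img \<psi>\<phi> by auto
      show "z \<in> insert q (\<Union>v\<in>D. \<alpha> v ` {0..1})"
      proof (cases "\<phi> z = 0")
        case True
        then show ?thesis using zs(3) \<psi>\<phi>(1)[OF qU] \<phi>q by simp
      next
        case False
        then obtain v s where v: "v \<in> D" "0 \<le> s" "s \<le> 1" "\<phi> z = s *\<^sub>R v"
          using zs(1) by (auto simp: star_configuration_def in_segment)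
        then have "s < \<epsilon>" using zs(2) D1 by simp
        then have "s / \<epsilon> \<in> {0..1}" "\<alpha> v (s / \<epsilon>) = z" using v zs(3) \<epsilon> by (auto simp: \<alpha>_def)
        then show ?thesis using v by blast
      qed
    qed
    ultimately show "\<exists>U. open U \<and> q \<in> U \<and> W \<inter> U \<subseteq> insert q (\<Union>v\<in>D. \<alpha> v ` {0..1})" by blast
  qed (use D qW in auto)
  then show ?thesis using D(2) by blast
qed

text \<open>The two arms run to the right and to the left of \<open>f q\<close> on the line. The
  index type \<open>bool\<close> has two elements, so such a point has degree 2.\<close>

lemma locally_line_imp_star_germ:
  fixes W :: "'a::euclidean_space set"
  assumes "open U" "q \<in> W" "q \<in> U" "(W \<inter> U) homeomorphic (UNIV :: real set)"
  shows "\<exists>\<alpha>. star_germ W q (UNIV :: bool set) \<alpha>"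
proof -
  obtain f g where hom: "homeomorphism (W \<inter> U) (UNIV :: real set) f g"
    using assms(4) by (auto simp: homeomorphic_def)
  have gf: "g (f x) = x" if "x \<in> W \<inter> U" for x using hom that by (auto simp: homeomorphism_def)
  have fg: "f (g s) = s" "g s \<in> W \<inter> U" for s using hom by (auto simp: homeomorphism_def)
  have cg: "continuous_on UNIV g" and cf: "continuous_on (W \<inter> U) f" using hom by (auto simp: homeomorphism_def)
  have ing: "g s = g t \<longleftrightarrow> s = t" for s t using fg(1) by metis
  have gq: "g (f q) = q" using gf assms by simp
  define \<alpha> where "\<alpha> = (\<lambda>b s. g (if b then f q + s else f q - s))"
  have "star_germ W q UNIV \<alpha>"
    unfolding star_germ_def
  proof (intro conjI ballI impI)
    fix b
    show "continuous_on {0..1} (\<alpha> b)"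
      unfolding \<alpha>_def by (cases b) (auto intro!: continuous_intros continuous_on_compose2[OF cg])
    show "inj_on (\<alpha> b) {0..1}" by (auto intro!: inj_onI simp: \<alpha>_def ing split: if_splits)
    show "\<alpha> b 0 = q" using gq by (simp add: \<alpha>_def)
    show "\<alpha> b ` {0..1} \<subseteq> W" using fg by (auto simp: \<alpha>_def)
  next
    fix a b :: bool assume "a \<noteq> b"
    show "\<alpha> a ` {0..1} \<inter> \<alpha> b ` {0..1} \<subseteq> {q}"
    proof
      fix z assume "z \<in> \<alpha> a ` {0..1} \<inter> \<alpha> b ` {0..1}"
      then obtain s t where st: "0 \<le> s" "0 \<le> t" "z = \<alpha> a s" "\<alpha> a s = \<alpha> b t" by auto
      then have "s = 0" using \<open>a \<noteq> b\<close> by (auto simp: \<alpha>_def ing split: if_splits)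
      then have "z = \<alpha> a 0" using st by simp
      then show "z \<in> {q}" using gq by (simp add: \<alpha>_def)
    qed
  next
    have "openin (top_of_set (W \<inter> U)) ((W \<inter> U) \<inter> f -` {f q - 1<..<f q + 1})"
      by (rule continuous_openin_preimage_gen[OF cf]) simp
    then obtain U' where U': "open U'" "(W \<inter> U) \<inter> f -` {f q - 1<..<f q + 1} = (W \<inter> U) \<inter> U'"
      using openin_open by metis
    have "W \<inter> (U \<inter> U') \<subseteq> insert q (\<Union>b\<in>UNIV. \<alpha> b ` {0..1})"
    proof
      fix z assume "z \<in> W \<inter> (U \<inter> U')"
      then have z: "z \<in> W \<inter> U" "z \<in> (W \<inter> U) \<inter> f -` {f q - 1<..<f q + 1}" using U'(2) by auto
      then have lt: "\<bar>f z - f q\<bar> < 1" by auto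
      then have "z = \<alpha> (f z \<ge> f q) \<bar>f z - f q\<bar>" using gf[OF z(1)] by (auto simp: \<alpha>_def)
      then show "z \<in> insert q (\<Union>b\<in>UNIV. \<alpha> b ` {0..1})" using lt by fastforce
    qed
    moreover have "q \<in> U'" using U'(2) assms by auto
    ultimately show "\<exists>U. open U \<and> q \<in> U \<and> W \<inter> U \<subseteq> insert q (\<Union>b\<in>UNIV. \<alpha> b ` {0..1})"
      using U'(1) assms by (intro exI[of _ "U \<inter> U'"]) auto
  qed (use assms in auto)
  then show ?thesis by blast
qed

section \<open>Systems of wedge curves\<close>

text \<open>The only coincidence allowed in a simple path involves both ends, so it is enough that
  one parameter is interior; the other may be an end.\<close>

lemma simple_path_inj_interior:
  assumes "simple_path c" "c s = c t" "s \<in> {0<..<1}" "t \<in> {0..1}"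
  shows "s = t"
  using assms unfolding simple_path_def loop_free_def by (metis atLeastAtMost_iff greaterThanLessThan_iff less_irrefl less_imp_le)

text \<open>\<open>F\<close> will be the set of cone points. They may be isolated in
  \<open>W\<close> or lie on one of the curves.\<close>

locale graph =
  fixes W :: "(real^3) set" and C :: "(real \<Rightarrow> real^3) set" and F :: "(real^3) set"
  assumes curves: "wedge_curve_system C" and F_finite: "finite F"
    and W_eq: "W = (\<Union>c\<in>C. path_image c) \<union> F"
begin

text \<open>Points of \<open>F\<close> on an open curve are not nodes, while isolated points of
  \<open>F\<close> and base points of closed curves are.\<close>

definition nodes :: "(real^3) set" where
  "nodes = W - (\<Union>c\<in>C. c ` {0<..<1})"

text \<open>A pair of a curve and a flag is a half-edge, so a closed curve contributes two edge ends
  at its base point.\<close>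

definition edge_end :: "(real \<Rightarrow> real^3) \<times> bool \<Rightarrow> real^3" where
  "edge_end = (\<lambda>(c, b). if b then c 0 else c 1)"

definition edge_ends_at :: "real^3 \<Rightarrow> ((real \<Rightarrow> real^3) \<times> bool) set" where
  "edge_ends_at q = {e \<in> C \<times> UNIV. edge_end e = q}"

lemma C_finite: "finite C"
  using curves by (simp add: wedge_curve_system_def)

lemma C_simple: "c \<in> C \<Longrightarrow> simple_path c"
  using curves by (simp add: wedge_curve_system_def)

lemma C_continuous: "c \<in> C \<Longrightarrow> continuous_on {0..1} c"
  using C_simple simple_path_def path_def by blast

lemma C_meet: "\<lbrakk>c \<in> C; c' \<in> C; c \<noteq> c'\<rbrakk> \<Longrightarrow> c ` {0..1} \<inter> c' ` {0..1} \<subseteq> {c 0, c 1} \<inter> {c' 0, c' 1}"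
  using curves by (simp add: wedge_curve_system_def path_image_def pathstart_def pathfinish_def)

lemma in_W_iff: "z \<in> W \<longleftrightarrow> (\<exists>c\<in>C. \<exists>t\<in>{0..1}. z = c t) \<or> z \<in> F"
  by (auto simp: W_eq path_image_def)

lemma in_nodes_iff: "z \<in> nodes \<longleftrightarrow> z \<in> W \<and> (\<forall>c\<in>C. \<forall>t\<in>{0<..<1}. z \<noteq> c t)"
  by (auto simp: nodes_def)

lemma curve_in_W: "c \<in> C \<Longrightarrow> t \<in> {0..1} \<Longrightarrow> c t \<in> W"
  unfolding in_W_iff by blast

lemma interior_notin_nodes: "c \<in> C \<Longrightarrow> t \<in> {0<..<1} \<Longrightarrow> c t \<notin> nodes"
  unfolding in_nodes_iff by blast

text \<open>Distinct curves meet only in points that are ends of both, and by simplicity an inner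
  point of a curve is never one of its ends.\<close>

lemma interior_unique:
  assumes "c \<in> C" "c' \<in> C" "c s = c' t" "s \<in> {0<..<1}" "t \<in> {0..1}"
  shows "c = c' \<and> s = t"
proof -
  have "c = c'"
  proof (rule ccontr)
    assume "c \<noteq> c'"
    have "c s \<in> c ` {0..1}" using assms(4) by auto
    moreover have "c s \<in> c' ` {0..1}" using assms(3,5) by auto
    ultimately have "c s \<in> c ` {0..1} \<inter> c' ` {0..1}" by blast
    then have "c s = c 0 \<or> c s = c 1" using C_meet[OF assms(1,2) \<open>c \<noteq> c'\<close>] by blast
    then show False
      using simple_path_inj_interior[OF C_simple[OF assms(1)], of s 0]
        simple_path_inj_interior[OF C_simple[OF assms(1)], of s 1] assms(4) by auto
  qed
  then show ?thesis using simple_path_inj_interior[OF C_simple[OF assms(1)], of s t] assms by simp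
qed

lemma end_in_nodes:
  assumes "e \<in> C \<times> UNIV" shows "edge_end e \<in> nodes"
proof -
  obtain c b where e: "e = (c, b)" "c \<in> C" using assms by auto
  have *: "c u \<notin> c' ` {0<..<1}" if "u = 0 \<or> u = 1" "c' \<in> C" for u c'
    using interior_unique[of c' c _ u] e that by fastforce
  have "c u \<in> W" if "u = 0 \<or> u = 1" for u
    using that e curve_in_W[of c u] by auto
  then show ?thesis using * e by (auto simp: nodes_def edge_end_def)
qed

lemma nodes_subset: "nodes \<subseteq> edge_end ` (C \<times> UNIV) \<union> F"
proof
  fix q assume q: "q \<in> nodes"
  show "q \<in> edge_end ` (C \<times> UNIV) \<union> F"
  proof (cases "q \<in> F")
    case False
    then obtain c t where c: "c \<in> C" "t \<in> {0..1}" "q = c t"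
      using q in_nodes_iff in_W_iff by blast
    then have "t \<notin> {0<..<1}" using q by (auto simp: nodes_def)
    then have "t = 0 \<or> t = 1" using c by auto
    then have "q = edge_end (c, t = 0)" using c by (auto simp: edge_end_def)
    then show ?thesis using c by auto
  qed simp
qed

lemma finite_nodes: "finite nodes"
  by (rule finite_subset[OF nodes_subset]) (use C_finite F_finite in auto)

lemma W_cells: "W = nodes \<union> (\<Union>c\<in>C. c ` {0..1})"
proof
  show "W \<subseteq> nodes \<union> (\<Union>c\<in>C. c ` {0..1})"
    by (force simp: nodes_def)
  show "nodes \<union> (\<Union>c\<in>C. c ` {0..1}) \<subseteq> W"
    using curve_in_W by (auto simp: nodes_def)
qed

lemma set_euler_graph: "set_euler W (int (card nodes) - int (card C))"
proof -
  have "set_euler (nodes \<union> (\<Union>c\<in>C. c ` {0..1})) (int (card nodes) - int (card C))"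
  proof (rule set_euler_attach_arcs[OF C_finite finite_imp_compact[OF finite_nodes] set_euler_finite[OF finite_nodes]])
    show "c 0 \<in> nodes \<and> c 1 \<in> nodes" if "c \<in> C" for c
      using end_in_nodes[of "(c, True)"] end_in_nodes[of "(c, False)"] that by (simp add: edge_end_def)
    show "c = c' \<and> s = t"
      if "c \<in> C" "c' \<in> C" "s \<in> {0<..<1}" "t \<in> {0<..<1}" "c s = c' t" for c c' s t
      using interior_unique[OF that(1,2,5,3)] that(4) by simp
  qed (use C_continuous interior_notin_nodes in blast)+
  then show ?thesis using W_cells by simp
qed

text \<open>Handshake count: each of the \<open>2 * card C\<close> half-edges ends at exactly one
  node.\<close>

lemma sum_edge_ends: "(\<Sum>q\<in>nodes. int (card (edge_ends_at q))) = 2 * int (card C)"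
proof -
  have "(\<Sum>q\<in>nodes. \<Sum>e | e \<in> C \<times> UNIV \<and> edge_end e = q. (1::int)) = (\<Sum>e\<in>C \<times> (UNIV :: bool set). 1)"
    using C_finite finite_nodes end_in_nodes by (intro sum.group) auto
  then show ?thesis by (simp add: edge_ends_at_def card_cartesian_product)
qed

lemma node_star_germ:
  assumes q: "q \<in> nodes"
  shows "\<exists>\<alpha>. star_germ W q (edge_ends_at q) \<alpha>"
proof -
  \<comment> \<open>Each arm is an end third of its curve, so the two arms of a closed curve at its
    base point do not overlap.\<close>
  define p where "p = (\<lambda>b (s::real). if b then s / 3 else 1 - s / 3)"
  define \<alpha> where "\<alpha> = (\<lambda>(c :: real \<Rightarrow> real^3, b) s. c (p b s))"
  define thirds where "thirds = (\<lambda>c :: real \<Rightarrow> real^3. c ` {1/3..2/3} \<union>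
     (if c 0 = q then {} else c ` {0..1/3}) \<union> (if c 1 = q then {} else c ` {2/3..1}))"
  \<comment> \<open>All of \<open>W\<close> except the arms at \<open>q\<close>: middle thirds, end
    thirds that do not end at \<open>q\<close>, and the other points of \<open>F\<close>. It is
    closed and avoids \<open>q\<close>, so its complement is the neighbourhood required of a
    germ.\<close>
  define K where "K = (\<Union>c\<in>C. thirds c) \<union> (F - {q})"
  have not_open: "c t \<noteq> q" if "c \<in> C" "0 < t" "t < 1" for c t
    using q that by (auto simp: nodes_def)
  have inner: "p b s \<in> {0<..<1}" if "0 < s" "s \<le> 1" for b s using that by (auto simp: p_def)
  have p01: "p b s \<in> {0..1}" if "s \<in> {0..1}" for b s using that by (auto simp: p_def)
  have \<alpha>0: "\<alpha> e 0 = q" if "e \<in> edge_ends_at q" for e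
    using that by (auto simp: edge_ends_at_def edge_end_def \<alpha>_def p_def split: if_splits)
  have eqs: "s = 0 \<or> (e = e' \<and> s = t)"
    if e: "e \<in> edge_ends_at q" "e' \<in> edge_ends_at q" and st: "s \<in> {0..1}" "t \<in> {0..1}"
      and eq: "\<alpha> e s = \<alpha> e' t" for e e' s t
  proof (cases "s = 0")
    case False
    obtain c b c' b' where cb: "e = (c, b)" "e' = (c', b')" "c \<in> C" "c' \<in> C"
      using e by (auto simp: edge_ends_at_def)
    have "c = c' \<and> p b s = p b' t"
      by (rule interior_unique) (use cb eq inner[of s b] p01[OF st(2), of b'] st False in \<open>auto simp: \<alpha>_def\<close>)
    then show ?thesis using cb st by (auto simp: p_def split: if_splits)
  qed simp
  have "star_germ W q (edge_ends_at q) \<alpha>"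
    unfolding star_germ_def
  proof (intro conjI ballI impI)
    show "finite (edge_ends_at q)" using C_finite by (simp add: edge_ends_at_def)
    show "q \<in> W" using q by (simp add: nodes_def)
  next
    fix e assume e: "e \<in> edge_ends_at q"
    then obtain c b where cb: "e = (c, b)" "c \<in> C" by (auto simp: edge_ends_at_def)
    show "continuous_on {0..1} (\<alpha> e)"
      unfolding cb \<alpha>_def prod.case
      by (rule continuous_on_compose2[OF C_continuous[OF cb(2)]])
         (cases b, use p01 in \<open>auto simp: p_def intro!: continuous_intros\<close>)
    show "inj_on (\<alpha> e) {0..1}"
    proof (rule inj_onI)
      fix s t assume st: "s \<in> {0..1}" "t \<in> {0..1}" "\<alpha> e s = \<alpha> e t"
      show "s = t" using eqs[OF e e st] eqs[OF e e st(2,1) st(3)[symmetric]] by auto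
    qed
    show "\<alpha> e 0 = q" by (rule \<alpha>0[OF e])
    show "\<alpha> e ` {0..1} \<subseteq> W"
      using p01 cb by (fastforce simp: \<alpha>_def in_W_iff)
  next
    fix e e' assume e: "e \<in> edge_ends_at q" "e' \<in> edge_ends_at q" "e \<noteq> e'"
    show "\<alpha> e ` {0..1} \<inter> \<alpha> e' ` {0..1} \<subseteq> {q}"
    proof
      fix z assume "z \<in> \<alpha> e ` {0..1} \<inter> \<alpha> e' ` {0..1}"
      then obtain s t where st: "s \<in> {0..1}" "t \<in> {0..1}" "z = \<alpha> e s" "\<alpha> e s = \<alpha> e' t" by auto
      then have "s = 0" using eqs[OF e(1,2) st(1,2,4)] e(3) by auto
      then show "z \<in> {q}" using st \<alpha>0[OF e(1)] by simp
    qed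
  next
    have "compact (thirds c)" if "c \<in> C" for c
      unfolding thirds_def using continuous_on_subset[OF C_continuous[OF that]]
      by (intro compact_Un) (auto intro!: compact_continuous_image)
    then have "closed K"
      unfolding K_def using C_finite F_finite
      by (intro compact_imp_closed compact_Un compact_UN finite_imp_compact[of "F - {q}"]) auto
    moreover have "q \<notin> K"
    proof -
      have "q \<notin> thirds c" if c: "c \<in> C" for c
      proof
        assume "q \<in> thirds c"
        then obtain t where t: "c t = q" "0 \<le> t" "t \<le> 1" "t = 0 \<longrightarrow> c 0 \<noteq> q" "t = 1 \<longrightarrow> c 1 \<noteq> q"
          by (fastforce simp: thirds_def split: if_splits)
        then show False using not_open[OF c, of t] by (cases "t = 0"; cases "t = 1") auto
      qed
      then show ?thesis by (auto simp: K_def)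
    qed
    moreover have "W \<inter> (- K) \<subseteq> insert q (\<Union>e\<in>edge_ends_at q. \<alpha> e ` {0..1})"
    proof
      fix z assume z: "z \<in> W \<inter> (- K)"
      show "z \<in> insert q (\<Union>e\<in>edge_ends_at q. \<alpha> e ` {0..1})"
      proof (cases "z \<in> F")
        case True
        then show ?thesis using z by (auto simp: K_def)
      next
        case False
        then obtain c t where c: "c \<in> C" "z = c t" "0 \<le> t" "t \<le> 1"
          using z in_W_iff[of z] by auto
        have nt: "z \<notin> thirds c" using z c by (auto simp: K_def)
        consider "t < 1/3" | "2/3 < t" | "1/3 \<le> t" "t \<le> 2/3" by linarith
        then show ?thesis
        proof cases
          case 1
          then have "c 0 = q" using nt c by (auto simp: thirds_def split: if_splits)
          then have "(c, True) \<in> edge_ends_at q" using c by (simp add: edge_ends_at_def edge_end_def)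
          moreover have "z = \<alpha> (c, True) (3 * t)" using c by (simp add: \<alpha>_def p_def)
          moreover have "3 * t \<in> {0..1}" using 1 c by auto
          ultimately show ?thesis by blast
        next
          case 2
          then have "c 1 = q" using nt c by (auto simp: thirds_def split: if_splits)
          then have "(c, False) \<in> edge_ends_at q" using c by (simp add: edge_ends_at_def edge_end_def)
          moreover have "z = \<alpha> (c, False) (3 * (1 - t))"
            using c by (simp add: \<alpha>_def p_def diff_divide_distrib)
          moreover have "3 * (1 - t) \<in> {0..1}" using 2 c by auto
          ultimately show ?thesis by blast
        next
          case 3
          then show ?thesis using nt c by (auto simp: thirds_def)
        qed
      qed
    qed
    ultimately show "\<exists>U. open U \<and> q \<in> U \<and> W \<inter> U \<subseteq> insert q (\<Union>e\<in>edge_ends_at q. \<alpha> e ` {0..1})"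
      by (intro exI[of _ "- K"]) auto
  qed
  then show ?thesis by blast
qed

text \<open>A point that is not a node is an inner point of a single curve. Nodes, other curves and
  the two far ends of this curve form a compact set, off which only an open subarc is left.\<close>

lemma locally_line_outside_nodes:
  assumes "q \<in> W" "q \<notin> nodes"
  shows "\<exists>U. open U \<and> q \<in> U \<and> (W \<inter> U) homeomorphic (UNIV :: real set)"
proof -
  obtain c t where c: "c \<in> C" "q = c t" "0 < t" "t < 1"
    using assms by (auto simp: nodes_def)
  define a b where "a = t / 2" and "b = (t + 1) / 2"
  have ab: "0 < a" "a < t" "t < b" "b < 1" using c by (auto simp: a_def b_def)
  define K where "K = nodes \<union> (\<Union>c'\<in>C - {c}. c' ` {0..1}) \<union> c ` {0..a} \<union> c ` {b..1}"
  have "compact K"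
    unfolding K_def using finite_nodes C_finite C_continuous c(1) ab
    by (intro compact_Un compact_UN finite_imp_compact[of nodes] compact_continuous_image)
       (auto intro: continuous_on_subset[OF C_continuous[OF c(1)]])
  then have "open (- K)" by (simp add: compact_imp_closed open_Compl)
  have notK: "c s \<notin> K" if s: "s \<in> {a<..<b}" for s
  proof -
    have s01: "s \<in> {0<..<1}" using s ab by auto
    have "c s \<notin> nodes" using s01 c interior_notin_nodes by blast
    moreover have "c s \<notin> c' ` {0..1}" if "c' \<in> C - {c}" for c'
      using interior_unique[OF c(1), of c' s] s01 that by blast
    moreover have "c s \<noteq> c u" if "u \<in> {0..a} \<union> {b..1}" for u
      using interior_unique[OF c(1) c(1), of s u] s01 s that ab by auto
    ultimately show ?thesis unfolding K_def by blast
  qed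
  have "W \<inter> - K = c ` {a<..<b}"
  proof
    have "c s \<in> W" if "s \<in> {a<..<b}" for s
      using that c(1) ab by (intro curve_in_W) auto
    then show "c ` {a<..<b} \<subseteq> W \<inter> - K" using notK by auto
    show "W \<inter> - K \<subseteq> c ` {a<..<b}"
    proof
      fix z assume z: "z \<in> W \<inter> - K"
      then have "z \<in> nodes \<union> (\<Union>c\<in>C. c ` {0..1})" using W_cells by blast
      then have "z \<in> c ` {0..1}" using z unfolding K_def by blast
      then obtain u where u: "z = c u" "0 \<le> u" "u \<le> 1" by auto
      then have "\<not> u \<le> a" "\<not> b \<le> u" using z unfolding K_def by auto
      then show "z \<in> c ` {a<..<b}" using u by auto
    qed
  qed
  moreover have "c ` {a<..<b} homeomorphic (UNIV :: real set)"
  proof -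
    have "\<exists>g. homeomorphism {a..b} (c ` {a..b}) c g"
    proof (rule homeomorphism_compact)
      show "continuous_on {a..b} c"
        by (rule continuous_on_subset[OF C_continuous[OF c(1)]]) (use ab in auto)
      show "inj_on c {a..b}"
        using simple_path_inj_interior[OF C_simple[OF c(1)]] ab by (intro inj_onI) auto
    qed auto
    then obtain g where "homeomorphism {a..b} (c ` {a..b}) c g" by blast
    then have "homeomorphism {a<..<b} (c ` {a<..<b}) c g"
      by (rule homeomorphism_of_subsets[OF _ _ subset_refl]) auto
    then have "{a<..<b} homeomorphic c ` {a<..<b}" by (auto simp: homeomorphic_def)
    then show ?thesis
      using homeomorphic_open_interval_UNIV[of a b] ab homeomorphic_sym homeomorphic_trans
      by (metis less_trans)
  qed
  ultimately have "(W \<inter> - K) homeomorphic (UNIV :: real set)" by simp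
  moreover have "q \<in> - K" using notK[of t] ab c by simp
  ultimately show ?thesis using \<open>open (- K)\<close> by blast
qed

end

section \<open>A single closed ribbon\<close>

lemma smooth_on_imp_continuous_on: "smooth_on U f \<Longrightarrow> continuous_on U f"
  by (metis smooth_on_def Ck_on.simps(1))

text \<open>The topological data of a closed Cartan ribbon: continuous centre curve and widths, unit
  rulings, positivity, and closing up after one period.\<close>

locale strip =
  fixes r :: ribbon
  assumes center_continuous: "continuous_on UNIV (center r)"
    and ruling_continuous: "continuous_on UNIV (ruling r)"
    and ruling_norm: "norm (ruling r t) = 1"
    and width_neg_continuous: "continuous_on UNIV (width_neg r)"
    and width_neg_pos: "width_neg r t > 0"
    and width_pos_continuous: "continuous_on UNIV (width_pos r)"
    and width_pos_pos: "width_pos r t > 0"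
    and closed: "closed_ribbon r"
begin

abbreviation "L \<equiv> period r"

lemma period_pos: "L > 0"
  using closed by (simp add: closed_ribbon_def)

text \<open>\<open>shift s \<epsilon>\<close>: translating the parameter by \<open>s\<close> is a symmetry of the ribbon that
  multiplies the ruling coordinate by the sign \<open>\<epsilon>\<close>.\<close>

definition shift :: "real \<Rightarrow> real \<Rightarrow> bool" where
  "shift s \<epsilon> \<longleftrightarrow> (\<epsilon> = 1 \<or> \<epsilon> = -1) \<and>
     (\<forall>t. center r (t + s) = center r t \<and> ruling r (t + s) = \<epsilon> *\<^sub>R ruling r t \<and>
        width_neg r (t + s) = (if \<epsilon> = 1 then width_neg r t else width_pos r t) \<and>
        width_pos r (t + s) = (if \<epsilon> = 1 then width_pos r t else width_neg r t))"

lemma shift_period: "\<exists>\<epsilon>. shift L \<epsilon>"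
proof -
  have "shift L 1 \<or> shift L (-1)"
    using closed by (auto simp: closed_ribbon_def shift_def)
  then show ?thesis by blast
qed

lemma shift_add:
  assumes "shift s \<epsilon>" "shift s' \<epsilon>'"
  shows "shift (s + s') (\<epsilon> * \<epsilon>')"
  using assms unfolding shift_def add.assoc[symmetric] by auto

lemma shift_uminus:
  assumes "shift s \<epsilon>"
  shows "shift (- s) \<epsilon>"
proof -
  have \<epsilon>: "\<epsilon> = 1 \<or> \<epsilon> = -1" using assms by (simp add: shift_def)
  have *: "center r t = center r (t - s)" "ruling r t = \<epsilon> *\<^sub>R ruling r (t - s)"
     "width_neg r t = (if \<epsilon> = 1 then width_neg r (t - s) else width_pos r (t - s))"
     "width_pos r t = (if \<epsilon> = 1 then width_pos r (t - s) else width_neg r (t - s))" for t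
    using assms[unfolded shift_def, THEN conjunct2, THEN spec, of "t - s"] by simp_all
  have "center r (t + - s) = center r t \<and> ruling r (t + - s) = \<epsilon> *\<^sub>R ruling r t \<and>
        width_neg r (t + - s) = (if \<epsilon> = 1 then width_neg r t else width_pos r t) \<and>
        width_pos r (t + - s) = (if \<epsilon> = 1 then width_pos r t else width_neg r t)" for t
    using \<epsilon> *[of t] by auto
  then show ?thesis using \<epsilon> unfolding shift_def by blast
qed

lemma shift_int: "\<exists>\<epsilon>. shift (of_int n * L) \<epsilon>"
proof -
  have *: "\<exists>\<epsilon>. shift (real k * L) \<epsilon>" for k
  proof (induction k)
    case 0
    have "shift 0 1" by (simp add: shift_def)
    then show ?case by auto
  next
    case (Suc k)
    then obtain \<epsilon> where "shift (real k * L) \<epsilon>" by blast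
    moreover obtain \<epsilon>' where "shift L \<epsilon>'" using shift_period by blast
    ultimately have "shift (real k * L + L) (\<epsilon> * \<epsilon>')" by (rule shift_add)
    moreover have "real (Suc k) * L = real k * L + L" by (simp add: algebra_simps)
    ultimately show ?case by metis
  qed
  show ?thesis
  proof (cases "n \<ge> 0")
    case True
    then show ?thesis using *[of "nat n"] by simp
  next
    case False
    then have "of_int n * L = - (real (nat (- n)) * L)" by simp
    then show ?thesis using *[of "nat (- n)"] shift_uminus by metis
  qed
qed

lemma shift_map: "shift s \<epsilon> \<Longrightarrow> ribbon_map r (t + s, u) = ribbon_map r (t, \<epsilon> * u)"
  by (simp add: shift_def ribbon_map_def mult.commute)

lemma shift_dom: "shift s \<epsilon> \<Longrightarrow> (t + s, u) \<in> ribbon_dom r \<longleftrightarrow> (t, \<epsilon> * u) \<in> ribbon_dom r"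
  by (auto simp: shift_def ribbon_dom_def)

lemma shift_edge: "shift s \<epsilon> \<Longrightarrow> (t + s, u) \<in> ribbon_edge r \<longleftrightarrow> (t, \<epsilon> * u) \<in> ribbon_edge r"
  by (auto simp: shift_def ribbon_edge_def)

text \<open>Reduction to one half-open period. The sign records whether the translation used
  reverses the rulings, as can happen on a Moebius strip.\<close>

lemma normalize_param:
  obtains s \<epsilon> where "0 \<le> s" "s < L" "\<epsilon> = 1 \<or> \<epsilon> = -1"
    "\<And>u. ribbon_map r (t, u) = ribbon_map r (s, \<epsilon> * u)"
    "\<And>u. (t, u) \<in> ribbon_dom r \<longleftrightarrow> (s, \<epsilon> * u) \<in> ribbon_dom r"
    "\<And>u. (t, u) \<in> ribbon_edge r \<longleftrightarrow> (s, \<epsilon> * u) \<in> ribbon_edge r"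
proof -
  define n where "n = \<lfloor>t / L\<rfloor>"
  define s where "s = t - of_int n * L"
  obtain \<epsilon> where \<epsilon>: "shift (of_int n * L) \<epsilon>" using shift_int by blast
  have t: "t = s + of_int n * L" by (simp add: s_def)
  have "of_int n \<le> t / L" "t / L < of_int n + 1" unfolding n_def by linarith+
  then have "0 \<le> s" "s < L" using period_pos by (simp_all add: s_def field_simps)
  then show ?thesis
    using that[of s \<epsilon>] \<epsilon> shift_map[OF \<epsilon>, of s] shift_dom[OF \<epsilon>, of s] shift_edge[OF \<epsilon>, of s]
    unfolding t[symmetric] by (simp add: shift_def)
qed

text \<open>Equal parameter classes differ by a shift symmetry, and every shift preserves the
  edge.\<close>

lemma same_param_inner_not_edge:
  assumes "x \<in> ribbon_inner r" "same_param r x y"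
  shows "y \<notin> ribbon_edge r"
proof
  assume y: "y \<in> ribbon_edge r"
  obtain t u t' u' where xy: "x = (t, u)" "y = (t', u')" by (cases x, cases y)
  then obtain n :: int where n: "t' = t + of_int n * L" "u *\<^sub>R ruling r t = u' *\<^sub>R ruling r t'"
    using assms(2) by (auto simp: same_param_def)
  obtain \<epsilon> where \<epsilon>: "shift (of_int n * L) \<epsilon>" using shift_int by blast
  then have "u *\<^sub>R ruling r t = (\<epsilon> * u') *\<^sub>R ruling r t"
    using n by (simp add: shift_def mult.commute)
  then have "u = \<epsilon> * u'" using ruling_norm[of t] by (metis norm_zero scaleR_cancel_right zero_neq_one)
  then have "(t, u) \<in> ribbon_edge r" using y shift_edge[OF \<epsilon>] n xy by simp
  then show False using assms(1) xy by (auto simp: ribbon_inner_def ribbon_edge_def)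
qed

lemma same_param_unique:
  assumes "same_param r (t, u) (t', u')" "\<bar>t - t'\<bar> < L"
  shows "t = t' \<and> u = u'"
proof -
  obtain n :: int where n: "t' = t + of_int n * L" "u *\<^sub>R ruling r t = u' *\<^sub>R ruling r t'"
    using assms(1) by (auto simp: same_param_def)
  have "n = 0"
  proof (rule ccontr)
    assume "n \<noteq> 0"
    then have "1 \<le> \<bar>real_of_int n\<bar>" by linarith
    then have "1 * L \<le> \<bar>of_int n\<bar> * L" using period_pos by (intro mult_right_mono) auto
    then show False using assms(2) n(1) period_pos by (simp add: abs_mult)
  qed
  then have "t = t'" using n by simp
  moreover have "ruling r t \<noteq> 0" using ruling_norm[of t] by auto
  ultimately show ?thesis using n \<open>n = 0\<close> by simp
qed

lemma inner_subset_dom: "ribbon_inner r \<subseteq> ribbon_dom r"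
  by (auto simp: ribbon_inner_def ribbon_dom_def)

lemma edge_subset_dom: "ribbon_edge r \<subseteq> ribbon_dom r"
  using width_neg_pos width_pos_pos
  by (auto simp: ribbon_edge_def ribbon_dom_def) (smt (verit))+

lemma ribbon_map_continuous: "continuous_on UNIV (ribbon_map r)"
  unfolding ribbon_map_def case_prod_unfold
  by (intro continuous_intros continuous_on_compose2[OF center_continuous]
      continuous_on_compose2[OF ruling_continuous]) auto

section \<open>Edge arcs, cross cut and square of a ribbon\<close>

definition edge_param :: "bool \<Rightarrow> real \<Rightarrow> real \<times> real" where
  "edge_param b s = (L * s, if b then width_pos r (L * s) else - width_neg r (L * s))"

text \<open>One period of the upper or of the lower edge. A band has two closed edges; on a Moebius
  strip the two arcs join into a single one.\<close>

definition edge_arc :: "bool \<Rightarrow> real \<Rightarrow> real^3" where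
  "edge_arc b s = ribbon_map r (edge_param b s)"

definition cross_cut :: "real \<Rightarrow> real^3" where
  "cross_cut s = ribbon_map r (0, s * width_pos r 0 - (1 - s) * width_neg r 0)"

text \<open>Affine rescaling of the square with half-side 1: the first coordinate runs through one
  period, the second along a ruling. Both vertical sides go to the cross cut, the horizontal ones to
  the edges.\<close>

definition square_param :: "real \<times> real \<Rightarrow> real \<times> real" where
  "square_param = (\<lambda>(a, b). (L * ((a + 1) / 2),
     (1 + b) / 2 * width_pos r (L * ((a + 1) / 2)) - (1 - b) / 2 * width_neg r (L * ((a + 1) / 2))))"

definition square_cell :: "real \<times> real \<Rightarrow> real^3" where
  "square_cell x = ribbon_map r (square_param x)"

lemma edge_param_in_edge: "edge_param b s \<in> ribbon_edge r"
  by (simp add: edge_param_def ribbon_edge_def)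

text \<open>Less than a period apart, the parameters must agree; the sign of the ruling coordinate
  then tells the two edges apart, since the widths are positive.\<close>

lemma edge_param_unique:
  assumes same: "same_param r (edge_param b s) (edge_param b' t)" and lt: "\<bar>s - t\<bar> < 1"
  shows "b = b' \<and> s = t"
proof -
  let ?u = "\<lambda>b t. if b then width_pos r t else - width_neg r t"
  have "\<bar>L * s - L * t\<bar> = L * \<bar>s - t\<bar>"
    using period_pos by (simp add: abs_mult right_diff_distrib[symmetric])
  also have "\<dots> < L * 1" using period_pos lt by (intro mult_strict_left_mono) auto
  finally have "\<bar>L * s - L * t\<bar> < L" by simp
  note eq = same_param_unique[OF same[unfolded edge_param_def] this]
  then have st: "s = t" using period_pos by simp
  have "?u b (L * s) = ?u b' (L * s)" using eq unfolding st by blast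
  then have "b = b'"
    using width_pos_pos[of "L * s"] width_neg_pos[of "L * s"] by (cases b; cases b'; simp)
  with st show ?thesis by simp
qed

lemma edge_arc_continuous: "continuous_on S (edge_arc b)"
proof (rule continuous_on_subset[OF _ subset_UNIV])
  show "continuous_on UNIV (edge_arc b)"
    unfolding edge_arc_def edge_param_def
    by (cases b) (auto intro!: continuous_on_compose2[OF ribbon_map_continuous] continuous_intros
      continuous_on_compose2[OF width_pos_continuous] continuous_on_compose2[OF width_neg_continuous])
qed

lemma cross_cut_continuous: "continuous_on S cross_cut"
  unfolding cross_cut_def
  by (rule continuous_on_compose2[OF ribbon_map_continuous]) (auto intro!: continuous_intros)

lemma square_cell_continuous: "continuous_on S square_cell"
proof (rule continuous_on_subset[OF _ subset_UNIV])
  show "continuous_on UNIV square_cell"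
    unfolding square_cell_def square_param_def case_prod_unfold
    by (auto intro!: continuous_on_compose2[OF ribbon_map_continuous] continuous_intros
      continuous_on_compose2[OF width_pos_continuous] continuous_on_compose2[OF width_neg_continuous])
qed

lemma edge_image: "ribbon_map r ` ribbon_edge r = (\<Union>b. edge_arc b ` {0..1})"
proof
  show "ribbon_map r ` ribbon_edge r \<subseteq> (\<Union>b. edge_arc b ` {0..1})"
  proof
    fix z assume "z \<in> ribbon_map r ` ribbon_edge r"
    then obtain t u where tu: "z = ribbon_map r (t, u)" "(t, u) \<in> ribbon_edge r" by auto
    obtain s \<epsilon> where s: "0 \<le> s" "s < L" "z = ribbon_map r (s, \<epsilon> * u)" "(s, \<epsilon> * u) \<in> ribbon_edge r"
      using normalize_param[of t] tu by metis
    then have "z = edge_arc (\<epsilon> * u = width_pos r s) (s / L)"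
      using period_pos by (auto simp: edge_arc_def edge_param_def ribbon_edge_def)
    moreover have "s / L \<in> {0..1}" using s period_pos by simp
    ultimately show "z \<in> (\<Union>b. edge_arc b ` {0..1})" by blast
  qed
  show "(\<Union>b. edge_arc b ` {0..1}) \<subseteq> ribbon_map r ` ribbon_edge r"
    by (auto simp: edge_arc_def edge_param_def ribbon_edge_def)
qed

text \<open>After one period a band returns to the same edge, and a Moebius strip continues on the
  opposite one.\<close>

lemma edge_arc_end: "\<exists>b'. edge_arc b 1 = edge_arc b' 0"
proof -
  obtain \<epsilon> where \<epsilon>: "shift L \<epsilon>" using shift_period by blast
  then have "\<epsilon> = 1 \<or> \<epsilon> = -1" by (simp add: shift_def)
  then have "edge_arc b 1 = edge_arc (b = (\<epsilon> = 1)) 0"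
    using shift_map[OF \<epsilon>, of 0] \<epsilon> by (auto simp: edge_arc_def edge_param_def shift_def) (metis add_0 power_one_right)+
  then show ?thesis by blast
qed

lemma interval_param:
  assumes "0 < w" "0 < v" "- v \<le> u" "u \<le> (w::real)"
  obtains s where "0 \<le> s" "s \<le> 1" "u = s * w - (1 - s) * v"
proof
  show "0 \<le> (u + v) / (w + v)" "(u + v) / (w + v) \<le> 1" using assms by (simp_all add: field_simps)
  have e: "q * w - (1 - q) * v = q * (w + v) - v" for q
    by (simp add: algebra_simps)
  then show "u = (u + v) / (w + v) * w - (1 - (u + v) / (w + v)) * v"
    unfolding e using assms by simp
qed

lemma cross_cut_image: "cross_cut ` {0..1} = ribbon_map r ` {x \<in> ribbon_dom r. fst x = 0}"
proof
  show "cross_cut ` {0..1} \<subseteq> ribbon_map r ` {x \<in> ribbon_dom r. fst x = 0}"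
  proof
    fix z assume "z \<in> cross_cut ` {0..1}"
    then obtain s where s: "0 \<le> s" "s \<le> 1" "z = cross_cut s" by auto
    have "s * width_pos r 0 \<le> 1 * width_pos r 0" "(1 - s) * width_neg r 0 \<le> 1 * width_neg r 0"
      "0 \<le> s * width_pos r 0" "0 \<le> (1 - s) * width_neg r 0"
      using s width_pos_pos[of 0] width_neg_pos[of 0] by (auto intro!: mult_right_mono)
    then show "z \<in> ribbon_map r ` {x \<in> ribbon_dom r. fst x = 0}"
      unfolding s(3) cross_cut_def by (intro imageI) (simp add: ribbon_dom_def)
  qed
  show "ribbon_map r ` {x \<in> ribbon_dom r. fst x = 0} \<subseteq> cross_cut ` {0..1}"
  proof
    fix z assume "z \<in> ribbon_map r ` {x \<in> ribbon_dom r. fst x = 0}"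
    then obtain u where u: "z = ribbon_map r (0, u)" "- width_neg r 0 \<le> u" "u \<le> width_pos r 0"
      by (auto simp: ribbon_dom_def)
    obtain s where "0 \<le> s" "s \<le> 1" "u = s * width_pos r 0 - (1 - s) * width_neg r 0"
      using interval_param[OF width_pos_pos width_neg_pos u(2,3)] by blast
    then show "z \<in> cross_cut ` {0..1}" using u(1) by (auto simp: cross_cut_def)
  qed
qed

lemma cross_cut_ends:
  "cross_cut 0 \<in> ribbon_map r ` ribbon_edge r \<and> cross_cut 1 \<in> ribbon_map r ` ribbon_edge r"
  by (auto simp: cross_cut_def ribbon_edge_def)

lemma width_mix:
  fixes w v s :: real
  assumes "0 < w" "0 < v" "0 < s" "s < 1"
  shows "- v < s * w - (1 - s) * v" "s * w - (1 - s) * v < w"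
proof -
  have e: "s * w - (1 - s) * v + v = s * (w + v)" "w - (s * w - (1 - s) * v) = (1 - s) * (w + v)"
    by (simp_all add: algebra_simps)
  have "s * w - (1 - s) * v + v > 0" "w - (s * w - (1 - s) * v) > 0" unfolding e using assms by auto
  then show "- v < s * w - (1 - s) * v" "s * w - (1 - s) * v < w" by linarith+
qed

lemma width_mix_inj:
  fixes w v s s' :: real
  assumes "0 < w" "0 < v" "s * w - (1 - s) * v = s' * w - (1 - s') * v"
  shows "s = s'"
proof -
  have "(s - s') * (w + v) = 0" using assms(3) by (simp add: algebra_simps)
  then show ?thesis using assms by simp
qed

lemma cross_cut_inner:
  assumes "s \<in> {0<..<1}"
  shows "(0, s * width_pos r 0 - (1 - s) * width_neg r 0) \<in> ribbon_inner r"
  using width_mix[OF width_pos_pos[of 0] width_neg_pos[of 0], of s] assms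
  by (simp add: ribbon_inner_def)

lemma square_param_inner:
  assumes "x \<in> {-1<..<1} \<times> {-1<..<1}"
  shows "square_param x \<in> ribbon_inner r \<and> 0 < fst (square_param x) \<and> fst (square_param x) < L"
proof -
  obtain a b where x: "x = (a, b)" "-1 < a" "a < 1" "-1 < b" "b < 1" using assms by auto
  let ?t = "L * ((a + 1) / 2)"
  have eq: "(1 - b) / 2 = 1 - (1 + b) / 2" by (simp add: field_simps)
  have b: "0 < (1 + b) / 2" "(1 + b) / 2 < 1" using x by auto
  have "?t < L * 1" using x period_pos by (intro mult_strict_left_mono) auto
  then have t: "0 < ?t" "?t < L" using x period_pos by auto
  show ?thesis
    unfolding x(1) square_param_def prod.case fst_conv ribbon_inner_def mem_Collect_eq eq
    using width_mix[OF width_pos_pos[of ?t] width_neg_pos[of ?t] b] t by blast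
qed

lemma square_param_inj: "inj square_param"
proof (rule injI)
  fix x y assume eq: "square_param x = square_param y"
  obtain a b a' b' where xy: "x = (a, b)" "y = (a', b')" by (cases x, cases y)
  have "a = a'" using eq period_pos by (simp add: xy square_param_def)
  let ?t = "L * ((a + 1) / 2)"
  have half: "(1 - z) / 2 = 1 - (1 + z) / 2" for z :: real by (simp add: field_simps)
  have "(1 + b) / 2 * width_pos r ?t - (1 - b) / 2 * width_neg r ?t =
      (1 + b') / 2 * width_pos r ?t - (1 - b') / 2 * width_neg r ?t"
    using eq unfolding xy \<open>a = a'\<close> square_param_def prod.case prod.inject by blast
  then have "(1 + b) / 2 = (1 + b') / 2"
    unfolding half by (rule width_mix_inj[OF width_pos_pos width_neg_pos])
  then show "x = y" using \<open>a = a'\<close> xy by simp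
qed

lemma strip_param_dom:
  assumes "u \<in> {-1..1}"
  shows "(t, (1 + u) / 2 * width_pos r t - (1 - u) / 2 * width_neg r t) \<in> ribbon_dom r"
proof -
  have "(1 + u) / 2 * width_pos r t \<le> 1 * width_pos r t" "(1 - u) / 2 * width_neg r t \<le> 1 * width_neg r t"
    "0 \<le> (1 + u) / 2 * width_pos r t" "0 \<le> (1 - u) / 2 * width_neg r t"
    using assms width_pos_pos[of t] width_neg_pos[of t] by (auto intro!: mult_right_mono)
  then show ?thesis by (simp add: ribbon_dom_def)
qed

text \<open>The right side has parameter \<open>L\<close>, which the shift takes back to 0, possibly
  upside down; the set of points is the cross cut in either case.\<close>

lemma square_cell_vertical:
  assumes "u \<in> {-1..1}"
  shows "square_cell (-1, u) \<in> cross_cut ` {0..1} \<and> square_cell (1, u) \<in> cross_cut ` {0..1}"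
proof -
  obtain \<epsilon> where \<epsilon>: "shift L \<epsilon>" using shift_period by blast
  note mix = strip_param_dom[OF assms]
  have "square_cell (-1, u) \<in> cross_cut ` {0..1}"
    using mix[of 0] unfolding cross_cut_image by (force simp: square_cell_def square_param_def)
  moreover have "square_cell (1, u) \<in> cross_cut ` {0..1}"
    using mix[of L] shift_map[OF \<epsilon>, of 0] shift_dom[OF \<epsilon>, of 0]
    unfolding cross_cut_image by (force simp: square_cell_def square_param_def)
  ultimately show ?thesis by blast
qed

lemma square_cell_horizontal:
  "square_cell (a, -1) \<in> ribbon_map r ` ribbon_edge r \<and> square_cell (a, 1) \<in> ribbon_map r ` ribbon_edge r"
  by (auto simp: square_cell_def square_param_def ribbon_edge_def)

lemma square_cell_subset: "square_cell ` ({-1..1} \<times> {-1..1}) \<subseteq> ribbon_set r"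
proof
  fix z assume "z \<in> square_cell ` ({-1..1} \<times> {-1..1})"
  then obtain a b where ab: "z = square_cell (a, b)" "b \<in> {-1..1}" by auto
  then show "z \<in> ribbon_set r"
    using strip_param_dom[of b "L * ((a + 1) / 2)"]
    by (auto simp: square_cell_def square_param_def ribbon_set_def)
qed

lemma ribbon_set_subset_square: "ribbon_set r \<subseteq> square_cell ` ({-1..1} \<times> {-1..1})"
proof
  fix z assume "z \<in> ribbon_set r"
  then obtain t u where tu: "z = ribbon_map r (t, u)" "(t, u) \<in> ribbon_dom r"
    by (auto simp: ribbon_set_def)
  obtain s \<epsilon> where s: "0 \<le> s" "s < L" "z = ribbon_map r (s, \<epsilon> * u)" "(s, \<epsilon> * u) \<in> ribbon_dom r"
    using normalize_param[of t] tu by metis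
  then have "- width_neg r s \<le> \<epsilon> * u" "\<epsilon> * u \<le> width_pos r s" by (auto simp: ribbon_dom_def)
  then obtain c where c: "0 \<le> c" "c \<le> 1" "\<epsilon> * u = c * width_pos r s - (1 - c) * width_neg r s"
    using interval_param[OF width_pos_pos width_neg_pos] by blast
  have "square_param (2 * (s / L) - 1, 2 * c - 1) = (s, \<epsilon> * u)"
    using period_pos by (simp add: square_param_def c(3))
  then have "z = square_cell (2 * (s / L) - 1, 2 * c - 1)" using s(3) by (simp add: square_cell_def)
  moreover have "0 \<le> s / L" "s / L \<le> 1" using s(1,2) period_pos by simp_all
  ultimately show "z \<in> square_cell ` ({-1..1} \<times> {-1..1})" using c(1,2) by auto
qed

end

section \<open>Ribbonizations\<close>

lemma cartan_ribbon_imp_strip: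
  assumes "cartan_ribbon S r" "closed_ribbon r"
  shows "strip r"
proof -
  have "smooth_on UNIV (center r) \<and> continuous_on UNIV (ruling r) \<and> (\<forall>t. norm (ruling r t) = 1) \<and>
    continuous_on UNIV (width_neg r) \<and> (\<forall>t. width_neg r t > 0) \<and>
    continuous_on UNIV (width_pos r) \<and> (\<forall>t. width_pos r t > 0)"
    using assms(1) unfolding cartan_ribbon_def by (elim conjE, intro conjI)
  then show ?thesis
    using assms(2) by unfold_locales (simp_all add: smooth_on_imp_continuous_on)
qed

locale ribbonization =
  fixes S :: "(real^3) set" and R :: nat and rb :: "nat \<Rightarrow> ribbon"
  assumes ribbonization: "closed_ribbonization S R rb"
begin

abbreviation "W \<equiv> wedge_set R rb"
abbreviation "E \<equiv> edge_set R rb"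
abbreviation "I \<equiv> {1..R}"

lemma strip: "i \<in> I \<Longrightarrow> strip (rb i)"
  using ribbonization[unfolded closed_ribbonization_def, THEN conjunct1] cartan_ribbon_imp_strip by blast

lemma inner_unique:
  "\<lbrakk>i \<in> I; j \<in> I; x \<in> ribbon_inner (rb i); y \<in> ribbon_dom (rb j);
    ribbon_map (rb i) x = ribbon_map (rb j) y\<rbrakk> \<Longrightarrow> i = j \<and> same_param (rb i) x y"
  using ribbonization[unfolded closed_ribbonization_def, THEN conjunct2, THEN conjunct1] by blast

lemma wedge_graph: "\<exists>C. wedge_curve_system C \<and> W = (\<Union>c\<in>C. path_image c) \<union> cone_points R rb"
  using ribbonization unfolding closed_ribbonization_def by (elim conjE)

lemma closed_free: "closed (E - W)"
  using ribbonization unfolding closed_ribbonization_def by (elim conjE)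

definition arc :: "nat \<times> bool \<Rightarrow> real \<Rightarrow> real^3" where
  "arc = (\<lambda>(i, b). strip.edge_arc (rb i) b)"

lemma arc_continuous: "j \<in> I \<times> UNIV \<Longrightarrow> continuous_on A (arc j)"
  using strip strip.edge_arc_continuous by (auto simp: arc_def)

lemma E_arcs: "E = (\<Union>j\<in>I \<times> UNIV. arc j ` {0..1})"
  unfolding edge_set_def arc_def using strip.edge_image[OF strip] by fastforce

lemma compact_E: "compact E"
  unfolding E_arcs using arc_continuous by (intro compact_UN compact_continuous_image) auto

text \<open>Contact points are edge points, and \<open>E\<close> is compact as a finite union of
  arcs, so taking the closure does not leave it.\<close>

lemma W_subset_E: "W \<subseteq> E"
  unfolding wedge_set_def
proof (rule closure_minimal)
  show "contact_set R rb \<subseteq> E" unfolding contact_set_def edge_set_def by blast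
  show "closed E" using compact_E by (rule compact_imp_closed)
qed

lemma compact_W: "compact W"
proof -
  have "W = E \<inter> W" using W_subset_E by blast
  moreover have "closed W" by (simp add: wedge_set_def)
  ultimately show ?thesis using compact_Int_closed[OF compact_E] by metis
qed

text \<open>Two parameter classes with the same image would make the point a contact point, hence a
  point of \<open>W\<close>.\<close>

lemma free_edge_unique:
  assumes "i \<in> I" "j \<in> I" "x \<in> ribbon_edge (rb i)" "y \<in> ribbon_edge (rb j)"
    and "ribbon_map (rb i) x = ribbon_map (rb j) y" "ribbon_map (rb i) x \<notin> W"
  shows "i = j \<and> same_param (rb i) x y"
proof (rule ccontr)
  assume "\<not> ?thesis"
  then have "ribbon_map (rb i) x \<in> contact_set R rb"
    using assms(1-5) unfolding contact_set_def mem_Collect_eq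
    by (intro bexI[of _ i] bexI[of _ j] bexI[of _ x] bexI[of _ y]) auto
  then show False using assms(6) closure_subset unfolding wedge_set_def by blast
qed

section \<open>The free part of the edges\<close>

definition free_arcs :: "(nat \<times> bool) set" where
  "free_arcs = {j \<in> I \<times> UNIV. arc j ` {0..1} \<subseteq> E - W}"

lemma free_arcs_subset: "free_arcs \<subseteq> I \<times> UNIV"
  unfolding free_arcs_def by blast

lemma free_arc_notin_W: "j \<in> free_arcs \<Longrightarrow> s \<in> {0..1} \<Longrightarrow> arc j s \<notin> W"
  unfolding free_arcs_def by blast

text \<open>The connected arc is covered by the disjoint closed sets \<open>W\<close> and
  \<open>E - W\<close>, so it meets only one of them.\<close>

lemma arc_free_or_wedge:
  assumes "j \<in> I \<times> UNIV"
  shows "j \<in> free_arcs \<or> arc j ` {0..1} \<subseteq> W"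
proof -
  let ?A = "arc j ` {0..1}"
  have "connected ?A" by (intro connected_continuous_image arc_continuous[OF assms]) simp
  moreover have "?A \<subseteq> E" using assms unfolding E_arcs by blast
  moreover have "closed W" using compact_W by (rule compact_imp_closed)
  ultimately have "W \<inter> ?A = {} \<or> (E - W) \<inter> ?A = {}"
    using connected_closedD[of ?A W "E - W"] closed_free by blast
  then show ?thesis using \<open>?A \<subseteq> E\<close> assms by (auto simp: free_arcs_def)
qed

text \<open>The bound on the parameters excludes exactly the closing up of an arc, where parameter 1
  of one arc meets parameter 0 of the same or the opposite one.\<close>

lemma free_arc_unique:
  assumes "j \<in> free_arcs" "k \<in> I \<times> UNIV" "s \<in> {0..1}" "t \<in> {0..1}" "arc j s = arc k t" "\<bar>s - t\<bar> < 1"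
  shows "j = k \<and> s = t"
proof -
  obtain i b i' b' where jk: "j = (i, b)" "k = (i', b')" by (cases j, cases k)
  have i: "i \<in> I" "i' \<in> I" using assms(1,2) jk free_arcs_subset by auto
  interpret i: strip "rb i" by (rule strip[OF i(1)])
  have "i = i' \<and> same_param (rb i) (strip.edge_param (rb i) b s) (strip.edge_param (rb i') b' t)"
  proof (rule free_edge_unique[OF i strip.edge_param_in_edge[OF strip[OF i(1)]]
        strip.edge_param_in_edge[OF strip[OF i(2)]]])
    have "arc j s \<notin> W" using assms free_arc_notin_W by blast
    then show "ribbon_map (rb i) (strip.edge_param (rb i) b s) \<notin> W"
      by (simp add: jk arc_def i.edge_arc_def)
    show "ribbon_map (rb i) (strip.edge_param (rb i) b s) = ribbon_map (rb i') (strip.edge_param (rb i') b' t)"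
      using assms(5)
      by (simp add: jk arc_def strip.edge_arc_def[OF strip[OF i(1)]] strip.edge_arc_def[OF strip[OF i(2)]])
  qed
  then have ii: "i = i'" and sp: "same_param (rb i) (i.edge_param b s) (i.edge_param b' t)"
    by auto
  from i.edge_param_unique[OF sp assms(6)] show ?thesis by (simp add: jk ii)
qed

text \<open>The arc that continues an edge after a free arc contains a free point, so it is free
  itself.\<close>

lemma arc_end:
  assumes "j \<in> free_arcs"
  obtains k where "k \<in> free_arcs" "arc j 1 = arc k 0"
proof -
  obtain i b where j: "j = (i, b)" "i \<in> I" using assms free_arcs_subset by (cases j) auto
  obtain b' where b': "arc j 1 = arc (i, b') 0"
    using strip.edge_arc_end[OF strip[OF j(2)]] j by (auto simp: arc_def)
  have "arc j 1 \<notin> W" by (rule free_arc_notin_W[OF assms]) simp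
  then have "\<not> arc (i, b') ` {0..1} \<subseteq> W" using b' by force
  then have "(i, b') \<in> free_arcs" using arc_free_or_wedge[of "(i, b')"] j by auto
  then show ?thesis using that b' by blast
qed

text \<open>Every free arc contributes its starting point as an isolated point and then itself as a
  1-cell, with total 0. Its end is again the start of a free arc, so no further points
  arise.\<close>

lemma set_euler_E:
  assumes "set_euler W w"
  shows "set_euler E w"
proof -
  have fin: "finite free_arcs"
    by (rule finite_subset[OF free_arcs_subset]) simp
  note free = free_arc_notin_W
  have sub: "j \<in> I \<times> UNIV" if "j \<in> free_arcs" for j using that free_arcs_subset by blast
  define A where "A = (\<lambda>j. arc j 0) ` free_arcs"
  have "inj_on (\<lambda>j. arc j 0) free_arcs"
    using free_arc_unique[of _ _ 0 0] sub by (intro inj_onI) auto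
  then have card: "card A = card free_arcs" unfolding A_def by (rule card_image)
  have "finite A" using fin by (simp add: A_def)
  have "W \<inter> A = {}" using free by (force simp: A_def)
  then have "set_euler (W \<union> A) (w + int (card free_arcs))"
    using assms set_euler_finite[OF \<open>finite A\<close>] compact_W \<open>finite A\<close>
    unfolding card[symmetric]
    by (intro set_euler_disjoint_closed closed_subset) (auto intro: compact_imp_closed finite_imp_closed)
  then have "set_euler ((W \<union> A) \<union> (\<Union>j\<in>free_arcs. arc j ` {0..1})) (w + int (card free_arcs) - int (card free_arcs))"
  proof (rule set_euler_attach_arcs[OF fin, rotated])
    show "compact (W \<union> A)" by (rule compact_Un[OF compact_W finite_imp_compact[OF \<open>finite A\<close>]])
    show "continuous_on {0..1} (arc j)" if "j \<in> free_arcs" for j using arc_continuous sub that by blast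
    show "arc j 0 \<in> W \<union> A \<and> arc j 1 \<in> W \<union> A" if "j \<in> free_arcs" for j
      using that arc_end[OF that] by (metis A_def UnI2 image_eqI)
    show "arc j s \<notin> W \<union> A" if "j \<in> free_arcs" "s \<in> {0<..<1}" for j s
    proof -
      have "arc j s \<noteq> arc k 0" if "k \<in> free_arcs" for k
        using free_arc_unique[of j k s 0] \<open>j \<in> free_arcs\<close> \<open>s \<in> {0<..<1}\<close> sub[OF that] by auto
      then show ?thesis using free[of j s] that by (auto simp: A_def)
    qed
    show "i = j \<and> s = t"
      if "i \<in> free_arcs" "j \<in> free_arcs" "s \<in> {0<..<1}" "t \<in> {0<..<1}" "arc i s = arc j t" for i j s t
      using free_arc_unique[of i j s t] that sub[of j] by (auto simp: abs_less_iff)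
  qed
  moreover have "(W \<union> A) \<union> (\<Union>j\<in>free_arcs. arc j ` {0..1}) = E"
  proof
    show "(W \<union> A) \<union> (\<Union>j\<in>free_arcs. arc j ` {0..1}) \<subseteq> E"
      using W_subset_E by (force simp: A_def free_arcs_def)
    show "E \<subseteq> (W \<union> A) \<union> (\<Union>j\<in>free_arcs. arc j ` {0..1})"
      unfolding E_arcs using arc_free_or_wedge by blast
  qed
  ultimately show ?thesis by simp
qed

section \<open>Filling in cuts and squares\<close>

lemma inner_notin_E:
  assumes "i \<in> I" "x \<in> ribbon_inner (rb i)"
  shows "ribbon_map (rb i) x \<notin> E"
proof
  assume "ribbon_map (rb i) x \<in> E"
  then obtain j y where j: "j \<in> I" "y \<in> ribbon_edge (rb j)" "ribbon_map (rb i) x = ribbon_map (rb j) y"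
    by (auto simp: edge_set_def)
  then have "i = j \<and> same_param (rb i) x y"
    using strip.edge_subset_dom[OF strip[OF j(1)]] assms by (intro inner_unique) auto
  then show False using strip.same_param_inner_not_edge[OF strip[OF assms(1)] assms(2)] j(2) by blast
qed

definition cut :: "nat \<Rightarrow> real \<Rightarrow> real^3" where
  "cut i = strip.cross_cut (rb i)"

definition cell :: "nat \<Rightarrow> real \<times> real \<Rightarrow> real^3" where
  "cell i = strip.square_cell (rb i)"

lemma cut_image: "i \<in> I \<Longrightarrow> cut i ` {0..1} = ribbon_map (rb i) ` {x \<in> ribbon_dom (rb i). fst x = 0}"
  unfolding cut_def by (rule strip.cross_cut_image[OF strip])

lemma set_euler_E_cuts:
  assumes "set_euler E w"
  shows "set_euler (E \<union> (\<Union>i\<in>I. cut i ` {0..1})) (w - int R)"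
proof -
  have "set_euler (E \<union> (\<Union>i\<in>I. cut i ` {0..1})) (w - int (card I))"
  proof (rule set_euler_attach_arcs[OF _ compact_E assms])
    show "continuous_on {0..1} (cut i)" if "i \<in> I" for i
      unfolding cut_def by (rule strip.cross_cut_continuous[OF strip[OF that]])
    show "cut i 0 \<in> E \<and> cut i 1 \<in> E" if "i \<in> I" for i
      using strip.cross_cut_ends[OF strip[OF that]] that unfolding cut_def edge_set_def by blast
    show "cut i s \<notin> E" if "i \<in> I" "s \<in> {0<..<1}" for i s
      unfolding cut_def strip.cross_cut_def[OF strip[OF that(1)]]
      by (rule inner_notin_E[OF that(1) strip.cross_cut_inner[OF strip[OF that(1)] that(2)]])
    show "i = j \<and> s = t"
      if ij: "i \<in> I" "j \<in> I" and st: "s \<in> {0<..<1}" "t \<in> {0<..<1}" and eq: "cut i s = cut j t" for i j s t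
    proof -
      interpret i: strip "rb i" by (rule strip[OF ij(1)])
      interpret j: strip "rb j" by (rule strip[OF ij(2)])
      have *: "i = j \<and> same_param (rb i) (0, s * width_pos (rb i) 0 - (1 - s) * width_neg (rb i) 0)
          (0, t * width_pos (rb j) 0 - (1 - t) * width_neg (rb j) 0)"
      proof (rule inner_unique[OF ij i.cross_cut_inner[OF st(1)]])
        show "(0, t * width_pos (rb j) 0 - (1 - t) * width_neg (rb j) 0) \<in> ribbon_dom (rb j)"
          using j.cross_cut_inner[OF st(2)] j.inner_subset_dom by blast
      qed (use eq in \<open>simp add: cut_def i.cross_cut_def j.cross_cut_def\<close>)
      then have "i = j" by blast
      have "s * width_pos (rb i) 0 - (1 - s) * width_neg (rb i) 0 = t * width_pos (rb j) 0 - (1 - t) * width_neg (rb j) 0"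
        using i.same_param_unique[OF conjunct2[OF *]] i.period_pos by simp
      then have "s * width_pos (rb i) 0 - (1 - s) * width_neg (rb i) 0 = t * width_pos (rb i) 0 - (1 - t) * width_neg (rb i) 0"
        unfolding \<open>i = j\<close> .
      then show ?thesis using * i.width_mix_inj[OF i.width_pos_pos i.width_neg_pos] by blast
    qed
  qed simp
  then show ?thesis by simp
qed

text \<open>The \<open>R\<close> squares restore what the \<open>R\<close> cuts took away.\<close>

lemma set_euler_ribbonization:
  assumes "set_euler W w"
  shows "set_euler (ribbonization_set R rb) w"
proof -
  let ?Q = "{-1..1::real} \<times> {-1..1::real}" and ?Y = "E \<union> (\<Union>i\<in>I. cut i ` {0..1})"
  have "set_euler (?Y \<union> (\<Union>i\<in>I. cell i ` ?Q)) (w - int R + int (card I))"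
  proof (rule set_euler_attach_squares[OF _ _ set_euler_E_cuts[OF set_euler_E[OF assms]]])
    have "compact (cut i ` {0..1})" if "i \<in> I" for i
      unfolding cut_def using strip.cross_cut_continuous[OF strip[OF that]]
      by (intro compact_continuous_image) auto
    then show "compact ?Y" using compact_E by (intro compact_Un compact_UN) auto
    show "continuous_on ?Q (cell i)" if "i \<in> I" for i
      unfolding cell_def by (rule strip.square_cell_continuous[OF strip[OF that]])
    show "cell i (-1, u) \<in> ?Y \<and> cell i (1, u) \<in> ?Y \<and> cell i (u, -1) \<in> ?Y \<and> cell i (u, 1) \<in> ?Y"
      if "i \<in> I" "u \<in> {-1..1}" for i u
      using strip.square_cell_vertical[OF strip[OF that(1)] that(2)]
        strip.square_cell_horizontal[OF strip[OF that(1)], of u] that(1)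
      unfolding cell_def cut_def edge_set_def by blast
    show "cell i x \<notin> ?Y" if i: "i \<in> I" and x: "x \<in> {-1<..<1} \<times> {-1<..<1}" for i x
    proof
      interpret i: strip "rb i" by (rule strip[OF i])
      note inn = i.square_param_inner[OF x]
      assume "cell i x \<in> ?Y"
      moreover have "cell i x \<notin> E"
        unfolding cell_def i.square_cell_def using inn by (intro inner_notin_E[OF i]) blast
      ultimately obtain k where k: "k \<in> I" "cell i x \<in> cut k ` {0..1}" by blast
      then obtain u where u: "(0, u) \<in> ribbon_dom (rb k)" "cell i x = ribbon_map (rb k) (0, u)"
        unfolding cut_image[OF k(1)] by auto
      have *: "i = k \<and> same_param (rb i) (i.square_param x) (0, u)"
        using inn u unfolding cell_def i.square_cell_def by (intro inner_unique[OF i k(1)]) auto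
      have "same_param (rb i) (fst (i.square_param x), snd (i.square_param x)) (0, u)"
        unfolding prod.collapse by (rule conjunct2[OF *])
      \<comment> \<open>The open square has parameters strictly inside one period and the cut has
        parameter 0; less than a period apart, equivalent parameters are equal.\<close>
      from i.same_param_unique[OF this] have "fst (i.square_param x) = 0"
        using inn by auto
      then show False using inn by simp
    qed
    show "i = j \<and> x = x'"
      if ij: "i \<in> I" "j \<in> I" and x: "x \<in> {-1<..<1} \<times> {-1<..<1}" "x' \<in> {-1<..<1} \<times> {-1<..<1}"
        and eq: "cell i x = cell j x'" for i j x x'
    proof -
      interpret i: strip "rb i" by (rule strip[OF ij(1)])
      interpret j: strip "rb j" by (rule strip[OF ij(2)])
      note inn = i.square_param_inner[OF x(1)] j.square_param_inner[OF x(2)]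
      have *: "i = j \<and> same_param (rb i) (i.square_param x) (j.square_param x')"
        using inn eq j.inner_subset_dom unfolding cell_def i.square_cell_def j.square_cell_def
        by (intro inner_unique[OF ij]) auto
      then have "j = i" and sp: "same_param (rb i) (i.square_param x) (i.square_param x')" by auto
      have inn': "0 < fst (i.square_param x')" "fst (i.square_param x') < period (rb i)"
        using inn(2) \<open>j = i\<close> by auto
      have "i.square_param x = i.square_param x'"
        using i.same_param_unique[of "fst (i.square_param x)" "snd (i.square_param x)"
            "fst (i.square_param x')" "snd (i.square_param x')"] sp inn(1) inn'
        by (simp add: prod_eq_iff abs_less_iff)
      then show ?thesis using \<open>j = i\<close> injD[OF i.square_param_inj] by blast
    qed
  qed simp
  moreover have "?Y \<union> (\<Union>i\<in>I. cell i ` ?Q) = ribbonization_set R rb"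
  proof
    have sub: "ribbon_set (rb i) \<subseteq> ribbonization_set R rb" if "i \<in> I" for i
      using that unfolding ribbonization_set_def by blast
    have "ribbon_map (rb i) ` ribbon_edge (rb i) \<subseteq> ribbon_set (rb i)" if "i \<in> I" for i
      unfolding ribbon_set_def by (rule image_mono[OF strip.edge_subset_dom[OF strip[OF that]]])
    then have 1: "E \<subseteq> ribbonization_set R rb"
      unfolding edge_set_def by (intro UN_least) (rule order_trans[OF _ sub])
    have 2: "cut i ` {0..1} \<subseteq> ribbonization_set R rb" if "i \<in> I" for i
    proof -
      have "cut i ` {0..1} \<subseteq> ribbon_set (rb i)"
        unfolding cut_image[OF that] ribbon_set_def by (rule image_mono) blast
      then show ?thesis using sub[OF that] by (rule order_trans)
    qed
    have 3: "cell i ` ?Q \<subseteq> ribbonization_set R rb" if "i \<in> I" for i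
      using strip.square_cell_subset[OF strip[OF that]] sub[OF that]
      unfolding cell_def by (rule order_trans)
    show "?Y \<union> (\<Union>i\<in>I. cell i ` ?Q) \<subseteq> ribbonization_set R rb"
    proof
      fix z assume "z \<in> ?Y \<union> (\<Union>i\<in>I. cell i ` ?Q)"
      then consider "z \<in> E" | i where "i \<in> I" "z \<in> cut i ` {0..1}"
        | i where "i \<in> I" "z \<in> cell i ` ?Q" by (elim UnE UN_E)
      then show "z \<in> ribbonization_set R rb"
        by cases (rule subsetD[OF 1] subsetD[OF 2] subsetD[OF 3]; assumption)+
    qed
    show "ribbonization_set R rb \<subseteq> ?Y \<union> (\<Union>i\<in>I. cell i ` ?Q)"
    proof
      fix z assume "z \<in> ribbonization_set R rb"
      then obtain i where i: "i \<in> I" "z \<in> ribbon_set (rb i)"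
        unfolding ribbonization_set_def by (elim UN_E)
      have "z \<in> cell i ` ?Q"
        unfolding cell_def by (rule subsetD[OF strip.ribbon_set_subset_square[OF strip[OF i(1)]] i(2)])
      with i(1) have "z \<in> (\<Union>i\<in>I. cell i ` ?Q)" by (rule UN_I)
      then show "z \<in> ?Y \<union> (\<Union>i\<in>I. cell i ` ?Q)" by (rule UnI2)
    qed
  qed
  ultimately show ?thesis by simp
qed

text \<open>A collapsed edge is constant, so its cone point is already its value at parameter 0;
  each ribbon offers at most two.\<close>

lemma finite_cone_points: "finite (cone_points R rb)"
proof (rule finite_subset)
  show "cone_points R rb \<subseteq> (\<Union>i\<in>I. {ribbon_map (rb i) (0, width_pos (rb i) 0), ribbon_map (rb i) (0, - width_neg (rb i) 0)})"
  proof
    fix q assume "q \<in> cone_points R rb"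
    then obtain i where i: "i \<in> I" and "(\<forall>t. ribbon_map (rb i) (t, width_pos (rb i) t) = q) \<or>
           (\<forall>t. ribbon_map (rb i) (t, - width_neg (rb i) t) = q)"
      unfolding cone_points_def by blast
    then have "q = ribbon_map (rb i) (0, width_pos (rb i) 0) \<or> q = ribbon_map (rb i) (0, - width_neg (rb i) 0)"
      by metis
    then show "q \<in> (\<Union>i\<in>I. {ribbon_map (rb i) (0, width_pos (rb i) 0), ribbon_map (rb i) (0, - width_neg (rb i) 0)})"
      using i by blast
  qed
qed simp

text \<open>By the handshake count, summing 2 minus the number of edge ends over the nodes gives
  twice nodes minus curves. The doubled identity stays within the integers.\<close>

lemma set_euler_vertices:
  assumes "bij_betw p {1..P} (vertices R rb)"
    and deg: "\<And>k. k \<in> {1..P} \<Longrightarrow> has_degree W (p k) (d k)"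
  shows "\<exists>w. set_euler (ribbonization_set R rb) w \<and> 2 * w = (\<Sum>k=1..P. 2 - int (d k))"
proof -
  obtain C where C: "wedge_curve_system C" "W = (\<Union>c\<in>C. path_image c) \<union> cone_points R rb"
    using wedge_graph by blast
  interpret graph W C "cone_points R rb"
    by unfold_locales (use C finite_cone_points in auto)
  let ?w = "int (card nodes) - int (card C)"
  let ?m = "\<lambda>q. int (card (edge_ends_at q))"
  have vn: "vertices R rb \<subseteq> nodes"
    using locally_line_outside_nodes unfolding vertices_def by blast
  \<comment> \<open>A node that is not a vertex comes from subdividing a curve or from the base
    point of a closed one. \<open>W\<close> is a line near it, so comparing germs yields two edge
    ends.\<close>
  have two: "?m q = 2" if q: "q \<in> nodes - vertices R rb" for q
  proof -
    have "q \<in> W" using q by (simp add: nodes_def)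
    then obtain U where "open U" "q \<in> U" "(W \<inter> U) homeomorphic (UNIV :: real set)"
      using q unfolding vertices_def by blast
    then obtain \<alpha> where "star_germ W q (UNIV :: bool set) \<alpha>"
      using locally_line_imp_star_germ \<open>q \<in> W\<close> by blast
    moreover obtain \<beta> where "star_germ W q (edge_ends_at q) \<beta>" using node_star_germ[of q] q by blast
    ultimately have "card (edge_ends_at q) = card (UNIV :: bool set)" by (rule star_germ_card_unique[rotated])
    then show ?thesis by simp
  qed
  \<comment> \<open>The diffeomorphic star and the edge ends of the graph are two germs of
    \<open>W\<close> at the same point, so they have equally many arms.\<close>
  have md: "?m (p k) = int (d k)" if k: "k \<in> {1..P}" for k
  proof -
    have "p k \<in> nodes" using assms(1) k vn by (auto simp: bij_betw_def)
    then obtain \<alpha> where "star_germ W (p k) (edge_ends_at (p k)) \<alpha>" using node_star_germ by blast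
    moreover obtain D \<beta> where "star_germ W (p k) (D :: (real^3) set) \<beta>" "card D = d k"
      using has_degree_imp_star_germ[OF deg[OF k]] by blast
    ultimately show ?thesis using star_germ_card_unique by metis
  qed
  have "2 * ?w = (\<Sum>q\<in>nodes. 2 - ?m q)"
    by (simp add: sum_subtractf sum_edge_ends)
  also have "\<dots> = (\<Sum>q\<in>vertices R rb. 2 - ?m q)"
    by (rule sum.mono_neutral_right[OF finite_nodes vn]) (use two in auto)
  also have "\<dots> = (\<Sum>k=1..P. 2 - ?m (p k))"
    by (rule sum.reindex_bij_betw[OF assms(1), symmetric])
  also have "\<dots> = (\<Sum>k=1..P. 2 - int (d k))"
    by (rule sum.cong) (use md in auto)
  finally have "2 * ?w = (\<Sum>k=1..P. 2 - int (d k))" .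
  then have "set_euler (ribbonization_set R rb) ?w \<and> 2 * ?w = (\<Sum>k=1..P. 2 - int (d k))"
    using set_euler_ribbonization[OF set_euler_graph] by (rule conjI[rotated])
  then show ?thesis by (rule exI)
qed

end

theorem theorem4p1:
  fixes S :: "(real^3) set" and R :: nat and rb :: "nat \<Rightarrow> ribbon"
    and P :: nat and p :: "nat \<Rightarrow> real^3" and d :: "nat \<Rightarrow> nat"
  assumes "regular_surface S"
    and "closed_ribbonization S R rb"
    and "bij_betw p {1..P} (vertices R rb)"
    and "\<And>k. k \<in> {1..P} \<Longrightarrow> has_degree (wedge_set R rb) (p k) (d k)"
  shows "finite_betti (top_of_set (ribbonization_set R rb)) \<and>
         real_of_int (euler_characteristic (top_of_set (ribbonization_set R rb)))
           = 1 / 2 * (\<Sum>k=1..P. 2 - real (d k))"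
proof -
  interpret ribbonization S R rb by unfold_locales (rule assms(2))
  obtain w where w: "set_euler (ribbonization_set R rb) w" "2 * w = (\<Sum>k=1..P. 2 - int (d k))"
    using set_euler_vertices[OF assms(3,4)] by blast
  have "real_of_int (2 * w) = (\<Sum>k=1..P. 2 - real (d k))"
    unfolding w(2) by (simp only: of_int_sum of_int_diff of_int_numeral of_int_of_nat_eq)
  then have "real_of_int w = 1 / 2 * (\<Sum>k=1..P. 2 - real (d k))"
    by linarith
  then show ?thesis using has_euler_imp_betti[OF w(1)] by (simp only: simp_thms)
qed

end
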